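(* For $i=1,2$, let a finitely generated residually finite group $G_i$ act cocompactly on a connected locally finite directed multigraph $X_i$ with finite vertex stabilizers. Let $\mathcal S_i=(Z_{i,\lambda})_{\lambda\in\Lambda}$ be finite labelled families of $G_i$-invariant subgraphs of $X_i$ (with the same finite label set $\Lambda$, possibly empty), and let $\mathfrak P$ be a subgroup of the symmetric group $\mathfrak S_\Lambda$. Fix a continuous isomorphism $\Phi:\widehat G_1\xrightarrow{\cong}\widehat G_2$ and let $\Phi_m:G_1/K_m(G_1)\to G_2/K_m(G_2)$ be the induced isomorphism. Assume either of the following two conditions. (a) There is an increasing unbounded sequence $(m_j)$ and, for every $j$, a $\Phi_{m_j}$-equivariant isomorphism $$F_j:\mathcal D(K_{m_j}(G_1)\backslash X_1)\xrightarrow{\cong}\mathcal D(K_{m_j}(G_2)\backslash X_2)$$ mapping the quotient of $Z_{1,\lambda}$ onto the quotient of $Z_{2,\sigma_j(\lambda)}$ (for all $\lambda$) for some $\sigma_j\in\mathfrak P$. (The maps $F_j$ and the permutations $\sigma_j$ are not required to be compatible with one another.) (b) There are $\sigma\in\mathfrak P$ and a $\Phi$-equivariant isomorphism $F:\widehat{\mathcal D}_{G_1}(X_1)\xrightarrow{\cong}\widehat{\mathcal D}_{G_2}(X_2)$ such that $F(\widehat{\mathcal D}_{G_1}(Z_{1,\lambda}))=\widehat{\mathcal D}_{G_2}(Z_{2,\sigma(\lambda)})$ for all $\lambda\in\Lambda$. Then: under condition (a), such isomorphisms can be selected compatibly at the chosen levels, all with the same permutation $\sigma\in\mathfrak P$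 (the selected maps may differ from the given $F_j$), and their inverse limit is an isomorphism $F$ as in (b). Under either condition there are $u\in\widehat G_2$ and an isomorphism $h:G_1\xrightarrow{\cong}G_2$ such that $$\Phi=\operatorname{Inn}(u)\circ\widehat h.$$ Moreover, $L_{u^{-1}}\circ F$, where $L_{u^{-1}}$ denotes left multiplication by $u^{-1}$ on the completed vertex and directed edge spaces, restricts to an $h$-equivariant directed graph isomorphism $\mathcal D(X_1)\xrightarrow{\cong}\mathcal D(X_2)$ mapping $Z_{1,\lambda}$ onto $Z_{2,\sigma(\lambda)}$ for every $\lambda\in\Lambda$.
   Context: $K_m(G)=\bigcap_{[G:L]\le m}L$ (intersection of all subgroups of index $\le m$); a continuous isomorphism $\Phi:\widehat G_1\to\widehat G_2$ maps $\overline{K_m(G_1)}$ onto $\overline{K_m(G_2)}$, hence induces $\Phi_m$. $\operatorname{Inn}(u)(x)=uxu^{-1}$. A directed multigraph $X$ has a vertex set $V(X)$, directed edge set $A(X)$ and maps $s_X,t_X:A(X)\to V(X)$ (initial, terminal vertex); loops and parallel edges are allowed. Connectedness refers to the underlying undirected multigraph; locally finite means each vertex is incident to finitely many directed edges. If $X$ comes from an undirected graph, both orientations of each geometric edge are included and a reversal involution $a\mapsto\bar a$ without fixed points, exchanging $s$ and $t$, is part of the structure. $\mathcal D(X)=(V(X),A(X),s_X,t_X)$ together with reversal when present; an isomorphism consists of bijections on vertices and directed edges commuting with $s,t$ and reversal when present (homeomorphisms in the profinite case). Groups act by automorphisms preserving this structure. For a group $N$ acting on $X$, $\mathcal D(N\backslash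 X)$ has vertex set $N\backslash V(X)$, edge set $N\backslash A(X)$ with induced maps (induced reversal may have fixed points; distinct edge orbits stay distinct). An invariant subgraph $Z$ is given by invariant subsets $V(Z)\subseteq V(X)$, $A(Z)\subseteq A(X)$ with endpoints of $A(Z)$ in $V(Z)$, and $A(Z)$ closed under reversal when present. Completion: $\widehat{\mathcal D}_G(X)=\varprojlim_m\mathcal D(K_m(G)\backslash X)$, the inverse limit taken on vertices, directed edges and all structure maps, with its $\widehat G$-action; $\widehat{\mathcal D}_G(Z)=\varprojlim_m\mathcal D(K_m(G)\backslash Z)\subseteq\widehat{\mathcal D}_G(X)$. $V(X)$ and $A(X)$ embed canonically in the completed spaces, and "restricts to $\mathcal D(X_1)\to\mathcal D(X_2)$" refers to these embedded copies. Compatibility in (a): for $k\ge j$, an equivariant isomorphism at level $m_k$ descends to a unique equivariant isomorphism at level $m_j$ through the quotient maps; a family $(E_j)$ is compatible if $E_k$ descends to $E_j$ for all $k\ge j$. *)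

theory Defs
  imports
    "HOL-Analysis.Function_Topology"
    "HOL-Algebra.Group_Action"
    "HOL-Algebra.Generated_Groups"
    "HOL-Algebra.Product_Groups"
    "Graph_Theory.Digraph_Component"
begin

section \<open>Groups and profinite completions\<close>

definition finitely_generated :: "('g, 'z) monoid_scheme \<Rightarrow> bool" where
  "finitely_generated G \<longleftrightarrow> (\<exists>S. finite S \<and> S \<subseteq> carrier G \<and> generate G S = carrier G)"

definition residually_finite :: "('g, 'z) monoid_scheme \<Rightarrow> bool" where
  "residually_finite G \<longleftrightarrow>
     (\<forall>g\<in>carrier G - {\<one>\<^bsub>G\<^esub>}. \<exists>N. N \<lhd> G \<and> finite (rcosets\<^bsub>G\<^esub> N) \<and> g \<notin> N)"

text \<open>The intersection is taken inside \<^term>\<open>carrier G\<close>, so that the value at 0, where no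
  subgroup qualifies, is \<^term>\<open>carrier G\<close>, the same as the value at 1.\<close>

definition K :: "('g, 'z) monoid_scheme \<Rightarrow> nat \<Rightarrow> 'g set" where
  "K G m = carrier G \<inter>
     \<Inter>{H. subgroup H G \<and> finite (rcosets\<^bsub>G\<^esub> H) \<and> card (rcosets\<^bsub>G\<^esub> H) \<le> m}"

text \<open>Inverse limit of the sets \<open>X i\<close> over an index set ordered by \<open>below\<close>. In all uses below
  the transition map \<open>X j \<rightarrow> X i\<close> is given by a formula \<open>t i\<close> depending only on its target.\<close>

definition inverse_limit ::
  "'i set \<Rightarrow> ('i \<Rightarrow> 'i \<Rightarrow> bool) \<Rightarrow> ('i \<Rightarrow> 'x set) \<Rightarrow> ('i \<Rightarrow> 'x \<Rightarrow> 'x) \<Rightarrow> ('i \<Rightarrow> 'x) set" where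
  "inverse_limit I below X t =
     {x \<in> \<Pi>\<^sub>E i\<in>I. X i. \<forall>i\<in>I. \<forall>j\<in>I. below i j \<longrightarrow> t i (x j) = x i}"

definition limit_topology ::
  "'i set \<Rightarrow> ('i \<Rightarrow> 'i \<Rightarrow> bool) \<Rightarrow> ('i \<Rightarrow> 'x set) \<Rightarrow> ('i \<Rightarrow> 'x \<Rightarrow> 'x) \<Rightarrow> ('i \<Rightarrow> 'x) topology" where
  "limit_topology I below X t =
     subtopology (product_topology (\<lambda>i. discrete_topology (X i)) I) (inverse_limit I below X t)"

definition fin_normal :: "('g, 'z) monoid_scheme \<Rightarrow> 'g set set" where
  "fin_normal G = {N. N \<lhd> G \<and> finite (rcosets\<^bsub>G\<^esub> N)}"

text \<open>For \<open>M \<subseteq> N\<close> the projection \<open>G/M \<rightarrow> G/N\<close> sends a coset \<open>C\<close> to the set product \<open>N C\<close>.\<close>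

definition profinite_completion :: "('g, 'z) monoid_scheme \<Rightarrow> ('g set \<Rightarrow> 'g set) monoid" where
  "profinite_completion G =
     (product_group (fin_normal G) (\<lambda>N. G Mod N))
       \<lparr>carrier := inverse_limit (fin_normal G) (\<lambda>N M. M \<subseteq> N)
                    (\<lambda>N. carrier (G Mod N)) (\<lambda>N C. N <#>\<^bsub>G\<^esub> C)\<rparr>"

definition profinite_topology :: "('g, 'z) monoid_scheme \<Rightarrow> ('g set \<Rightarrow> 'g set) topology" where
  "profinite_topology G =
     limit_topology (fin_normal G) (\<lambda>N M. M \<subseteq> N)
       (\<lambda>N. carrier (G Mod N)) (\<lambda>N C. N <#>\<^bsub>G\<^esub> C)"

text \<open>The continuous extension of a homomorphism \<open>h\<close>: on the component at \<open>N\<close> it is the map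
  \<open>G/h\<^sup>-\<^sup>1(N) \<rightarrow> H/N\<close> induced by \<open>h\<close>.\<close>

definition completed_hom ::
  "('g, 'y) monoid_scheme \<Rightarrow> ('h, 'z) monoid_scheme \<Rightarrow> ('g \<Rightarrow> 'h)
    \<Rightarrow> ('g set \<Rightarrow> 'g set) \<Rightarrow> ('h set \<Rightarrow> 'h set)" where
  "completed_hom G H h x = (\<lambda>N\<in>fin_normal H. N <#>\<^bsub>H\<^esub> (h ` x {g \<in> carrier G. h g \<in> N}))"

definition Inn :: "('g, 'z) monoid_scheme \<Rightarrow> 'g \<Rightarrow> 'g \<Rightarrow> 'g" where
  "Inn G u x = u \<otimes>\<^bsub>G\<^esub> x \<otimes>\<^bsub>G\<^esub> inv\<^bsub>G\<^esub> u"

text \<open>The isomorphism \<open>G/K\<^sub>m(G) \<rightarrow> H/K\<^sub>m(H)\<close> induced by \<open>\<Phi>\<close>, where these quotients are identified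
  with the quotients of the completions by the closures of \<open>K\<^sub>m\<close>, that is, the class of \<open>x\<close> is
  the component \<open>x (K G m)\<close>.\<close>

definition induced_quotient_map ::
  "('g, 'y) monoid_scheme \<Rightarrow> ('h, 'z) monoid_scheme \<Rightarrow> (('g set \<Rightarrow> 'g set) \<Rightarrow> ('h set \<Rightarrow> 'h set))
    \<Rightarrow> nat \<Rightarrow> 'g set \<Rightarrow> 'h set" where
  "induced_quotient_map G H \<Phi> m C =
     (THE D. \<forall>x\<in>carrier (profinite_completion G). x (K G m) = C \<longrightarrow> \<Phi> x (K H m) = D)"

section \<open>Directed multigraphs with group actions\<close>

record ('v, 'a) multigraph = "('v, 'a) pre_digraph" +
  reversal :: "('a \<Rightarrow> 'a) option"

record ('g, 'v, 'a) group_graph = "('v, 'a) multigraph" +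
  vact :: "'g \<Rightarrow> 'v \<Rightarrow> 'v"
  aact :: "'g \<Rightarrow> 'a \<Rightarrow> 'a"

definition directed_multigraph :: "('v, 'a, 'z) multigraph_scheme \<Rightarrow> bool" where
  "directed_multigraph X \<longleftrightarrow>
     wf_digraph (pre_digraph.truncate X) \<and>
     (\<forall>r. reversal X = Some r \<longrightarrow>
        (\<forall>a\<in>arcs X. r a \<in> arcs X \<and> r (r a) = a \<and> r a \<noteq> a \<and>
           tail X (r a) = head X a \<and> head X (r a) = tail X a))"

definition connected_multigraph :: "('v, 'a, 'z) multigraph_scheme \<Rightarrow> bool" where
  "connected_multigraph X \<longleftrightarrow> Digraph_Component.connected (pre_digraph.truncate X)"

definition locally_finite :: "('v, 'a, 'z) multigraph_scheme \<Rightarrow> bool" where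
  "locally_finite X \<longleftrightarrow> (\<forall>v\<in>verts X. finite {a \<in> arcs X. tail X a = v \<or> head X a = v})"

definition acts_on_graph ::
  "('g, 'y) monoid_scheme \<Rightarrow> ('g, 'v, 'a, 'z) group_graph_scheme \<Rightarrow> bool" where
  "acts_on_graph G X \<longleftrightarrow>
     group_action G (verts X) (vact X) \<and> group_action G (arcs X) (aact X) \<and>
     (\<forall>g\<in>carrier G. \<forall>a\<in>arcs X.
        tail X (aact X g a) = vact X g (tail X a) \<and>
        head X (aact X g a) = vact X g (head X a) \<and>
        (\<forall>r. reversal X = Some r \<longrightarrow> r (aact X g a) = aact X g (r a)))"

definition cocompact ::
  "('g, 'y) monoid_scheme \<Rightarrow> ('g, 'v, 'a, 'z) group_graph_scheme \<Rightarrow> bool" where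
  "cocompact G X \<longleftrightarrow> finite (orbits G (verts X) (vact X)) \<and> finite (orbits G (arcs X) (aact X))"

definition finite_vertex_stabilizers ::
  "('g, 'y) monoid_scheme \<Rightarrow> ('g, 'v, 'a, 'z) group_graph_scheme \<Rightarrow> bool" where
  "finite_vertex_stabilizers G X \<longleftrightarrow> (\<forall>v\<in>verts X. finite (stabilizer G (vact X) v))"

text \<open>A subgraph is represented by the pair of its vertex and edge sets.\<close>

definition invariant_subgraph ::
  "('g, 'y) monoid_scheme \<Rightarrow> ('g, 'v, 'a, 'z) group_graph_scheme \<Rightarrow> 'v set \<times> 'a set \<Rightarrow> bool" where
  "invariant_subgraph G X Z \<longleftrightarrow>
     fst Z \<subseteq> verts X \<and> snd Z \<subseteq> arcs X \<and>
     (\<forall>g\<in>carrier G. vact X g ` fst Z \<subseteq> fst Z \<and> aact X g ` snd Z \<subseteq> snd Z) \<and>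
     (\<forall>a\<in>snd Z. tail X a \<in> fst Z \<and> head X a \<in> fst Z) \<and>
     (\<forall>r. reversal X = Some r \<longrightarrow> r ` snd Z \<subseteq> snd Z)"

definition sub ::
  "('g, 'v, 'a) group_graph \<Rightarrow> 'v set \<times> 'a set \<Rightarrow> ('g, 'v, 'a) group_graph" where
  "sub X Z = X\<lparr>verts := fst Z, arcs := snd Z\<rparr>"

text \<open>Whether a reversal is present is part of the structure, so it has to agree.\<close>

definition graph_iso ::
  "('v, 'a, 'y) multigraph_scheme \<Rightarrow> ('w, 'b, 'z) multigraph_scheme
    \<Rightarrow> ('v \<Rightarrow> 'w) \<Rightarrow> ('a \<Rightarrow> 'b) \<Rightarrow> bool" where
  "graph_iso X Y fv fa \<longleftrightarrow>
     bij_betw fv (verts X) (verts Y) \<and> bij_betw fa (arcs X) (arcs Y) \<and>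
     (\<forall>a\<in>arcs X. tail Y (fa a) = fv (tail X a) \<and> head Y (fa a) = fv (head X a)) \<and>
     (case (reversal X, reversal Y) of
        (None, None) \<Rightarrow> True
      | (Some r, Some r') \<Rightarrow> (\<forall>a\<in>arcs X. r' (fa a) = fa (r a))
      | _ \<Rightarrow> False)"

definition equivariant ::
  "'c set \<Rightarrow> ('c \<Rightarrow> 'd) \<Rightarrow> ('c \<Rightarrow> 'x \<Rightarrow> 'x) \<Rightarrow> ('d \<Rightarrow> 'y \<Rightarrow> 'y) \<Rightarrow> 'x set \<Rightarrow> ('x \<Rightarrow> 'y) \<Rightarrow> bool" where
  "equivariant C \<theta> \<alpha> \<beta> S f \<longleftrightarrow> (\<forall>c\<in>C. \<forall>x\<in>S. f (\<alpha> c x) = \<beta> (\<theta> c) (f x))"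

section \<open>Quotient graphs and completed graphs\<close>

text \<open>The set \<open>C \<cdot> S\<close>. If \<open>S\<close> is an orbit of a normal subgroup \<open>N\<close>, this is the action of a coset
  \<open>C\<close> of \<open>N\<close> on \<open>S\<close>; if \<open>C\<close> is a subgroup containing \<open>N\<close>, it is the image of \<open>S\<close> under the
  projection from \<open>N\<close>-orbits to \<open>C\<close>-orbits.\<close>

definition set_act :: "('g \<Rightarrow> 'x \<Rightarrow> 'x) \<Rightarrow> 'g set \<Rightarrow> 'x set \<Rightarrow> 'x set" where
  "set_act \<phi> C S = (\<Union>g\<in>C. \<phi> g ` S)"

text \<open>The induced structure maps are given by taking images, as \<open>s(N a) = N s(a)\<close> and so on.\<close>

definition quotient_graph ::
  "('g, 'y) monoid_scheme \<Rightarrow> 'g set \<Rightarrow> ('g, 'v, 'a, 'z) group_graph_scheme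
    \<Rightarrow> ('v set, 'a set) multigraph" where
  "quotient_graph G N X =
     \<lparr>verts = orbits (G\<lparr>carrier := N\<rparr>) (verts X) (vact X),
      arcs = orbits (G\<lparr>carrier := N\<rparr>) (arcs X) (aact X),
      tail = (\<lambda>A. tail X ` A),
      head = (\<lambda>A. head X ` A),
      reversal = map_option (\<lambda>r A. r ` A) (reversal X)\<rparr>"

definition completed_graph ::
  "('g, 'y) monoid_scheme \<Rightarrow> ('g, 'v, 'a, 'z) group_graph_scheme
    \<Rightarrow> (nat \<Rightarrow> 'v set, nat \<Rightarrow> 'a set) multigraph" where
  "completed_graph G X =
     \<lparr>verts = inverse_limit UNIV (\<le>) (\<lambda>m. verts (quotient_graph G (K G m) X))
                (\<lambda>m. set_act (vact X) (K G m)),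
      arcs = inverse_limit UNIV (\<le>) (\<lambda>m. arcs (quotient_graph G (K G m) X))
                (\<lambda>m. set_act (aact X) (K G m)),
      tail = (\<lambda>a m. tail (quotient_graph G (K G m) X) (a m)),
      head = (\<lambda>a m. head (quotient_graph G (K G m) X) (a m)),
      reversal = map_option (\<lambda>r a m. r ` a m) (reversal X)\<rparr>"

definition completed_verts_topology ::
  "('g, 'y) monoid_scheme \<Rightarrow> ('g, 'v, 'a, 'z) group_graph_scheme \<Rightarrow> (nat \<Rightarrow> 'v set) topology" where
  "completed_verts_topology G X =
     limit_topology UNIV (\<le>) (\<lambda>m. verts (quotient_graph G (K G m) X))
       (\<lambda>m. set_act (vact X) (K G m))"

definition completed_arcs_topology ::
  "('g, 'y) monoid_scheme \<Rightarrow> ('g, 'v, 'a, 'z) group_graph_scheme \<Rightarrow> (nat \<Rightarrow> 'a set) topology" where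
  "completed_arcs_topology G X =
     limit_topology UNIV (\<le>) (\<lambda>m. arcs (quotient_graph G (K G m) X))
       (\<lambda>m. set_act (aact X) (K G m))"

text \<open>The action of the profinite completion on completed vertices (\<open>\<phi> = vact X\<close>) or edges
  (\<open>\<phi> = aact X\<close>); at level \<open>m\<close> it is the action of \<open>G/K\<^sub>m(G)\<close>.\<close>

definition completed_act ::
  "('g, 'y) monoid_scheme \<Rightarrow> ('g \<Rightarrow> 'x \<Rightarrow> 'x) \<Rightarrow> ('g set \<Rightarrow> 'g set) \<Rightarrow> (nat \<Rightarrow> 'x set) \<Rightarrow> (nat \<Rightarrow> 'x set)"
  where "completed_act G \<phi> x p = (\<lambda>m. set_act \<phi> (x (K G m)) (p m))"

text \<open>The canonical map from vertices or edges to completed vertices or edges.\<close>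

definition embed :: "('g, 'y) monoid_scheme \<Rightarrow> ('g \<Rightarrow> 'x \<Rightarrow> 'x) \<Rightarrow> 'x \<Rightarrow> (nat \<Rightarrow> 'x set)" where
  "embed G \<phi> p = (\<lambda>m. Group_Action.orbit (G\<lparr>carrier := K G m\<rparr>) \<phi> p)"

section \<open>Isomorphisms at finite levels and of completed graphs\<close>

definition level_iso where
  "level_iso G1 G2 \<Phi> X1 X2 \<Lambda> Z1 Z2 m \<sigma> fv fa \<longleftrightarrow>
     (let D1 = (\<lambda>Y. quotient_graph G1 (K G1 m) Y);
          D2 = (\<lambda>Y. quotient_graph G2 (K G2 m) Y);
          Q1 = carrier (G1 Mod K G1 m);
          \<Phi>\<^sub>m = induced_quotient_map G1 G2 \<Phi> m
      in graph_iso (D1 X1) (D2 X2) fv fa \<and>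
         equivariant Q1 \<Phi>\<^sub>m (set_act (vact X1)) (set_act (vact X2)) (verts (D1 X1)) fv \<and>
         equivariant Q1 \<Phi>\<^sub>m (set_act (aact X1)) (set_act (aact X2)) (arcs (D1 X1)) fa \<and>
         (\<forall>l\<in>\<Lambda>. fv ` verts (D1 (sub X1 (Z1 l))) = verts (D2 (sub X2 (Z2 (\<sigma> l)))) \<and>
                fa ` arcs (D1 (sub X1 (Z1 l))) = arcs (D2 (sub X2 (Z2 (\<sigma> l))))))"

definition completed_iso where
  "completed_iso G1 G2 \<Phi> X1 X2 \<Lambda> Z1 Z2 \<sigma> Fv Fa \<longleftrightarrow>
     (let D1 = (\<lambda>Y. completed_graph G1 Y);
          D2 = (\<lambda>Y. completed_graph G2 Y);
          Q1 = carrier (profinite_completion G1)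
      in graph_iso (D1 X1) (D2 X2) Fv Fa \<and>
         homeomorphic_map (completed_verts_topology G1 X1) (completed_verts_topology G2 X2) Fv \<and>
         homeomorphic_map (completed_arcs_topology G1 X1) (completed_arcs_topology G2 X2) Fa \<and>
         equivariant Q1 \<Phi> (completed_act G1 (vact X1)) (completed_act G2 (vact X2))
           (verts (D1 X1)) Fv \<and>
         equivariant Q1 \<Phi> (completed_act G1 (aact X1)) (completed_act G2 (aact X2))
           (arcs (D1 X1)) Fa \<and>
         (\<forall>l\<in>\<Lambda>. Fv ` verts (D1 (sub X1 (Z1 l))) = verts (D2 (sub X2 (Z2 (\<sigma> l)))) \<and>
                Fa ` arcs (D1 (sub X1 (Z1 l))) = arcs (D2 (sub X2 (Z2 (\<sigma> l))))))"

text \<open>\<open>E\<close> at level \<open>m\<close> descends to \<open>E'\<close> at level \<open>m' \<le> m\<close> through the quotient maps.\<close>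

definition descends where
  "descends G1 G2 X1 X2 m Ev Ea m' Ev' Ea' \<longleftrightarrow>
     (\<forall>p\<in>verts (quotient_graph G1 (K G1 m) X1).
        Ev' (set_act (vact X1) (K G1 m') p) = set_act (vact X2) (K G2 m') (Ev p)) \<and>
     (\<forall>p\<in>arcs (quotient_graph G1 (K G1 m) X1).
        Ea' (set_act (aact X1) (K G1 m') p) = set_act (aact X2) (K G2 m') (Ea p))"

text \<open>\<open>F\<close> is the inverse limit of the maps \<open>E j\<close> at the levels \<open>ms j\<close>, that is, it induces all
  of them; for unbounded \<open>ms\<close> this determines a map into the completed graph.\<close>

definition is_limit_of where
  "is_limit_of G1 X1 ms Ev Ea Fv Fa \<longleftrightarrow>
     (\<forall>p\<in>verts (completed_graph G1 X1). \<forall>j::nat. Fv p (ms j) = Ev j (p (ms j))) \<and>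
     (\<forall>p\<in>arcs (completed_graph G1 X1). \<forall>j::nat. Fa p (ms j) = Ea j (p (ms j)))"

text \<open>The conclusion for a given isomorphism \<open>F\<close> of completed graphs.\<close>

definition discretizes where
  "discretizes G1 G2 \<Phi> X1 X2 \<Lambda> Z1 Z2 \<sigma> Fv Fa \<longleftrightarrow>
     (\<exists>u\<in>carrier (profinite_completion G2). \<exists>h\<in>iso G1 G2.
        (\<forall>x\<in>carrier (profinite_completion G1).
           \<Phi> x = Inn (profinite_completion G2) u (completed_hom G1 G2 h x)) \<and>
        (\<exists>fv fa.
           (\<forall>v\<in>verts X1.
              completed_act G2 (vact X2) (inv\<^bsub>profinite_completion G2\<^esub> u) (Fv (embed G1 (vact X1) v))
                = embed G2 (vact X2) (fv v)) \<and>
           (\<forall>a\<in>arcs X1.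
              completed_act G2 (aact X2) (inv\<^bsub>profinite_completion G2\<^esub> u) (Fa (embed G1 (aact X1) a))
                = embed G2 (aact X2) (fa a)) \<and>
           graph_iso X1 X2 fv fa \<and>
           equivariant (carrier G1) h (vact X1) (vact X2) (verts X1) fv \<and>
           equivariant (carrier G1) h (aact X1) (aact X2) (arcs X1) fa \<and>
           (\<forall>l\<in>\<Lambda>. fv ` fst (Z1 l) = fst (Z2 (\<sigma> l)) \<and> fa ` snd (Z1 l) = snd (Z2 (\<sigma> l)))))"

end

theory Submission
  imports Defs "HOL-Library.Diagonal_Subsequence"
begin

text \<open>Since vertex stabilizers are finite and \<open>G\<close> is residually finite, \<open>X\<close> embeds into its
  completion, and a vertex of \<open>X\<close> is fixed in the profinite completion only by its stabilizer in
  \<open>G\<close>. Local finiteness then shows that \<open>X\<close> is a connected component of the completed graph, that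
  all components are translates of \<open>X\<close>, and that the setwise stabilizer of \<open>X\<close> is \<open>G\<close>. An
  equivariant isomorphism \<open>F\<close> therefore maps \<open>X1\<close> onto some translate \<open>u X2\<close>; after multiplying
  with \<open>u\<^sup>-\<^sup>1\<close> it maps \<open>X1\<close> onto \<open>X2\<close> and conjugates the stabilizer \<open>G1\<close> into \<open>G2\<close>, which yields
  \<open>h\<close>, and continuity gives \<open>\<Phi> = Inn(u) \<circ> h\<close> on the completion. Under condition (a) an equivariant isomorphism at
  a high level descends to all lower levels, where there are only finitely many candidates, so a
  diagonal argument makes the choices compatible.\<close>

section \<open>Subgroups of finite index\<close>

text \<open>Two finiteness principles replace compactness. When the candidates form one fixed finite
  set (the elements carrying \<open>v\<close> to \<open>w\<close>, the edges at a vertex) and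
  validity passes to lower levels, a candidate at each level gives a single candidate for all
  levels; this is how an identity in the completion is brought back to the group or the graph. When
  the candidates vary with the level (cosets of \<open>K G m\<close>, maps between finite
  quotients), a diagonal sequence is used. The completion is indexed by all normal subgroups of
  finite index, the graphs only by the \<open>K G m\<close>. Finite generation puts each
  \<open>K G m\<close> among these subgroups and the index bound makes them cofinal, so both towers
  have the same limit. That \<Phi> acts level by level has to be proved: continuity together with
  the density of \<open>G1\<close> reduces it to an index count for preimages of subgroups. Under
  (a), descending an isomorphism gives at first only a surjection at the lower level. Its
  injectivity is a matter of counting, and the equality of the two cardinalities is supplied by the
  isomorphism already given there; this is the use made of the unrelated maps at lower
  levels.\<close>

context group
begin

lemma inv_mult_cancel: "\<lbrakk>x \<in> carrier G; y \<in> carrier G\<rbrakk> \<Longrightarrow> inv x \<otimes> (x \<otimes> y) = y"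
  by (simp add: m_assoc[symmetric])

lemma mem_rcosets_iff: "C \<in> rcosets N \<longleftrightarrow> (\<exists>g\<in>carrier G. C = N #> g)"
  by (auto simp: RCOSETS_def)

lemma r_coset_in_rcosets: "g \<in> carrier G \<Longrightarrow> N #> g \<in> rcosets N"
  by (auto simp: mem_rcosets_iff)

lemma r_coset_eq_iff:
  assumes "subgroup H G" "a \<in> carrier G" "b \<in> carrier G"
  shows "H #> a = H #> b \<longleftrightarrow> a \<otimes> inv b \<in> H"
proof -
  interpret H: subgroup H G by fact
  have "H #> a = H #> b \<longleftrightarrow> a \<in> H #> b"
    using assms rcos_self repr_independence by metis
  then show ?thesis
    using assms H.rcos_module[OF is_group] by simp
qed

text \<open>Since equal labels force equal cosets, a coset of \<open>L\<close> can be read off from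
  the label of any of its elements, so the labels map onto the cosets. This bounds the index of
  intersections, conjugates and preimages of subgroups by one argument.\<close>

lemma index_le_cardI:
  assumes L: "subgroup L G" and S: "finite S" and c: "c ` carrier G \<subseteq> S"
    and inj: "\<And>a b. \<lbrakk>a \<in> carrier G; b \<in> carrier G; c a = c b\<rbrakk> \<Longrightarrow> a \<otimes> inv b \<in> L"
  shows "finite (rcosets L)" "card (rcosets L) \<le> card S"
proof -
  define r where "r C = L #> (SOME g. g \<in> carrier G \<and> c g = C)" for C
  have r: "r (c g) = L #> g" if "g \<in> carrier G" for g
  proof -
    have "(SOME h. h \<in> carrier G \<and> c h = c g) \<in> carrier G \<and> c (SOME h. h \<in> carrier G \<and> c h = c g) = c g"
      by (rule someI[of "\<lambda>h. h \<in> carrier G \<and> c h = c g" g]) (simp add: that)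
    then show ?thesis
      unfolding r_def using that L inj by (simp add: r_coset_eq_iff)
  qed
  have sub: "rcosets L \<subseteq> r ` S"
  proof
    fix C assume "C \<in> rcosets L"
    then obtain g where "g \<in> carrier G" "C = L #> g" by (auto simp: mem_rcosets_iff)
    then show "C \<in> r ` S" using r[of g] c by (metis image_eqI image_subset_iff)
  qed
  show "finite (rcosets L)" using sub S finite_surj by blast
  show "card (rcosets L) \<le> card S" using sub S surj_card_le by blast
qed

lemma finite_rcosets_Int:
  assumes "subgroup H G" "subgroup J G" "finite (rcosets H)" "finite (rcosets J)"
  shows "finite (rcosets (H \<inter> J))"
proof (rule index_le_cardI(1))
  show "subgroup (H \<inter> J) G" using assms by (simp add: subgroups_Inter_pair)
  show "finite ((rcosets H) \<times> (rcosets J))" using assms by simp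
  show "(\<lambda>g. (H #> g, J #> g)) ` carrier G \<subseteq> (rcosets H) \<times> (rcosets J)"
    using assms by (auto simp: mem_rcosets_iff)
qed (use assms in \<open>auto simp: r_coset_eq_iff\<close>)

lemma rcosets_carrier: "rcosets (carrier G) = {carrier G}"
  using coset_join2[OF _ subgroup_self] by (auto simp: RCOSETS_def)

lemma finite_rcosets_Inter:
  assumes "finite \<H>" "\<And>H. H \<in> \<H> \<Longrightarrow> subgroup H G \<and> finite (rcosets H)"
  shows "subgroup (carrier G \<inter> \<Inter>\<H>) G \<and> finite (rcosets (carrier G \<inter> \<Inter>\<H>))"
  using assms
proof (induction)
  case empty
  then show ?case by (simp add: subgroup_self rcosets_carrier)
next
  case (insert H \<H>)
  have eq: "carrier G \<inter> \<Inter>(insert H \<H>) = H \<inter> (carrier G \<inter> \<Inter>\<H>)" by auto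
  show ?case
    unfolding eq using insert by (simp add: subgroups_Inter_pair finite_rcosets_Int)
qed

text \<open>A subgroup \<open>H\<close> of index at most \<open>m\<close> is determined by its Schreier graph: number its cosets by
  \<open>c : G \<rightarrow> {..<m}\<close> and record, for each generator \<open>s\<close>, the relation \<open>{(c g, c (g s))}\<close>.\<close>

lemma schreier_relation_eq:
  fixes c c' :: "'a \<Rightarrow> 'z"
  assumes S: "S \<subseteq> carrier G"
    and H: "\<And>a b g. \<lbrakk>a \<in> carrier G; b \<in> carrier G; g \<in> carrier G; c a = c b\<rbrakk> \<Longrightarrow> c (a \<otimes> g) = c (b \<otimes> g)"
    and H': "\<And>a b g. \<lbrakk>a \<in> carrier G; b \<in> carrier G; g \<in> carrier G; c' a = c' b\<rbrakk> \<Longrightarrow> c' (a \<otimes> g) = c' (b \<otimes> g)"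
    and im: "c ` carrier G = c' ` carrier G"
    and gen: "\<And>s. s \<in> S \<Longrightarrow> {(c a, c (a \<otimes> s)) | a. a \<in> carrier G} = {(c' a, c' (a \<otimes> s)) | a. a \<in> carrier G}"
    and "g \<in> generate G S"
  shows "{(c a, c (a \<otimes> g)) | a. a \<in> carrier G} = {(c' a, c' (a \<otimes> g)) | a. a \<in> carrier G}"
  using \<open>g \<in> generate G S\<close>
proof (induction)
  case one
  have id: "{(d a, d (a \<otimes> \<one>)) | a. a \<in> carrier G} = Id_on (d ` carrier G)" for d :: "'a \<Rightarrow> 'z"
    by (auto simp: Id_on_def)
  show ?case unfolding id im ..
next
  case (incl h)
  then show ?case by (rule gen)
next
  case (inv h)
  then have h: "h \<in> carrier G" using S by auto
  \<comment> \<open>Inverting the group element converts the relation, and multiplying two elements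
    composes their relations.\<close>
  have conv: "{(d a, d (a \<otimes> inv h)) | a. a \<in> carrier G} = {(d a, d (a \<otimes> h)) | a. a \<in> carrier G}\<inverse>"
    for d :: "'a \<Rightarrow> 'z"
  proof (intro equalityI subsetI)
    fix p assume "p \<in> {(d a, d (a \<otimes> inv h)) | a. a \<in> carrier G}"
    then obtain a where a: "a \<in> carrier G" "p = (d a, d (a \<otimes> inv h))" by blast
    then have "p = (d ((a \<otimes> inv h) \<otimes> h), d (a \<otimes> inv h))" "a \<otimes> inv h \<in> carrier G"
      using h by (simp_all add: m_assoc)
    then show "p \<in> {(d a, d (a \<otimes> h)) | a. a \<in> carrier G}\<inverse>" by blast
  next
    fix p assume "p \<in> {(d a, d (a \<otimes> h)) | a. a \<in> carrier G}\<inverse>"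
    then obtain a where a: "a \<in> carrier G" "p = (d (a \<otimes> h), d a)" by blast
    then have "p = (d (a \<otimes> h), d ((a \<otimes> h) \<otimes> inv h))" "a \<otimes> h \<in> carrier G"
      using h by (simp_all add: m_assoc)
    then show "p \<in> {(d a, d (a \<otimes> inv h)) | a. a \<in> carrier G}" by blast
  qed
  show ?case unfolding conv gen[OF inv] ..
next
  case (eng h1 h2)
  then have h: "h1 \<in> carrier G" "h2 \<in> carrier G"
    using S generate_in_carrier by auto
  \<comment> \<open>The composite supplies some \<open>b\<close> that merely has the same label as
    \<open>a \<otimes> h1\<close>; right multiplication by \<open>h2\<close> respects equality of
    labels, so \<open>b\<close> may be replaced.\<close>
  have comp: "{(d a, d (a \<otimes> (h1 \<otimes> h2))) | a. a \<in> carrier G}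
      = {(d a, d (a \<otimes> h1)) | a. a \<in> carrier G} O {(d a, d (a \<otimes> h2)) | a. a \<in> carrier G}"
    if d: "\<And>a b g. \<lbrakk>a \<in> carrier G; b \<in> carrier G; g \<in> carrier G; d a = d b\<rbrakk> \<Longrightarrow> d (a \<otimes> g) = d (b \<otimes> g)"
    for d :: "'a \<Rightarrow> 'z"
  proof (intro equalityI subsetI)
    fix p assume "p \<in> {(d a, d (a \<otimes> (h1 \<otimes> h2))) | a. a \<in> carrier G}"
    then obtain a where a: "a \<in> carrier G" "p = (d a, d ((a \<otimes> h1) \<otimes> h2))"
      using h by (auto simp: m_assoc)
    moreover have "a \<otimes> h1 \<in> carrier G" using a h by simp
    ultimately show "p \<in> {(d a, d (a \<otimes> h1)) | a. a \<in> carrier G} O {(d a, d (a \<otimes> h2)) | a. a \<in> carrier G}"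
      by blast
  next
    fix p assume "p \<in> {(d a, d (a \<otimes> h1)) | a. a \<in> carrier G} O {(d a, d (a \<otimes> h2)) | a. a \<in> carrier G}"
    then obtain a b where ab: "a \<in> carrier G" "b \<in> carrier G" "d (a \<otimes> h1) = d b" "p = (d a, d (b \<otimes> h2))"
      by auto
    then have "p = (d a, d (a \<otimes> (h1 \<otimes> h2)))"
      using d[of "a \<otimes> h1" b h2] h by (simp add: m_assoc)
    then show "p \<in> {(d a, d (a \<otimes> (h1 \<otimes> h2))) | a. a \<in> carrier G}" using ab by blast
  qed
  show ?case using comp[of c, OF H] comp[of c', OF H'] unfolding eng.IH by (rule trans[OF _ sym])
qed

text \<open>This makes \<open>K G m\<close> a finite intersection, hence itself of finite index. The
  relations of finitely many generators determine those of all elements, so each subgroup receives a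
  code from a finite set.\<close>

lemma finite_subgroups_index_le:
  assumes "finitely_generated G"
  shows "finite {H. subgroup H G \<and> finite (rcosets H) \<and> card (rcosets H) \<le> m}" (is "finite ?\<H>")
proof -
  obtain S where S: "finite S" "S \<subseteq> carrier G" "generate G S = carrier G"
    using assms by (auto simp: finitely_generated_def)
  have "\<exists>c :: 'a \<Rightarrow> nat. c ` carrier G \<subseteq> {..<m} \<and>
      (\<forall>a\<in>carrier G. \<forall>b\<in>carrier G. c a = c b \<longleftrightarrow> H #> a = H #> b)" if "H \<in> ?\<H>" for H
  proof -
    have "finite (rcosets H)" "card (rcosets H) \<le> card {..<m}" using that by simp_all
    then obtain e where e: "e ` (rcosets H) \<subseteq> {..<m}" "inj_on e (rcosets H)"
      using card_le_inj[of "rcosets H" "{..<m}"] by blast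
    have "(\<lambda>g. e (H #> g)) ` carrier G \<subseteq> {..<m}"
      using e(1) r_coset_in_rcosets by (meson image_subset_iff)
    moreover have "e (H #> a) = e (H #> b) \<longleftrightarrow> H #> a = H #> b" if "a \<in> carrier G" "b \<in> carrier G" for a b
      using that e(2) r_coset_in_rcosets by (metis inj_on_eq_iff)
    ultimately show ?thesis by blast
  qed
  then have "\<forall>H\<in>?\<H>. \<exists>c :: 'a \<Rightarrow> nat. c ` carrier G \<subseteq> {..<m} \<and>
      (\<forall>a\<in>carrier G. \<forall>b\<in>carrier G. c a = c b \<longleftrightarrow> H #> a = H #> b)" by (rule ballI)
  from bchoice[OF this] obtain c :: "'a set \<Rightarrow> 'a \<Rightarrow> nat" where
    c_all: "\<forall>H\<in>?\<H>. c H ` carrier G \<subseteq> {..<m} \<and>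
      (\<forall>a\<in>carrier G. \<forall>b\<in>carrier G. c H a = c H b \<longleftrightarrow> H #> a = H #> b)" ..
  have c: "c H ` carrier G \<subseteq> {..<m}" if "H \<in> ?\<H>" for H
    using bspec[OF c_all that] ..
  have c_eq: "c H a = c H b \<longleftrightarrow> H #> a = H #> b" if "H \<in> ?\<H>" "a \<in> carrier G" "b \<in> carrier G" for H a b
    using bspec[OF c_all that(1)] that(2,3) by blast
  define R where "R H g = {(c H a, c H (a \<otimes> g)) | a. a \<in> carrier G}" for H g
  \<comment> \<open>The code of \<open>H\<close>: the label of the coset \<open>H\<close> itself as
    base point, the labels in use, and the edges of the Schreier graph for each generator.\<close>
  define f where "f H = (c H \<one>, c H ` carrier G, \<lambda>s\<in>S. R H s)" for H
  have c_mult: "c H (a \<otimes> g) = c H (b \<otimes> g)"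
    if "H \<in> ?\<H>" "a \<in> carrier G" "b \<in> carrier G" "g \<in> carrier G" "c H a = c H b" for H a b g
  proof -
    have "H #> a = H #> b" using that c_eq by simp
    then have "H #> a #> g = H #> b #> g" by simp
    moreover have "H \<subseteq> carrier G" using that subgroup.subset by auto
    ultimately show ?thesis using that c_eq by (simp add: coset_mult_assoc)
  qed
  \<comment> \<open>\<open>H\<close> is the stabilizer of the base label under right multiplication,
    so the base label and the relations \<open>R H g\<close> recover it.\<close>
  have mem: "g \<in> H \<longleftrightarrow> g \<in> carrier G \<and> (c H \<one>, c H \<one>) \<in> R H g" if H: "H \<in> ?\<H>" for H g
  proof -
    have sg: "subgroup H G" using H by simp
    have c1: "c H a = c H \<one> \<longleftrightarrow> a \<in> H" if "a \<in> carrier G" for a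
      using that H sg by (simp add: c_eq r_coset_eq_iff)
    show ?thesis
    proof
      assume g: "g \<in> H"
      then have gc: "g \<in> carrier G" using sg by (simp add: subgroup.mem_carrier)
      then have "c H (\<one> \<otimes> g) = c H \<one>" using c1[OF gc] g by simp
      then have "(c H \<one>, c H \<one>) = (c H \<one>, c H (\<one> \<otimes> g)) \<and> \<one> \<in> carrier G" by simp
      then show "g \<in> carrier G \<and> (c H \<one>, c H \<one>) \<in> R H g" unfolding R_def using gc by blast
    next
      assume g: "g \<in> carrier G \<and> (c H \<one>, c H \<one>) \<in> R H g"
      then obtain a where "a \<in> carrier G" "c H \<one> = c H a" "c H \<one> = c H (a \<otimes> g)"
        unfolding R_def by blast
      with g have a: "g \<in> carrier G" "a \<in> carrier G" "c H a = c H \<one>" "c H (a \<otimes> g) = c H \<one>"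
        by simp_all
      then have "a \<in> H" "a \<otimes> g \<in> H" by (simp_all add: c1)
      then have "inv a \<otimes> (a \<otimes> g) \<in> H" by (simp add: sg subgroup.m_closed subgroup.m_inv_closed)
      then show "g \<in> H" using a by (simp add: inv_mult_cancel)
    qed
  qed
  have "inj_on f ?\<H>"
  proof (rule inj_onI)
    fix H H' assume H: "H \<in> ?\<H>" "H' \<in> ?\<H>" "f H = f H'"
    have RS: "R H s = R H' s" if "s \<in> S" for s
      using H(3) that unfolding f_def by (metis (no_types, lifting) prod.inject restrict_apply')
    have Rg: "R H g = R H' g" if "g \<in> carrier G" for g
      unfolding R_def
      by (rule schreier_relation_eq[of S "c H" "c H'", OF S(2) c_mult[OF H(1)] c_mult[OF H(2)]])
        (use H(3) RS that S(3) in \<open>auto simp: f_def R_def\<close>)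
    show "H = H'"
    proof (rule Set.set_eqI)
      fix g
      have "c H \<one> = c H' \<one>" using H(3) by (simp add: f_def)
      then show "g \<in> H \<longleftrightarrow> g \<in> H'" using mem[OF H(1)] mem[OF H(2)] Rg by metis
    qed
  qed
  moreover have "f ` ?\<H> \<subseteq> {..<m} \<times> Pow {..<m} \<times> (S \<rightarrow>\<^sub>E Pow ({..<m} \<times> {..<m}))"
  proof (rule image_subsetI)
    fix H assume "H \<in> ?\<H>"
    from c[OF this] have "c H a < m" if "a \<in> carrier G" for a using that by auto
    then show "f H \<in> {..<m} \<times> Pow {..<m} \<times> (S \<rightarrow>\<^sub>E Pow ({..<m} \<times> {..<m}))"
      unfolding f_def R_def using S(2) by (auto simp: subset_iff)
  qed
  moreover have "finite ({..<m} \<times> Pow {..<m} \<times> (S \<rightarrow>\<^sub>E Pow ({..<m} \<times> {..<m})))"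
    using S(1) by (intro finite_cartesian_product finite_PiE) auto
  ultimately show ?thesis using inj_on_finite by blast
qed

section \<open>The subgroups \<open>K G m\<close> and the normal subgroups of finite index\<close>

lemma subgroup_K:
  assumes "finitely_generated G"
  shows "subgroup (K G m) G" "finite (rcosets (K G m))"
proof -
  have "subgroup (K G m) G \<and> finite (rcosets (K G m))"
    unfolding K_def by (rule finite_rcosets_Inter[OF finite_subgroups_index_le[OF assms]]) simp
  then show "subgroup (K G m) G" "finite (rcosets (K G m))" by simp_all
qed

lemma K_subset: "\<lbrakk>subgroup H G; finite (rcosets H); card (rcosets H) \<le> m\<rbrakk> \<Longrightarrow> K G m \<subseteq> H"
  unfolding K_def by blast

lemma K_antimono: "m \<le> n \<Longrightarrow> K G n \<subseteq> K G m"
  unfolding K_def by (intro Int_mono Inter_anti_mono order_refl) auto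

text \<open>Every subgroup has at least one coset, so no subgroup enters the intersection. Level 0
  of each tower therefore consists of full \<open>G\<close>-orbits, which later gives a common
  starting point for all levels.\<close>

lemma K_0: "K G 0 = carrier G"
proof -
  have "rcosets H \<noteq> {}" for H
    using r_coset_in_rcosets[OF one_closed] by blast
  then show ?thesis unfolding K_def by auto
qed

text \<open>Conjugation preserves the index bound: \<open>L\<close> is the conjugate of
  \<open>H\<close> by the inverse of \<open>x\<close>, and its cosets are labelled by cosets of
  \<open>H\<close>. Hence \<open>K G m\<close> lies in \<open>L\<close> as well.\<close>

lemma K_normal:
  assumes "finitely_generated G"
  shows "K G m \<lhd> G"
proof -
  have "x \<otimes> h \<otimes> inv x \<in> K G m" if x: "x \<in> carrier G" and h: "h \<in> K G m" for x h
  proof -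
    have hG: "h \<in> carrier G" using h by (simp add: K_def)
    have "x \<otimes> h \<otimes> inv x \<in> H" if H: "subgroup H G" "finite (rcosets H)" "card (rcosets H) \<le> m" for H
    proof -
      define L where "L = {g \<in> carrier G. x \<otimes> g \<otimes> inv x \<in> H}"
      have mult: "x \<otimes> (a \<otimes> b) \<otimes> inv x = (x \<otimes> a \<otimes> inv x) \<otimes> (x \<otimes> b \<otimes> inv x)"
        if "a \<in> carrier G" "b \<in> carrier G" for a b
        using that x by (simp add: m_assoc inv_mult_cancel)
      have inv: "x \<otimes> inv a \<otimes> inv x = inv (x \<otimes> a \<otimes> inv x)" if "a \<in> carrier G" for a
        using that x by (simp add: m_assoc inv_mult_group)
      have "x \<otimes> \<one> \<otimes> inv x \<in> H" using x H(1) by (simp add: subgroup.one_closed)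
      then have "\<one> \<in> L" by (simp add: L_def)
      then have L: "subgroup L G"
        by (intro subgroupI)
          (use x H(1) mult inv in \<open>auto simp: L_def subgroup.m_closed subgroup.m_inv_closed\<close>)
      have c: "(\<lambda>g. H #> (x \<otimes> g \<otimes> inv x)) ` carrier G \<subseteq> rcosets H"
        using x by (auto intro: r_coset_in_rcosets)
      have inj: "a \<otimes> inv b \<in> L"
        if "a \<in> carrier G" "b \<in> carrier G" "H #> (x \<otimes> a \<otimes> inv x) = H #> (x \<otimes> b \<otimes> inv x)" for a b
        using that x H(1) by (simp add: r_coset_eq_iff L_def mult inv)
      note fin = index_le_cardI[where c = "\<lambda>g. H #> (x \<otimes> g \<otimes> inv x)", OF L H(2) c inj]
      then have "h \<in> L" using K_subset[OF L, of m] fin h H(3) by fastforce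
      then show ?thesis by (simp add: L_def)
    qed
    then show ?thesis using x hG unfolding K_def by auto
  qed
  then show ?thesis using subgroup_K[OF assms] by (simp add: normal_inv_iff)
qed

lemma fin_normalD:
  assumes "N \<in> fin_normal G"
  shows "N \<lhd> G" "finite (rcosets N)" "subgroup N G" "N \<subseteq> carrier G"
  using assms normal_imp_subgroup[of N G] subgroup.subset[of N G] by (simp_all add: fin_normal_def)

lemma K_in_fin_normal: "finitely_generated G \<Longrightarrow> K G m \<in> fin_normal G"
  by (simp add: fin_normal_def K_normal subgroup_K)

text \<open>The index of \<open>N\<close> serves as the level. Through this cofinality, identities
  in the completion can be tested on the coordinates \<open>K G m\<close> alone.\<close>

lemma K_cofinal: "N \<in> fin_normal G \<Longrightarrow> K G (card (rcosets N)) \<subseteq> N"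
  by (rule K_subset) (simp_all add: fin_normalD)

lemma fin_normal_Int:
  assumes "M \<in> fin_normal G" "N \<in> fin_normal G"
  shows "M \<inter> N \<in> fin_normal G"
  unfolding fin_normal_def
  using normal_subgroup_intersect[OF fin_normalD(1)[OF assms(1)] fin_normalD(1)[OF assms(2)]]
    finite_rcosets_Int[OF fin_normalD(3)[OF assms(1)] fin_normalD(3)[OF assms(2)]
      fin_normalD(2)[OF assms(1)] fin_normalD(2)[OF assms(2)]] by simp

lemma carrier_in_fin_normal: "carrier G \<in> fin_normal G"
  by (simp add: fin_normal_def rcosets_carrier normal_inv_iff subgroup_self)

lemma fin_normal_Inter:
  "finite \<N> \<Longrightarrow> \<N> \<subseteq> fin_normal G \<Longrightarrow> carrier G \<inter> \<Inter>\<N> \<in> fin_normal G"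
proof (induction rule: finite_induct)
  case empty
  then show ?case by (simp add: carrier_in_fin_normal)
next
  case (insert N \<N>)
  have eq: "carrier G \<inter> \<Inter>(insert N \<N>) = N \<inter> (carrier G \<inter> \<Inter>\<N>)" by auto
  show ?case unfolding eq using insert by (simp add: fin_normal_Int)
qed

lemma residually_finite_eq_one:
  assumes "residually_finite G" "g \<in> carrier G" "\<And>m. g \<in> K G m"
  shows "g = \<one>"
proof (rule ccontr)
  assume "g \<noteq> \<one>"
  then obtain N where "N \<lhd> G" "finite (rcosets N)" "g \<notin> N"
    using assms by (auto simp: residually_finite_def)
  moreover from this have "N \<in> fin_normal G" by (simp add: fin_normal_def)
  ultimately show False using K_cofinal assms(3) by blast
qed

lemma r_coset_product:
  "\<lbrakk>N \<lhd> G; a \<in> carrier G; b \<in> carrier G\<rbrakk> \<Longrightarrow> (N #> a) <#> (N #> b) = N #> (a \<otimes> b)"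
  by (rule normal.rcos_sum)

text \<open>As \<open>M\<close> lies in \<open>N\<close>, the product of \<open>N\<close> and
  \<open>M\<close> is \<open>N\<close>. Thus the transition map of the completion, encoded as a set
  product, is the usual projection of cosets.\<close>

lemma set_mult_r_coset:
  assumes "subgroup N G" "subgroup M G" "M \<subseteq> N" "a \<in> carrier G"
  shows "N <#> (M #> a) = N #> a"
proof -
  interpret N: subgroup N G by fact
  interpret M: subgroup M G by fact
  have "N <#> M = N"
  proof
    show "N <#> M \<subseteq> N" using assms by (auto simp: set_mult_def)
    show "N \<subseteq> N <#> M"
    proof
      fix n assume n: "n \<in> N"
      then have "n \<otimes> \<one> \<in> N <#> M" unfolding set_mult_def using M.one_closed by blast
      then show "n \<in> N <#> M" using n N.mem_carrier by simp
    qed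
  qed
  then show ?thesis using assms N.subset M.subset setmult_rcos_assoc[of N M a] by simp
qed

lemma r_coset_eq_superset:
  assumes "subgroup N G" "subgroup M G" "M \<subseteq> N" "a \<in> carrier G" "b \<in> carrier G" "M #> a = M #> b"
  shows "N #> a = N #> b"
  using assms by (auto simp: r_coset_eq_iff)

end

section \<open>Inverse limits of discrete sets\<close>

lemma inverse_limit_subset_PiE: "inverse_limit I below X t \<subseteq> (\<Pi>\<^sub>E i\<in>I. X i)"
  by (auto simp: inverse_limit_def)

lemma topspace_limit_topology [simp]:
  "topspace (limit_topology I below X t) = inverse_limit I below X t"
  using inverse_limit_subset_PiE[of I below X t]
  by (auto simp: limit_topology_def topspace_subtopology_subset)

lemma continuous_map_limit_component:
  assumes "i \<in> I"
  shows "continuous_map (limit_topology I below X t) (discrete_topology (X i)) (\<lambda>x. x i)"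
  unfolding limit_topology_def
  by (rule continuous_map_from_subtopology) (rule continuous_map_product_projection[OF assms])

lemma continuous_map_into_limit:
  assumes "\<And>x. x \<in> topspace T \<Longrightarrow> f x \<in> inverse_limit I below X t"
    and "\<And>i. i \<in> I \<Longrightarrow> continuous_map T (discrete_topology (X i)) (\<lambda>x. f x i)"
  shows "continuous_map T (limit_topology I below X t) f"
  unfolding limit_topology_def
proof (rule continuous_map_into_subtopology)
  show "continuous_map T (product_topology (\<lambda>i. discrete_topology (X i)) I) f"
    using assms inverse_limit_subset_PiE[of I below X t]
    by (auto simp: continuous_map_componentwise PiE_def)
qed (use assms in auto)

text \<open>A basic open set of the product restricts only finitely many coordinates, and each of
  them may be fixed because the factors are discrete.\<close>

lemma openin_limit_topologyD:
  assumes "openin (limit_topology I below X t) U" "x \<in> U"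
  shows "\<exists>F. finite F \<and> F \<subseteq> I \<and> (\<forall>y\<in>inverse_limit I below X t. (\<forall>i\<in>F. y i = x i) \<longrightarrow> y \<in> U)"
proof -
  obtain W where W: "openin (product_topology (\<lambda>i. discrete_topology (X i)) I) W"
    and U: "U = W \<inter> inverse_limit I below X t"
    using assms(1) by (auto simp: limit_topology_def openin_subtopology)
  obtain V where V: "finite {i \<in> I. V i \<noteq> topspace (discrete_topology (X i))}" "x \<in> Pi\<^sub>E I V" "Pi\<^sub>E I V \<subseteq> W"
    using W assms(2) unfolding openin_product_topology_alt U by blast
  have "y \<in> U" if y: "y \<in> inverse_limit I below X t"
    and eq: "\<forall>i\<in>{i \<in> I. V i \<noteq> topspace (discrete_topology (X i))}. y i = x i" for y
  proof -
    have "y \<in> Pi\<^sub>E I X" using y inverse_limit_subset_PiE by blast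
    then have "y \<in> Pi\<^sub>E I V" using eq V(2) by (auto simp: PiE_iff)
    then show ?thesis using V(3) y U by blast
  qed
  then show ?thesis using V(1) by (intro exI[of _ "{i \<in> I. V i \<noteq> topspace (discrete_topology (X i))}"]) blast
qed

section \<open>The profinite completion\<close>

definition completion_embed :: "('g, 'z) monoid_scheme \<Rightarrow> 'g \<Rightarrow> 'g set \<Rightarrow> 'g set" where
  "completion_embed G g = (\<lambda>N\<in>fin_normal G. N #>\<^bsub>G\<^esub> g)"

lemma completion_embed_apply: "N \<in> fin_normal G \<Longrightarrow> completion_embed G g N = N #>\<^bsub>G\<^esub> g"
  by (simp add: completion_embed_def)

lemma carrier_profinite_completion:
  "carrier (profinite_completion G) =
     inverse_limit (fin_normal G) (\<lambda>N M. M \<subseteq> N) (\<lambda>N. carrier (G Mod N)) (\<lambda>N C. N <#>\<^bsub>G\<^esub> C)"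
  by (simp add: profinite_completion_def)

lemma mult_profinite_completion:
  "x \<otimes>\<^bsub>profinite_completion G\<^esub> y = (\<lambda>N\<in>fin_normal G. x N <#>\<^bsub>G\<^esub> y N)"
  by (simp add: profinite_completion_def)

lemma one_profinite_completion: "\<one>\<^bsub>profinite_completion G\<^esub> = (\<lambda>N\<in>fin_normal G. N)"
  by (simp add: profinite_completion_def)

lemma topspace_profinite_topology [simp]:
  "topspace (profinite_topology G) = carrier (profinite_completion G)"
  by (simp add: profinite_topology_def carrier_profinite_completion)

lemma profinite_completion_eqI:
  assumes "x \<in> carrier (profinite_completion G)" "y \<in> carrier (profinite_completion G)"
    and "\<And>N. N \<in> fin_normal G \<Longrightarrow> x N = y N"
  shows "x = y"
proof -
  have "x \<in> (\<Pi>\<^sub>E N\<in>fin_normal G. carrier (G Mod N))" "y \<in> (\<Pi>\<^sub>E N\<in>fin_normal G. carrier (G Mod N))"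
    using assms(1,2) inverse_limit_subset_PiE unfolding carrier_profinite_completion by fast+
  then show ?thesis using assms(3) by (rule PiE_ext)
qed

lemma profinite_completion_outside:
  "\<lbrakk>x \<in> carrier (profinite_completion G); N \<notin> fin_normal G\<rbrakk> \<Longrightarrow> x N = undefined"
  unfolding carrier_profinite_completion inverse_limit_def by (auto intro: PiE_arb)

context group
begin

abbreviation (input) PC where "PC \<equiv> profinite_completion G"

lemma PC_coset:
  assumes "x \<in> carrier PC" "N \<in> fin_normal G"
  obtains g where "g \<in> carrier G" "x N = N #> g"
proof -
  have "x N \<in> carrier (G Mod N)"
    using assms inverse_limit_subset_PiE unfolding carrier_profinite_completion by fast
  then show thesis using that by (auto simp: carrier_FactGroup)
qed

lemma PC_trans:
  assumes "x \<in> carrier PC" "N \<in> fin_normal G" "M \<in> fin_normal G" "M \<subseteq> N"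
  shows "x N = N <#> x M"
  using assms unfolding carrier_profinite_completion inverse_limit_def by simp

lemma PC_coset_superset:
  assumes "x \<in> carrier PC" "N \<in> fin_normal G" "M \<in> fin_normal G" "M \<subseteq> N"
    and "g \<in> carrier G" "x M = M #> g"
  shows "x N = N #> g"
  using PC_trans[OF assms(1-4)] assms by (simp add: set_mult_r_coset fin_normalD)

text \<open>One element \<open>g\<close> that represents \<open>x\<close> at every \<open>N\<close>
  above \<open>M\<close> settles both that the coordinates are cosets and that they are
  compatible.\<close>

lemma PC_memI:
  assumes "x \<in> extensional (fin_normal G)"
    and "\<And>M. M \<in> fin_normal G \<Longrightarrow> \<exists>g\<in>carrier G. \<forall>N\<in>fin_normal G. M \<subseteq> N \<longrightarrow> x N = N #> g"
  shows "x \<in> carrier PC"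
proof -
  have "x N \<in> carrier (G Mod N)" if "N \<in> fin_normal G" for N
    using assms(2)[OF that] that by (auto simp: carrier_FactGroup)
  moreover have "N <#> x M = x N" if NM: "N \<in> fin_normal G" "M \<in> fin_normal G" "M \<subseteq> N" for M N
  proof -
    obtain g where "g \<in> carrier G" "\<forall>N\<in>fin_normal G. M \<subseteq> N \<longrightarrow> x N = N #> g"
      using assms(2)[OF NM(2)] by blast
    then show ?thesis using NM by (simp add: set_mult_r_coset fin_normalD)
  qed
  ultimately show ?thesis
    using assms(1) unfolding carrier_profinite_completion inverse_limit_def by (simp add: PiE_iff)
qed

lemma completion_embed_closed: "g \<in> carrier G \<Longrightarrow> completion_embed G g \<in> carrier PC"
  by (rule PC_memI) (auto simp: completion_embed_def)

lemma PC_mult_apply: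
  assumes "N \<in> fin_normal G" "a \<in> carrier G" "b \<in> carrier G" "x N = N #> a" "y N = N #> b"
  shows "(x \<otimes>\<^bsub>PC\<^esub> y) N = N #> (a \<otimes> b)"
  using assms by (simp add: mult_profinite_completion r_coset_product fin_normalD)

lemma PC_mult_closed:
  assumes "x \<in> carrier PC" "y \<in> carrier PC"
  shows "x \<otimes>\<^bsub>PC\<^esub> y \<in> carrier PC"
proof (rule PC_memI)
  show "x \<otimes>\<^bsub>PC\<^esub> y \<in> extensional (fin_normal G)" by (simp add: mult_profinite_completion)
next
  fix M assume M: "M \<in> fin_normal G"
  obtain a where a: "a \<in> carrier G" "x M = M #> a" using PC_coset assms M by blast
  obtain b where b: "b \<in> carrier G" "y M = M #> b" using PC_coset assms M by blast
  have "(x \<otimes>\<^bsub>PC\<^esub> y) N = N #> (a \<otimes> b)" if "N \<in> fin_normal G" "M \<subseteq> N" for N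
    by (rule PC_mult_apply[of N a b x y, OF that(1) a(1) b(1) PC_coset_superset[OF assms(1) that(1) M that(2) a]
        PC_coset_superset[OF assms(2) that(1) M that(2) b]])
  then show "\<exists>g\<in>carrier G. \<forall>N\<in>fin_normal G. M \<subseteq> N \<longrightarrow> (x \<otimes>\<^bsub>PC\<^esub> y) N = N #> g"
    using m_closed[OF a(1) b(1)] by blast
qed

lemma completion_embed_one: "completion_embed G \<one> = \<one>\<^bsub>PC\<^esub>"
  unfolding completion_embed_def one_profinite_completion
  by (rule restrict_ext) (simp add: fin_normalD)

lemma group_profinite_completion: "group PC"
proof (rule groupI)
  show "\<one>\<^bsub>PC\<^esub> \<in> carrier PC"
    using completion_embed_closed[OF one_closed] by (simp add: completion_embed_one)
next
  fix x y z assume xyz: "x \<in> carrier PC" "y \<in> carrier PC" "z \<in> carrier PC"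
  show "x \<otimes>\<^bsub>PC\<^esub> y \<otimes>\<^bsub>PC\<^esub> z = x \<otimes>\<^bsub>PC\<^esub> (y \<otimes>\<^bsub>PC\<^esub> z)"
  proof (rule profinite_completion_eqI)
    fix N assume N: "N \<in> fin_normal G"
    obtain a where "a \<in> carrier G" "x N = N #> a" using PC_coset xyz(1) N by blast
    moreover obtain b where "b \<in> carrier G" "y N = N #> b" using PC_coset xyz(2) N by blast
    moreover obtain c where "c \<in> carrier G" "z N = N #> c" using PC_coset xyz(3) N by blast
    ultimately show "(x \<otimes>\<^bsub>PC\<^esub> y \<otimes>\<^bsub>PC\<^esub> z) N = (x \<otimes>\<^bsub>PC\<^esub> (y \<otimes>\<^bsub>PC\<^esub> z)) N"
      using N by (simp add: mult_profinite_completion r_coset_product fin_normalD m_assoc)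
  qed (use xyz in \<open>simp_all add: PC_mult_closed\<close>)
next
  fix x assume x: "x \<in> carrier PC"
  have one: "\<one>\<^bsub>PC\<^esub> \<in> carrier PC"
    using completion_embed_closed[OF one_closed] by (simp add: completion_embed_one)
  show "\<one>\<^bsub>PC\<^esub> \<otimes>\<^bsub>PC\<^esub> x = x"
  proof (rule profinite_completion_eqI)
    fix N assume N: "N \<in> fin_normal G"
    obtain a where "a \<in> carrier G" "x N = N #> a" using PC_coset x N by blast
    then show "(\<one>\<^bsub>PC\<^esub> \<otimes>\<^bsub>PC\<^esub> x) N = x N"
      using N by (simp add: mult_profinite_completion one_profinite_completion set_mult_r_coset fin_normalD)
  qed (use x one in \<open>simp_all add: PC_mult_closed\<close>)
  define y where "y = (\<lambda>N\<in>fin_normal G. set_inv (x N))"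
  have y: "y N = N #> inv a" if "N \<in> fin_normal G" "a \<in> carrier G" "x N = N #> a" for N a
    using that by (simp add: y_def normal.rcos_inv fin_normalD)
  have yc: "y \<in> carrier PC"
  proof (rule PC_memI)
    show "y \<in> extensional (fin_normal G)" by (simp add: y_def)
  next
    fix M assume M: "M \<in> fin_normal G"
    obtain a where a: "a \<in> carrier G" "x M = M #> a" using PC_coset x M by blast
    have "y N = N #> inv a" if "N \<in> fin_normal G" "M \<subseteq> N" for N
      using that(1) a(1) PC_coset_superset[OF x that(1) M that(2) a] by (rule y)
    then show "\<exists>g\<in>carrier G. \<forall>N\<in>fin_normal G. M \<subseteq> N \<longrightarrow> y N = N #> g"
      using inv_closed[OF a(1)] by blast
  qed
  have "y \<otimes>\<^bsub>PC\<^esub> x = \<one>\<^bsub>PC\<^esub>"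
  proof (rule profinite_completion_eqI)
    fix N assume N: "N \<in> fin_normal G"
    obtain a where a: "a \<in> carrier G" "x N = N #> a" using PC_coset x N by blast
    then have "(y \<otimes>\<^bsub>PC\<^esub> x) N = N #> (inv a \<otimes> a)"
      using N y by (intro PC_mult_apply) simp_all
    then show "(y \<otimes>\<^bsub>PC\<^esub> x) N = \<one>\<^bsub>PC\<^esub> N"
      using a N by (simp add: one_profinite_completion fin_normalD)
  qed (use x yc one in \<open>simp_all add: PC_mult_closed\<close>)
  then show "\<exists>y\<in>carrier PC. y \<otimes>\<^bsub>PC\<^esub> x = \<one>\<^bsub>PC\<^esub>" using yc by blast
qed (rule PC_mult_closed)

lemma PC_inv_apply:
  assumes "x \<in> carrier PC" "N \<in> fin_normal G" "a \<in> carrier G" "x N = N #> a"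
  shows "(inv\<^bsub>PC\<^esub> x) N = N #> inv a"
proof -
  interpret PC: group PC by (rule group_profinite_completion)
  obtain b where b: "b \<in> carrier G" "(inv\<^bsub>PC\<^esub> x) N = N #> b"
    using PC_coset[OF PC.inv_closed[OF assms(1)] assms(2)] by blast
  have "(inv\<^bsub>PC\<^esub> x \<otimes>\<^bsub>PC\<^esub> x) N = N #> (b \<otimes> a)" using assms b by (intro PC_mult_apply) simp_all
  then have "N #> \<one> = N #> (b \<otimes> a)"
    using assms by (simp add: one_profinite_completion fin_normalD)
  then have "N #> \<one> #> inv a = N #> (b \<otimes> a) #> inv a" by simp
  then show ?thesis
    using assms b by (simp add: coset_mult_assoc m_assoc fin_normalD)
qed

lemma completion_embed_mult:
  assumes "a \<in> carrier G" "b \<in> carrier G"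
  shows "completion_embed G (a \<otimes> b) = completion_embed G a \<otimes>\<^bsub>PC\<^esub> completion_embed G b"
  unfolding completion_embed_def mult_profinite_completion
  using assms by (intro restrict_ext) (simp add: r_coset_product fin_normalD)

lemma completion_embed_inv:
  assumes "a \<in> carrier G"
  shows "completion_embed G (inv a) = inv\<^bsub>PC\<^esub> (completion_embed G a)"
proof -
  have PC: "group PC" by (rule group_profinite_completion)
  have a: "completion_embed G (inv a) \<otimes>\<^bsub>PC\<^esub> completion_embed G a = completion_embed G (inv a \<otimes> a)"
    by (rule completion_embed_mult[OF inv_closed[OF assms] assms, symmetric])
  have "completion_embed G (inv a) \<otimes>\<^bsub>PC\<^esub> completion_embed G a = completion_embed G \<one>"
    unfolding a by (simp only: l_inv[OF assms])
  then have "completion_embed G (inv a) \<otimes>\<^bsub>PC\<^esub> completion_embed G a = \<one>\<^bsub>PC\<^esub>"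
    by (simp only: completion_embed_one)
  from group.inv_equality[OF PC this completion_embed_closed[OF assms] completion_embed_closed[OF inv_closed[OF assms]]]
  show ?thesis by (rule sym)
qed

text \<open>Finitely many coordinates are controlled by a single one, at the intersection of the
  subgroups; the carrier is intersected in to cover an empty family.\<close>

lemma openin_profinite_topologyD:
  assumes "openin (profinite_topology G) U" "x \<in> U"
  obtains M where "M \<in> fin_normal G" "\<And>y. \<lbrakk>y \<in> carrier PC; y M = x M\<rbrakk> \<Longrightarrow> y \<in> U"
proof -
  obtain F where "finite F \<and> F \<subseteq> fin_normal G \<and>
      (\<forall>y\<in>carrier PC. (\<forall>N\<in>F. y N = x N) \<longrightarrow> y \<in> U)"
    using openin_limit_topologyD[OF assms(1)[unfolded profinite_topology_def] assms(2)]
    unfolding carrier_profinite_completion by (rule exE)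
  then have F: "finite F" "F \<subseteq> fin_normal G" "\<And>y. \<lbrakk>y \<in> carrier PC; \<forall>N\<in>F. y N = x N\<rbrakk> \<Longrightarrow> y \<in> U"
    by simp_all
  define M where "M = carrier G \<inter> \<Inter>F"
  have M: "M \<in> fin_normal G" using F by (simp add: M_def fin_normal_Inter)
  have x: "x \<in> carrier PC"
    using assms openin_subset topspace_profinite_topology by fastforce
  have "y \<in> U" if y: "y \<in> carrier PC" "y M = x M" for y
  proof (rule F(3)[OF y(1)], rule ballI)
    fix N assume "N \<in> F"
    then have "M \<subseteq> N" "N \<in> fin_normal G" using F(2) by (auto simp: M_def)
    then show "y N = x N" using PC_trans[OF y(1) _ M] PC_trans[OF x _ M] y(2) by simp
  qed
  then show thesis using that M by blast
qed

end

text \<open>The quotient by \<open>N\<close> is discrete, so the points whose image has the same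
  coordinate at \<open>N\<close> as that of \<open>x\<close> form an open set, which contains a
  basic neighbourhood of \<open>x\<close>.\<close>

lemma continuous_profinite_component:
  assumes "group G1" "continuous_map (profinite_topology G1) (profinite_topology G2) \<Phi>"
    and "x \<in> carrier (profinite_completion G1)" "N \<in> fin_normal G2"
  obtains M where "M \<in> fin_normal G1"
    "\<And>y. \<lbrakk>y \<in> carrier (profinite_completion G1); y M = x M\<rbrakk> \<Longrightarrow> \<Phi> y N = \<Phi> x N"
proof -
  have "continuous_map (profinite_topology G1) (discrete_topology (carrier (G2 Mod N))) ((\<lambda>z. z N) \<circ> \<Phi>)"
    using assms(2) continuous_map_limit_component[OF assms(4)] unfolding profinite_topology_def
    by (rule continuous_map_compose)
  then have cont: "continuous_map (profinite_topology G1) (discrete_topology (carrier (G2 Mod N))) (\<lambda>y. \<Phi> y N)"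
    by (simp add: o_def)
  then have "\<Phi> x N \<in> carrier (G2 Mod N)"
    using assms(3) continuous_map_image_subset_topspace by fastforce
  then have "openin (profinite_topology G1) {y \<in> carrier (profinite_completion G1). \<Phi> y N \<in> {\<Phi> x N}}"
    using openin_continuous_map_preimage[OF cont, of "{\<Phi> x N}"] by simp
  from group.openin_profinite_topologyD[OF assms(1) this, of x] obtain M where "M \<in> fin_normal G1"
    "\<And>y. \<lbrakk>y \<in> carrier (profinite_completion G1); y M = x M\<rbrakk>
      \<Longrightarrow> y \<in> {y \<in> carrier (profinite_completion G1). \<Phi> y N \<in> {\<Phi> x N}}"
    using assms(3) by auto
  then show thesis using that by simp
qed

locale fg_group = group +
  assumes fg: "finitely_generated G"
begin

lemma K_fin_normal [simp]: "K G m \<in> fin_normal G"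
  using fg by (rule K_in_fin_normal)

lemma K_facts [simp]: "K G m \<lhd> G" "subgroup (K G m) G" "finite (rcosets (K G m))"
  using fin_normalD[OF K_fin_normal] by auto

lemma PC_eqI_K:
  assumes "x \<in> carrier PC" "y \<in> carrier PC" "\<And>m. x (K G m) = y (K G m)"
  shows "x = y"
  using assms(1,2)
proof (rule profinite_completion_eqI)
  fix N assume N: "N \<in> fin_normal G"
  have "K G (card (rcosets N)) \<subseteq> N" using N by (rule K_cofinal)
  then show "x N = y N"
    using PC_trans[OF assms(1) N K_fin_normal] PC_trans[OF assms(2) N K_fin_normal] assms(3) by metis
qed

end

section \<open>Two selection principles\<close>

text \<open>If every candidate \<open>s\<close> failed at some level \<open>f s\<close>, all of them
  would fail at the largest of these levels.\<close>

lemma finite_antimono_ex: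
  fixes Q :: "nat \<Rightarrow> 'x \<Rightarrow> bool"
  assumes "finite S" "\<And>m. \<exists>s\<in>S. Q m s" "\<And>k m s. \<lbrakk>k \<le> m; Q m s\<rbrakk> \<Longrightarrow> Q k s"
  shows "\<exists>s\<in>S. \<forall>m. Q m s"
proof (rule ccontr)
  assume "\<not> ?thesis"
  then have "\<forall>s\<in>S. \<exists>m. \<not> Q m s" by blast
  from bchoice[OF this] obtain f where f: "\<forall>s\<in>S. \<not> Q (f s) s" ..
  obtain s where s: "s \<in> S" "Q (Max (f ` S)) s" using assms(2) by blast
  have "f s \<le> Max (f ` S)" using s(1) assms(1) by simp
  then show False using assms(3) s f by blast
qed

text \<open>Sequential compactness of a product of finite sets, for a triangular array: row
  \<open>k\<close> carries data at the levels \<open>j \<le> k\<close> only. Successive subsequences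
  make column after column constant, and the diagonal sequence serves all columns.\<close>

lemma diagonal_selection:
  fixes D :: "nat \<Rightarrow> nat \<Rightarrow> 'x"
  assumes fin: "\<And>j. finite (A j)" and D: "\<And>k j. j \<le> k \<Longrightarrow> D k j \<in> A j"
  obtains r :: "nat \<Rightarrow> nat" and e where "\<And>i. i \<le> r i" "\<And>i j. j < i \<Longrightarrow> D (r i) j = e j"
proof -
  \<comment> \<open>Entries above the diagonal are not known to lie in \<open>A j\<close>; taking
    the maximum makes the array total and leaves the entries with \<open>j \<le> k\<close>
    unchanged.\<close>
  define D' where "D' k j = D (max k j) j" for k j
  have D': "D' k j \<in> A j" for k j by (simp add: D'_def D)
  interpret subseqs "\<lambda>n s. \<exists>e. \<forall>i. D' (s i) n = e"
  proof
    fix n and s :: "nat \<Rightarrow> nat"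
    have "finite ((\<lambda>i. D' (s i) n) ` UNIV)"
      by (rule finite_subset[OF _ fin[of n]]) (use D' in blast)
    then obtain i0 where inf: "infinite {i \<in> UNIV. D' (s i) n = D' (s i0) n}"
      using pigeonhole_infinite[OF infinite_UNIV_nat] by blast
    define r' where "r' = Infinite_Set.enumerate {i \<in> UNIV. D' (s i) n = D' (s i0) n}"
    have mono: "strict_mono r'" unfolding r'_def by (rule strict_mono_enumerate[OF inf])
    have const: "D' ((s \<circ> r') i) n = D' (s i0) n" for i
      using enumerate_in_set[OF inf, of i] by (simp add: r'_def)
    show "\<exists>r' :: nat \<Rightarrow> nat. strict_mono r' \<and> (\<exists>e. \<forall>i. D' ((s \<circ> r') i) n = e)" 
      by (intro exI[of _ r'] conjI exI[of _ "D' (s i0) n"] allI mono const)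
  qed
  \<comment> \<open>Column \<open>j\<close> is stabilized when stage \<open>Suc j\<close> is formed,
    so the diagonal sequence is constant there from index \<open>Suc j\<close> on; hence the strict
    inequality \<open>j < i\<close> in the result.\<close>
  have "\<exists>e. \<forall>i. D' ((diagseq \<circ> (+) (Suc j)) i) j = e" for j
    by (rule diagseq_holds) auto
  then obtain e where e: "\<And>i j. D' (diagseq (Suc j + i)) j = e j"
    by (simp add: o_def) metis
  have le: "i \<le> diagseq i" for i using seq_suble[OF subseq_diagseq] .
  have "D (diagseq i) j = e j" if "j < i" for i j
  proof -
    have "D' (diagseq i) j = e j" using e[of j "i - Suc j"] that by simp
    moreover have "max (diagseq i) j = diagseq i" using le[of i] that by simp
    ultimately show ?thesis by (simp add: D'_def)
  qed
  then show thesis using that le by blast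
qed

section \<open>Completions of group actions\<close>

text \<open>Stated for an action on a single set, so that vertices and edges share all lemmas; the
  vertex and edge sets of \<open>quotient_graph\<close> and \<open>completed_graph\<close> are
  instances of \<open>level\<close> and \<open>climit\<close>.\<close>

definition level :: "('g, 'y) monoid_scheme \<Rightarrow> ('g \<Rightarrow> 'x \<Rightarrow> 'x) \<Rightarrow> 'x set \<Rightarrow> nat \<Rightarrow> 'x set set" where
  "level G \<phi> E m = orbits (G\<lparr>carrier := K G m\<rparr>) E \<phi>"

definition climit :: "('g, 'y) monoid_scheme \<Rightarrow> ('g \<Rightarrow> 'x \<Rightarrow> 'x) \<Rightarrow> 'x set \<Rightarrow> (nat \<Rightarrow> 'x set) set" where
  "climit G \<phi> E = inverse_limit UNIV (\<le>) (level G \<phi> E) (\<lambda>m. set_act \<phi> (K G m))"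

definition climit_topology ::
  "('g, 'y) monoid_scheme \<Rightarrow> ('g \<Rightarrow> 'x \<Rightarrow> 'x) \<Rightarrow> 'x set \<Rightarrow> (nat \<Rightarrow> 'x set) topology" where
  "climit_topology G \<phi> E = limit_topology UNIV (\<le>) (level G \<phi> E) (\<lambda>m. set_act \<phi> (K G m))"

lemma topspace_climit_topology [simp]: "topspace (climit_topology G \<phi> E) = climit G \<phi> E"
  by (simp add: climit_topology_def climit_def)

lemma climit_iff:
  "p \<in> climit G \<phi> E \<longleftrightarrow> (\<forall>m. p m \<in> level G \<phi> E m) \<and> (\<forall>k m. k \<le> m \<longrightarrow> set_act \<phi> (K G k) (p m) = p k)"
  by (auto simp: climit_def inverse_limit_def)

lemma set_act_image:
  assumes "\<And>g x. \<lbrakk>g \<in> C; x \<in> S\<rbrakk> \<Longrightarrow> t (\<phi> g x) = \<psi> g (t x)"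
  shows "t ` set_act \<phi> C S = set_act \<psi> C (t ` S)"
  using assms by (force simp: set_act_def)

locale fg_action = fg_group G + group_action G E \<phi>
  for G (structure) and E and \<phi>
begin

abbreviation (input) orb where "orb N v \<equiv> Group_Action.orbit (G\<lparr>carrier := N\<rparr>) \<phi> v"

lemma act_closed: "\<lbrakk>g \<in> carrier G; v \<in> E\<rbrakk> \<Longrightarrow> \<phi> g v \<in> E"
  using element_image by blast

lemma act_mult: "\<lbrakk>g \<in> carrier G; h \<in> carrier G; v \<in> E\<rbrakk> \<Longrightarrow> \<phi> (g \<otimes> h) v = \<phi> g (\<phi> h v)"
  by (simp add: composition_rule)

lemma act_one: "v \<in> E \<Longrightarrow> \<phi> \<one> v = v"
  using id_eq_one by (metis restrict_apply')

lemma act_inv: "\<lbrakk>g \<in> carrier G; v \<in> E\<rbrakk> \<Longrightarrow> \<phi> (inv g) (\<phi> g v) = v"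
  by (simp add: act_mult[symmetric] act_one)

lemma mem_orb: "w \<in> orb N v \<longleftrightarrow> (\<exists>n\<in>N. w = \<phi> n v)"
  by (auto simp: orbit_def)

lemma orb_self: "\<lbrakk>subgroup N G; v \<in> E\<rbrakk> \<Longrightarrow> v \<in> orb N v"
  unfolding mem_orb using subgroup.one_closed act_one by metis

lemma orb_subset:
  assumes "subgroup N G" "v \<in> E"
  shows "orb N v \<subseteq> E"
proof
  fix w assume "w \<in> orb N v"
  then obtain n where n: "n \<in> N" "w = \<phi> n v" by (auto simp: mem_orb)
  show "w \<in> E" unfolding n(2) using subgroup.mem_carrier[OF assms(1) n(1)] assms(2) by (rule act_closed)
qed

text \<open>By normality \<open>n\<close> in \<open>N\<close> can be moved across \<open>g\<close>,
  where \<open>M\<close> absorbs it. The case \<open>M = N\<close> is the action of a coset on an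
  orbit, the case \<open>g = \<one>\<close> the projection to a coarser quotient.\<close>

lemma set_act_orb:
  assumes N: "N \<lhd> G" and M: "subgroup M G" and "N \<subseteq> M" and g: "g \<in> carrier G" and v: "v \<in> E"
  shows "set_act \<phi> (M #> g) (orb N v) = orb M (\<phi> g v)"
proof (intro equalityI subsetI)
  fix w assume "w \<in> set_act \<phi> (M #> g) (orb N v)"
  then obtain m n where mn: "m \<in> M" "n \<in> N" "w = \<phi> (m \<otimes> g) (\<phi> n v)"
    by (auto simp: set_act_def r_coset_def mem_orb)
  have mnc: "m \<in> carrier G" "n \<in> carrier G"
    by (rule subgroup.mem_carrier[OF M mn(1)])
      (rule subgroup.mem_carrier[OF normal_imp_subgroup[OF N] mn(2)])
  define n' where "n' = g \<otimes> n \<otimes> inv g"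
  have n': "n' \<in> N" unfolding n'_def using normal.inv_op_closed2[OF N g mn(2)] .
  then have n'c: "n' \<in> carrier G" by (rule subgroup.mem_carrier[OF normal_imp_subgroup[OF N]])
  have "(m \<otimes> n') \<otimes> g = (m \<otimes> g) \<otimes> n"
    using mnc g by (simp add: n'_def m_assoc)
  then have "w = \<phi> ((m \<otimes> n') \<otimes> g) v"
    using mnc g v unfolding mn(3) by (simp add: act_mult)
  also have "\<dots> = \<phi> (m \<otimes> n') (\<phi> g v)" using mnc n'c g v by (intro act_mult) simp_all
  finally show "w \<in> orb M (\<phi> g v)"
    unfolding mem_orb using subgroup.m_closed[OF M mn(1), of n'] n' \<open>N \<subseteq> M\<close> by blast
next
  fix w assume "w \<in> orb M (\<phi> g v)"
  then obtain m where m: "m \<in> M" "w = \<phi> m (\<phi> g v)" by (auto simp: mem_orb)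
  then have "w = \<phi> (m \<otimes> g) v" using subgroup.mem_carrier[OF M m(1)] g v by (simp add: act_mult)
  moreover have "v \<in> orb N v" using N v by (simp add: orb_self normal_imp_subgroup)
  ultimately show "w \<in> set_act \<phi> (M #> g) (orb N v)"
    using m(1) unfolding set_act_def r_coset_def by blast
qed

lemma set_act_orb_subgroup:
  assumes "N \<lhd> G" "subgroup M G" "N \<subseteq> M" "v \<in> E"
  shows "set_act \<phi> M (orb N v) = orb M v"
  using set_act_orb[OF assms(1-3) one_closed assms(4)] assms
  by (simp add: act_one subgroup.subset)

lemma orb_eq:
  assumes "N \<lhd> G" "v \<in> E" "w \<in> orb N v"
  shows "orb N w = orb N v"
proof -
  obtain n where n: "n \<in> N" "w = \<phi> n v" using assms(3) by (auto simp: mem_orb)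
  have sg: "subgroup N G" using assms(1) by (rule normal_imp_subgroup)
  have nc: "n \<in> carrier G" using subgroup.mem_carrier[OF sg n(1)] .
  have "N #> n = N" using nc sg n(1) by (rule coset_join2)
  then show ?thesis
    using set_act_orb[OF assms(1) sg order_refl nc assms(2)] set_act_orb_subgroup[OF assms(1) sg order_refl assms(2)]
    by (simp add: n(2))
qed

lemma level_iff: "p \<in> level G \<phi> E m \<longleftrightarrow> (\<exists>v\<in>E. p = orb (K G m) v)"
  by (auto simp: level_def orbits_def)

lemma level_mem:
  assumes "p \<in> level G \<phi> E m" "v \<in> p"
  shows "v \<in> E" "p = orb (K G m) v"
proof -
  obtain w where w: "w \<in> E" "p = orb (K G m) w" using assms(1) by (auto simp: level_iff)
  show "v \<in> E" using assms(2) w(2) orb_subset[OF K_facts(2) w(1)] by blast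
  show "p = orb (K G m) v" using orb_eq[OF K_facts(1) w(1)] w(2) assms(2) by blast
qed

lemma level_nonempty: "p \<in> level G \<phi> E m \<Longrightarrow> \<exists>v. v \<in> p"
  using orb_self[OF K_facts(2)] by (auto simp: level_iff)

lemma level_proj_orb: "\<lbrakk>k \<le> m; v \<in> E\<rbrakk> \<Longrightarrow> set_act \<phi> (K G k) (orb (K G m) v) = orb (K G k) v"
  by (intro set_act_orb_subgroup) (simp_all add: K_antimono)

lemma level_proj_closed: "\<lbrakk>k \<le> m; p \<in> level G \<phi> E m\<rbrakk> \<Longrightarrow> set_act \<phi> (K G k) p \<in> level G \<phi> E k"
  using level_proj_orb by (fastforce simp: level_iff)

lemma level_proj_proj:
  "\<lbrakk>k \<le> l; l \<le> m; p \<in> level G \<phi> E m\<rbrakk> \<Longrightarrow> set_act \<phi> (K G k) (set_act \<phi> (K G l) p) = set_act \<phi> (K G k) p"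
  by (auto simp: level_iff level_proj_orb)

lemma level_proj_self: "p \<in> level G \<phi> E m \<Longrightarrow> set_act \<phi> (K G m) p = p"
  by (auto simp: level_iff level_proj_orb)

lemma level_proj_surj:
  assumes "k \<le> m" "q \<in> level G \<phi> E k"
  shows "\<exists>p\<in>level G \<phi> E m. set_act \<phi> (K G k) p = q"
proof -
  obtain v where "v \<in> E" "q = orb (K G k) v" using assms(2) by (auto simp: level_iff)
  then show ?thesis
    using level_proj_orb[OF assms(1)] by (intro bexI[of _ "orb (K G m) v"]) (auto simp: level_iff)
qed

text \<open>A single element of \<open>p m\<close> represents \<open>p\<close> at all levels up to
  \<open>m\<close>. Computations with points of the completion are done on such
  representatives.\<close>

lemma climit_mem:
  assumes "p \<in> climit G \<phi> E" "v \<in> p m" "k \<le> m"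
  shows "v \<in> E" "p k = orb (K G k) v" "v \<in> p k"
proof -
  have "p m \<in> level G \<phi> E m" using assms(1) by (simp add: climit_iff)
  note v = level_mem[OF this assms(2)]
  show "v \<in> E" by fact
  have "p k = set_act \<phi> (K G k) (p m)" using assms by (simp add: climit_iff)
  then show "p k = orb (K G k) v" using v level_proj_orb[OF assms(3)] by simp
  then show "v \<in> p k" using v(1) by (simp add: orb_self)
qed

lemma climit_nonempty: "p \<in> climit G \<phi> E \<Longrightarrow> \<exists>v. v \<in> p m"
  using level_nonempty[of "p m" m] by (simp add: climit_iff)

lemma climitI:
  assumes "\<And>m. \<exists>v\<in>E. \<forall>k\<le>m. p k = orb (K G k) v"
  shows "p \<in> climit G \<phi> E"
  unfolding climit_iff
proof (intro conjI allI impI)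
  show "p m \<in> level G \<phi> E m" for m using assms[of m] by (auto simp: level_iff)
  show "set_act \<phi> (K G k) (p m) = p k" if "k \<le> m" for k m
    using assms[of m] that by (auto simp: level_proj_orb)
qed

lemma embed_apply: "embed G \<phi> v m = orb (K G m) v"
  by (simp add: embed_def)

lemma embed_closed: "v \<in> E \<Longrightarrow> embed G \<phi> v \<in> climit G \<phi> E"
  by (rule climitI) (auto simp: embed_apply)

lemma climit_eq_embed:
  assumes "p \<in> climit G \<phi> E" "\<And>m. v \<in> p m"
  shows "p = embed G \<phi> v"
  by (rule ext) (use climit_mem(2)[OF assms order_refl] in \<open>simp add: embed_apply\<close>)

lemma completed_act_apply:
  assumes "p m = orb (K G m) v" "x (K G m) = K G m #> g" "g \<in> carrier G" "v \<in> E"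
  shows "completed_act G \<phi> x p m = orb (K G m) (\<phi> g v)"
  unfolding completed_act_def assms(1,2) by (rule set_act_orb) (use assms in simp_all)

lemma completed_act_closed:
  assumes x: "x \<in> carrier PC" and p: "p \<in> climit G \<phi> E"
  shows "completed_act G \<phi> x p \<in> climit G \<phi> E"
proof (rule climitI)
  fix m
  obtain v where v: "v \<in> p m" using climit_nonempty[OF p] by blast
  obtain g where g: "g \<in> carrier G" "x (K G m) = K G m #> g" using PC_coset[OF x K_fin_normal] by blast
  have "completed_act G \<phi> x p k = orb (K G k) (\<phi> g v)" if k: "k \<le> m" for k
    by (rule completed_act_apply[of p k v x g, OF climit_mem(2)[OF p v k]
        PC_coset_superset[OF x K_fin_normal K_fin_normal K_antimono[OF k] g] g(1) climit_mem(1)[OF p v k]])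
  then show "\<exists>w\<in>E. \<forall>k\<le>m. completed_act G \<phi> x p k = orb (K G k) w"
    using act_closed[OF g(1) climit_mem(1)[OF p v order_refl]] by blast
qed

lemma completed_act_mult:
  assumes "x \<in> carrier PC" "y \<in> carrier PC" and p: "p \<in> climit G \<phi> E"
  shows "completed_act G \<phi> (x \<otimes>\<^bsub>PC\<^esub> y) p = completed_act G \<phi> x (completed_act G \<phi> y p)"
proof
  fix m
  obtain v where v: "v \<in> p m" using climit_nonempty[OF p] by blast
  obtain g where g: "g \<in> carrier G" "x (K G m) = K G m #> g" using PC_coset[OF assms(1) K_fin_normal] by blast
  obtain h where h: "h \<in> carrier G" "y (K G m) = K G m #> h" using PC_coset[OF assms(2) K_fin_normal] by blast
  note pv = climit_mem(2)[OF p v order_refl] and vE = climit_mem(1)[OF p v order_refl]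
  have y: "completed_act G \<phi> y p m = orb (K G m) (\<phi> h v)"
    by (rule completed_act_apply[of p m v y h, OF pv h(2,1) vE])
  have "completed_act G \<phi> (x \<otimes>\<^bsub>PC\<^esub> y) p m = orb (K G m) (\<phi> (g \<otimes> h) v)"
    by (rule completed_act_apply[of p m v "x \<otimes>\<^bsub>PC\<^esub> y" "g \<otimes> h", OF pv PC_mult_apply[of "K G m" g h x y, OF K_fin_normal g(1) h(1) g(2) h(2)] m_closed[OF g(1) h(1)] vE])
  also have "\<dots> = orb (K G m) (\<phi> g (\<phi> h v))" using g h vE by (simp add: act_mult)
  also have "\<dots> = completed_act G \<phi> x (completed_act G \<phi> y p) m"
    by (rule completed_act_apply[of "completed_act G \<phi> y p" m "\<phi> h v" x g, OF y g(2,1) act_closed[OF h(1) vE], symmetric])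
  finally show "completed_act G \<phi> (x \<otimes>\<^bsub>PC\<^esub> y) p m = completed_act G \<phi> x (completed_act G \<phi> y p) m" .
qed

lemma completed_act_embed:
  assumes "g \<in> carrier G" "v \<in> E"
  shows "completed_act G \<phi> (completion_embed G g) (embed G \<phi> v) = embed G \<phi> (\<phi> g v)"
proof
  fix m
  show "completed_act G \<phi> (completion_embed G g) (embed G \<phi> v) m = embed G \<phi> (\<phi> g v) m"
    unfolding embed_apply[of "\<phi> g v"]
    by (rule completed_act_apply) (use assms in \<open>simp_all add: embed_apply completion_embed_apply\<close>)
qed

lemma completed_act_one:
  assumes p: "p \<in> climit G \<phi> E"
  shows "completed_act G \<phi> \<one>\<^bsub>PC\<^esub> p = p"
proof
  fix m
  have "p m \<in> level G \<phi> E m" using p by (simp add: climit_iff)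
  then show "completed_act G \<phi> \<one>\<^bsub>PC\<^esub> p m = p m"
    by (simp add: completed_act_def one_profinite_completion level_proj_self)
qed

lemma completed_act_inv:
  assumes x: "x \<in> carrier PC" and p: "p \<in> climit G \<phi> E"
  shows "completed_act G \<phi> (inv\<^bsub>PC\<^esub> x) (completed_act G \<phi> x p) = p"
    and "completed_act G \<phi> x (completed_act G \<phi> (inv\<^bsub>PC\<^esub> x) p) = p"
proof -
  note grp = group_profinite_completion
  have xi: "inv\<^bsub>PC\<^esub> x \<in> carrier PC" using group.inv_closed[OF grp x] .
  show "completed_act G \<phi> (inv\<^bsub>PC\<^esub> x) (completed_act G \<phi> x p) = p"
    unfolding completed_act_mult[OF xi x p, symmetric] group.l_inv[OF grp x]
    by (rule completed_act_one[OF p])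
  show "completed_act G \<phi> x (completed_act G \<phi> (inv\<^bsub>PC\<^esub> x) p) = p"
    unfolding completed_act_mult[OF x xi p, symmetric] group.r_inv[OF grp x]
    by (rule completed_act_one[OF p])
qed

text \<open>Since \<open>p 0\<close> is a full orbit, every \<open>p k\<close> contains a translate
  of one fixed \<open>v\<close> by some \<open>g k\<close>. The cosets of \<open>g k\<close> at a
  given level range over a finite set, so along a diagonal subsequence they stabilize at each level,
  and the limiting cosets form \<open>x\<close>.\<close>

lemma climit_transitive:
  assumes p: "p \<in> climit G \<phi> E"
  obtains x v where "x \<in> carrier PC" "v \<in> E" "p = completed_act G \<phi> x (embed G \<phi> v)"
proof -
  obtain v where v: "v \<in> p 0" using climit_nonempty[OF p] by blast
  note vE = climit_mem(1)[OF p v order_refl]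
  have "\<exists>g\<in>carrier G. \<phi> g v \<in> p k" for k
  proof -
    obtain w where w: "w \<in> p k" using climit_nonempty[OF p] by blast
    then have "w \<in> p 0" using climit_mem(3)[OF p w, of 0] by simp
    then have "w \<in> orb (K G 0) v" using climit_mem(2)[OF p v order_refl] by simp
    then show ?thesis using w unfolding mem_orb K_0 by blast
  qed
  then obtain g where g: "\<And>k. g k \<in> carrier G" and gp: "\<And>k. \<phi> (g k) v \<in> p k" by metis
  obtain r e where r: "\<And>i. i \<le> r i" and e: "\<And>i j. j < i \<Longrightarrow> K G j #> g (r i) = e j"
    using diagonal_selection[of "\<lambda>j. rcosets (K G j)" "\<lambda>k j. K G j #> g k"] r_coset_in_rcosets g
    by (metis K_facts(3))
  define idx where "idx N = card (rcosets N)" for N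
  have coset_eq: "N #> g (r i) = N #> g (r i')"
    if "N \<in> fin_normal G" "K G j \<subseteq> N" "j < i" "j < i'" for N i i' j
    using r_coset_eq_superset[OF fin_normalD(3)[OF that(1)] K_facts(2) that(2) g g] e[OF that(3)] e[OF that(4)]
    by simp
  \<comment> \<open>At \<open>N\<close> the coset of \<open>g (r i)\<close> is stable once
    \<open>i\<close> exceeds the index of \<open>N\<close>, because \<open>K G\<close> at that index
    lies in \<open>N\<close>.\<close>
  define x where "x = (\<lambda>N\<in>fin_normal G. N #> g (r (Suc (idx N))))"
  have x_eq: "x N = N #> g (r i)" if N: "N \<in> fin_normal G" "K G j \<subseteq> N" "j < i" for N i j
  proof -
    let ?l = "Suc (max (idx N) j)"
    have "N #> g (r (Suc (idx N))) = N #> g (r ?l)"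
      by (rule coset_eq[OF N(1), of "idx N"]) (use K_cofinal[OF N(1)] in \<open>simp_all add: idx_def\<close>)
    also have "\<dots> = N #> g (r i)" by (rule coset_eq[OF N(1,2)]) (use N(3) in simp_all)
    finally show ?thesis using N(1) by (simp add: x_def)
  qed
  have "x \<in> carrier PC"
  proof (rule PC_memI)
    show "x \<in> extensional (fin_normal G)" by (simp add: x_def)
  next
    fix M assume M: "M \<in> fin_normal G"
    have "x N = N #> g (r (Suc (idx M)))" if "N \<in> fin_normal G" "M \<subseteq> N" for N
      by (rule x_eq[OF that(1), of "idx M"]) (use K_cofinal[OF M] that in \<open>auto simp: idx_def\<close>)
    then show "\<exists>g\<in>carrier G. \<forall>N\<in>fin_normal G. M \<subseteq> N \<longrightarrow> x N = N #> g" using g by blast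
  qed
  moreover have "completed_act G \<phi> x (embed G \<phi> v) = p"
  proof
    fix m
    have "completed_act G \<phi> x (embed G \<phi> v) m = orb (K G m) (\<phi> (g (r (Suc m))) v)"
      by (rule completed_act_apply[of "embed G \<phi> v" m v x, OF embed_apply x_eq[OF K_fin_normal order_refl lessI] g vE])
    also have "\<dots> = p m"
      using climit_mem(2)[OF p gp, of m "r (Suc m)"] r[of "Suc m"] by simp
    finally show "completed_act G \<phi> x (embed G \<phi> v) m = p m" .
  qed
  ultimately show thesis using that vE by metis
qed

end

section \<open>Recovering group elements and points from the completion\<close>

locale proper_action = fg_action +
  assumes rf: "residually_finite G"
    and finite_stab: "\<And>v. v \<in> E \<Longrightarrow> finite (stabilizer G \<phi> v)"
begin

lemma finite_transporter:
  assumes "v \<in> E"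
  shows "finite {g \<in> carrier G. \<phi> g v = w}" (is "finite ?T")
proof (cases "\<exists>h\<in>carrier G. \<phi> h v = w")
  case True
  then obtain h where h: "h \<in> carrier G" "\<phi> h v = w" by blast
  have "?T \<subseteq> (\<lambda>s. h \<otimes> s) ` stabilizer G \<phi> v"
  proof
    fix g assume g: "g \<in> ?T"
    then have "g = h \<otimes> (inv h \<otimes> g)" using h by (simp add: m_assoc[symmetric])
    moreover have "\<phi> (inv h \<otimes> g) v = v" using g h assms act_inv[of h v] by (simp add: act_mult)
    then have "inv h \<otimes> g \<in> stabilizer G \<phi> v" using g h by (simp add: stabilizer_def)
    ultimately show "g \<in> (\<lambda>s. h \<otimes> s) ` stabilizer G \<phi> v" by blast
  qed
  then show ?thesis using finite_stab[OF assms] finite_surj by blast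
next
  case False
  then have "?T = {}" by blast
  then show ?thesis by (simp only: finite.emptyI)
qed

text \<open>At each level a representative of \<open>x\<close> carries \<open>v\<close> into the
  \<open>K G m\<close>-orbit of \<open>w\<close>, and a correction by an element of
  \<open>K G m\<close> within the same coset makes it hit \<open>w\<close> exactly. Only finitely
  many elements of \<open>G\<close> carry \<open>v\<close> to \<open>w\<close>, so one of them lies
  in all cosets of \<open>x\<close>. For \<open>w = v\<close> this says that passing to the
  completion does not enlarge the stabilizer.\<close>

lemma transporter_in_G:
  assumes x: "x \<in> carrier PC" and v: "v \<in> E" and w: "w \<in> E"
    and eq: "completed_act G \<phi> x (embed G \<phi> v) = embed G \<phi> w"
  obtains g where "g \<in> carrier G" "\<phi> g v = w" "x = completion_embed G g"
proof -
  have "\<exists>g\<in>{g \<in> carrier G. \<phi> g v = w}. \<forall>m. g \<in> x (K G m)"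
  proof (rule finite_antimono_ex[OF finite_transporter[OF v]])
    fix m
    obtain h where h: "h \<in> carrier G" "x (K G m) = K G m #> h" using PC_coset[OF x K_fin_normal] by blast
    have "orb (K G m) (\<phi> h v) = orb (K G m) w"
      using completed_act_apply[of "embed G \<phi> v" m v x h, OF embed_apply h(2,1) v] eq by (simp add: embed_apply)
    then have "w \<in> orb (K G m) (\<phi> h v)" using orb_self[OF K_facts(2) w] by simp
    then obtain n where n: "n \<in> K G m" "w = \<phi> n (\<phi> h v)" by (auto simp: mem_orb)
    have nc: "n \<in> carrier G" using n(1) by (simp add: K_def)
    have "n \<otimes> h \<in> x (K G m)" unfolding h(2) r_coset_def using n(1) by blast
    moreover have "n \<otimes> h \<in> carrier G" "\<phi> (n \<otimes> h) v = w" using nc h n(2) v by (simp_all add: act_mult)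
    ultimately show "\<exists>g\<in>{g \<in> carrier G. \<phi> g v = w}. g \<in> x (K G m)" by blast
  next
    fix k m g assume km: "k \<le> m" and g: "g \<in> x (K G m)"
    obtain h where h: "h \<in> carrier G" "x (K G m) = K G m #> h" using PC_coset[OF x K_fin_normal] by blast
    have "x (K G k) = K G k #> h"
      by (rule PC_coset_superset[OF x K_fin_normal K_fin_normal K_antimono[OF km] h])
    then show "g \<in> x (K G k)"
      using g K_antimono[OF km] unfolding h(2) r_coset_def by blast
  qed
  then obtain g where g: "g \<in> carrier G" "\<phi> g v = w" and gx: "\<And>m. g \<in> x (K G m)" by blast
  have "x = completion_embed G g"
  proof (rule PC_eqI_K[OF x completion_embed_closed[OF g(1)]])
    fix m
    obtain h where h: "h \<in> carrier G" "x (K G m) = K G m #> h" using PC_coset[OF x K_fin_normal] by blast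
    have "K G m #> h = K G m #> g"
      by (rule repr_independence) (use gx[of m] h in simp_all)
    then show "x (K G m) = completion_embed G g (K G m)" by (simp add: h(2) completion_embed_apply)
  qed
  then show thesis using that g by blast
qed

lemma completion_embed_inj:
  assumes "a \<in> carrier G" "b \<in> carrier G" "completion_embed G a = completion_embed G b"
  shows "a = b"
proof -
  have "a \<otimes> inv b \<in> K G m" for m
  proof -
    have "K G m #> a = K G m #> b"
      using fun_cong[OF assms(3), of "K G m"] by (simp add: completion_embed_apply)
    then show ?thesis using assms by (simp add: r_coset_eq_iff)
  qed
  then have "a \<otimes> inv b = \<one>" using assms by (intro residually_finite_eq_one[OF rf]) simp_all
  then show ?thesis using assms by (metis inv_equality inv_closed inv_inv)
qed

text \<open>The identity of the completion carries one embedded point to the other, so by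
  \<open>transporter_in_G\<close> it comes from an element carrying \<open>v\<close> to
  \<open>w\<close>; by residual finiteness this element is \<one>.\<close>

lemma embed_inj:
  assumes v: "v \<in> E" and w: "w \<in> E" and eq: "embed G \<phi> v = embed G \<phi> w"
  shows "v = w"
proof -
  have "completed_act G \<phi> (completion_embed G \<one>) (embed G \<phi> v) = embed G \<phi> w"
    unfolding completed_act_embed[OF one_closed v] act_one[OF v] by (rule eq)
  then obtain g where g: "g \<in> carrier G" "\<phi> g v = w" "completion_embed G \<one> = completion_embed G g"
    using transporter_in_G[OF completion_embed_closed[OF one_closed] v w] by blast
  have "\<one> = g" using one_closed g(1,3) by (rule completion_embed_inj)
  then show ?thesis using g(2) act_one[OF v] by simp
qed

end

section \<open>Continuous homomorphisms between completions\<close>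

locale completion_iso = G1: fg_group G1 + G2: fg_group G2
  for G1 :: "('g, 'y) monoid_scheme" and G2 :: "('h, 'z) monoid_scheme" +
  fixes \<Phi> :: "('g set \<Rightarrow> 'g set) \<Rightarrow> ('h set \<Rightarrow> 'h set)"
  assumes iso: "\<Phi> \<in> iso (profinite_completion G1) (profinite_completion G2)"
    and cont: "continuous_map (profinite_topology G1) (profinite_topology G2) \<Phi>"
begin

abbreviation "PC1 \<equiv> profinite_completion G1"
abbreviation "PC2 \<equiv> profinite_completion G2"

lemma grp1: "group PC1" and grp2: "group PC2"
  by (rule G1.group_profinite_completion, rule G2.group_profinite_completion)

lemma hom: "\<Phi> \<in> hom PC1 PC2"
  using iso by (simp add: iso_def)

lemma Phi_closed: "x \<in> carrier PC1 \<Longrightarrow> \<Phi> x \<in> carrier PC2"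
  using hom by (rule hom_in_carrier)

lemma Phi_mult: "\<lbrakk>x \<in> carrier PC1; y \<in> carrier PC1\<rbrakk> \<Longrightarrow> \<Phi> (x \<otimes>\<^bsub>PC1\<^esub> y) = \<Phi> x \<otimes>\<^bsub>PC2\<^esub> \<Phi> y"
  using hom by (rule hom_mult)

lemma group_hom_Phi: "group_hom PC1 PC2 \<Phi>"
  using grp1 grp2 hom by (simp add: group_hom_def group_hom_axioms_def)

lemma Phi_inv: "x \<in> carrier PC1 \<Longrightarrow> \<Phi> (inv\<^bsub>PC1\<^esub> x) = inv\<^bsub>PC2\<^esub> \<Phi> x"
  by (rule group_hom.hom_inv[OF group_hom_Phi])

text \<open>Density of \<open>G1\<close> with two demands met at once: \<open>g\<close> represents
  \<open>x\<close> at \<open>M \<inter> L\<close>, where agreement at \<open>M\<close> fixes the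
  image at \<open>N\<close> by continuity and agreement at \<open>L\<close> gives the prescribed
  coset.\<close>

lemma Phi_approx:
  assumes x: "x \<in> carrier PC1" and N: "N \<in> fin_normal G2" and L: "L \<in> fin_normal G1"
  obtains g where "g \<in> carrier G1" "x L = L #>\<^bsub>G1\<^esub> g" "\<Phi> x N = \<Phi> (completion_embed G1 g) N"
proof -
  obtain M where M: "M \<in> fin_normal G1"
    and eq: "\<And>y. \<lbrakk>y \<in> carrier PC1; y M = x M\<rbrakk> \<Longrightarrow> \<Phi> y N = \<Phi> x N"
    using continuous_profinite_component[OF G1.is_group cont x N] by blast
  have MiL: "M \<inter> L \<in> fin_normal G1" using M L by (rule G1.fin_normal_Int)
  obtain g where g: "g \<in> carrier G1" "x (M \<inter> L) = (M \<inter> L) #>\<^bsub>G1\<^esub> g"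
    using G1.PC_coset[OF x MiL] by blast
  have "x L = L #>\<^bsub>G1\<^esub> g" by (rule G1.PC_coset_superset[OF x L MiL Int_lower2 g])
  moreover have "x M = M #>\<^bsub>G1\<^esub> g" by (rule G1.PC_coset_superset[OF x M MiL Int_lower1 g])
  then have "\<Phi> (completion_embed G1 g) N = \<Phi> x N"
    using G1.completion_embed_closed[OF g(1)] M by (intro eq) (simp_all add: completion_embed_apply)
  ultimately show thesis using that g(1) by simp
qed

text \<open>A subgroup \<open>H\<close> of \<open>G2\<close> of index at most \<open>m\<close> contains \<open>K G2 m\<close>; it pulls back along
  \<open>G1 \<rightarrow> PC1 \<rightarrow> PC2 \<rightarrow> G2/K G2 m\<close> to a subgroup of index at most \<open>m\<close>, which contains \<open>K G1 m\<close>.\<close>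

lemma Phi_embed_level:
  assumes gg': "g \<in> carrier G1" "g' \<in> carrier G1" and K: "g \<otimes>\<^bsub>G1\<^esub> inv\<^bsub>G1\<^esub> g' \<in> K G1 m"
  shows "\<Phi> (completion_embed G1 g) (K G2 m) = \<Phi> (completion_embed G1 g') (K G2 m)"
proof -
  let ?K = "K G2 m"
  have "\<forall>a\<in>carrier G1. \<exists>c. c \<in> carrier G2 \<and> \<Phi> (completion_embed G1 a) ?K = ?K #>\<^bsub>G2\<^esub> c"
    using G2.PC_coset[OF Phi_closed[OF G1.completion_embed_closed] G2.K_fin_normal] by blast
  from bchoice[OF this] obtain f where
    f_all: "\<forall>a\<in>carrier G1. f a \<in> carrier G2 \<and> \<Phi> (completion_embed G1 a) ?K = ?K #>\<^bsub>G2\<^esub> f a" ..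
  have f: "f a \<in> carrier G2" "\<Phi> (completion_embed G1 a) ?K = ?K #>\<^bsub>G2\<^esub> f a" if "a \<in> carrier G1" for a
    using f_all that by blast+
  \<comment> \<open>The lift \<open>f\<close> is an arbitrary choice of representatives and is
    compatible with the group operations only modulo \<open>?K\<close>. This suffices for membership
    in a subgroup \<open>H\<close> that contains \<open>?K\<close>.\<close>
  have f_diff: "?K #>\<^bsub>G2\<^esub> f (a \<otimes>\<^bsub>G1\<^esub> inv\<^bsub>G1\<^esub> b) = ?K #>\<^bsub>G2\<^esub> (f a \<otimes>\<^bsub>G2\<^esub> inv\<^bsub>G2\<^esub> f b)"
    if ab: "a \<in> carrier G1" "b \<in> carrier G1" for a b
  proof -
    have eq: "\<Phi> (completion_embed G1 (a \<otimes>\<^bsub>G1\<^esub> inv\<^bsub>G1\<^esub> b))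
        = \<Phi> (completion_embed G1 a) \<otimes>\<^bsub>PC2\<^esub> inv\<^bsub>PC2\<^esub> \<Phi> (completion_embed G1 b)"
      unfolding G1.completion_embed_mult[OF ab(1) G1.inv_closed[OF ab(2)]] G1.completion_embed_inv[OF ab(2)]
        Phi_mult[OF G1.completion_embed_closed[OF ab(1)] group.inv_closed[OF grp1 G1.completion_embed_closed[OF ab(2)]]]
        Phi_inv[OF G1.completion_embed_closed[OF ab(2)]] ..
    have i: "(inv\<^bsub>PC2\<^esub> \<Phi> (completion_embed G1 b)) ?K = ?K #>\<^bsub>G2\<^esub> inv\<^bsub>G2\<^esub> f b"
      by (rule G2.PC_inv_apply[OF Phi_closed[OF G1.completion_embed_closed[OF ab(2)]] G2.K_fin_normal f[OF ab(2)]])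
    have "\<Phi> (completion_embed G1 (a \<otimes>\<^bsub>G1\<^esub> inv\<^bsub>G1\<^esub> b)) ?K = ?K #>\<^bsub>G2\<^esub> (f a \<otimes>\<^bsub>G2\<^esub> inv\<^bsub>G2\<^esub> f b)"
      unfolding eq
      by (rule G2.PC_mult_apply[of ?K "f a" "inv\<^bsub>G2\<^esub> f b" "\<Phi> (completion_embed G1 a)"
            "inv\<^bsub>PC2\<^esub> \<Phi> (completion_embed G1 b)",
          OF G2.K_fin_normal f(1)[OF ab(1)] G2.inv_closed[OF f(1)[OF ab(2)]] f(2)[OF ab(1)] i])
    then show ?thesis using f(2)[of "a \<otimes>\<^bsub>G1\<^esub> inv\<^bsub>G1\<^esub> b"] ab by simp
  qed
  have "f g \<otimes>\<^bsub>G2\<^esub> inv\<^bsub>G2\<^esub> f g' \<in> H"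
    if H: "subgroup H G2" "finite (rcosets\<^bsub>G2\<^esub> H)" "card (rcosets\<^bsub>G2\<^esub> H) \<le> m" for H
  proof -
    define L where "L = {a \<in> carrier G1. f a \<in> H}"
    have KH: "?K \<subseteq> H" using H by (rule G2.K_subset)
    have diff: "a \<otimes>\<^bsub>G1\<^esub> inv\<^bsub>G1\<^esub> b \<in> L \<longleftrightarrow> f a \<otimes>\<^bsub>G2\<^esub> inv\<^bsub>G2\<^esub> f b \<in> H"
      if ab: "a \<in> carrier G1" "b \<in> carrier G1" for a b
    proof -
      let ?s = "f (a \<otimes>\<^bsub>G1\<^esub> inv\<^bsub>G1\<^esub> b)" and ?t = "f a \<otimes>\<^bsub>G2\<^esub> inv\<^bsub>G2\<^esub> f b"
      have st: "?s \<in> carrier G2" "?t \<in> carrier G2" using ab f(1) by simp_all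
      have "H #>\<^bsub>G2\<^esub> ?s = H #>\<^bsub>G2\<^esub> ?t"
        by (rule G2.r_coset_eq_superset[OF H(1) G2.K_facts(2) KH st f_diff[OF ab]])
      then have "?s \<in> H \<longleftrightarrow> ?t \<in> H"
        using G2.coset_join1[OF _ st(1) H(1)] G2.coset_join1[OF _ st(2) H(1)]
          G2.coset_join2[OF st(1) H(1)] G2.coset_join2[OF st(2) H(1)] by blast
      then show ?thesis using ab by (simp add: L_def)
    qed
    have one: "\<one>\<^bsub>G1\<^esub> \<in> L"
      using diff[OF G1.one_closed G1.one_closed] f(1)[OF G1.one_closed] subgroup.one_closed[OF H(1)] by simp
    have inv: "inv\<^bsub>G1\<^esub> b \<in> L" if b: "b \<in> L" for b
    proof -
      have bc: "b \<in> carrier G1" using b by (simp add: L_def)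
      have "f \<one>\<^bsub>G1\<^esub> \<otimes>\<^bsub>G2\<^esub> inv\<^bsub>G2\<^esub> f b \<in> H"
        using one b H(1) by (simp add: L_def subgroup.m_closed subgroup.m_inv_closed)
      then show ?thesis using diff[OF G1.one_closed bc] bc by simp
    qed
    have mult: "a \<otimes>\<^bsub>G1\<^esub> b \<in> L" if a: "a \<in> L" and b: "b \<in> L" for a b
    proof -
      have c: "a \<in> carrier G1" "b \<in> carrier G1" using a b by (simp_all add: L_def)
      have "f a \<otimes>\<^bsub>G2\<^esub> inv\<^bsub>G2\<^esub> f (inv\<^bsub>G1\<^esub> b) \<in> H"
        using a inv[OF b] H(1) by (simp add: L_def subgroup.m_closed subgroup.m_inv_closed)
      then show ?thesis using diff[OF c(1) G1.inv_closed[OF c(2)]] c by simp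
    qed
    have L: "subgroup L G1"
      by (rule G1.subgroupI) (use one inv mult in \<open>auto simp: L_def\<close>)
    have c: "(\<lambda>a. H #>\<^bsub>G2\<^esub> f a) ` carrier G1 \<subseteq> rcosets\<^bsub>G2\<^esub> H"
      using f(1) by (auto intro!: G2.r_coset_in_rcosets)
    have inj: "a \<otimes>\<^bsub>G1\<^esub> inv\<^bsub>G1\<^esub> b \<in> L"
      if "a \<in> carrier G1" "b \<in> carrier G1" "H #>\<^bsub>G2\<^esub> f a = H #>\<^bsub>G2\<^esub> f b" for a b
      using that(3) diff[OF that(1,2)] G2.r_coset_eq_iff[OF H(1) f(1)[OF that(1)] f(1)[OF that(2)]] by simp
    note fin = G1.index_le_cardI[where c = "\<lambda>a. H #>\<^bsub>G2\<^esub> f a", OF L H(2) c inj]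
    have "K G1 m \<subseteq> L" by (rule G1.K_subset[OF L fin(1) order_trans[OF fin(2) H(3)]]) simp_all
    then show ?thesis using K diff[OF gg'] by blast
  qed
  then have "f g \<otimes>\<^bsub>G2\<^esub> inv\<^bsub>G2\<^esub> f g' \<in> ?K"
    using f(1) gg' unfolding K_def by simp
  then show ?thesis
    using G2.r_coset_eq_iff[OF G2.K_facts(2) f(1)[OF gg'(1)] f(1)[OF gg'(2)]] f(2) gg' by simp
qed

lemma Phi_level:
  assumes x: "x \<in> carrier PC1" and y: "y \<in> carrier PC1" and eq: "x (K G1 m) = y (K G1 m)"
  shows "\<Phi> x (K G2 m) = \<Phi> y (K G2 m)"
proof -
  obtain g where g: "g \<in> carrier G1" "x (K G1 m) = K G1 m #>\<^bsub>G1\<^esub> g"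
    "\<Phi> x (K G2 m) = \<Phi> (completion_embed G1 g) (K G2 m)"
    using Phi_approx[OF x G2.K_fin_normal G1.K_fin_normal] by blast
  obtain h where h: "h \<in> carrier G1" "y (K G1 m) = K G1 m #>\<^bsub>G1\<^esub> h"
    "\<Phi> y (K G2 m) = \<Phi> (completion_embed G1 h) (K G2 m)"
    using Phi_approx[OF y G2.K_fin_normal G1.K_fin_normal] by blast
  have "g \<otimes>\<^bsub>G1\<^esub> inv\<^bsub>G1\<^esub> h \<in> K G1 m"
    using eq g(1,2) h(1,2) by (simp add: G1.r_coset_eq_iff)
  then show ?thesis using Phi_embed_level g h by simp
qed

text \<open>\<open>Phi_level\<close> is the well-definedness required by the definite description;
  the element \<open>x\<close> itself witnesses uniqueness.\<close>

lemma induced_quotient_map_apply: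
  assumes x: "x \<in> carrier PC1"
  shows "induced_quotient_map G1 G2 \<Phi> m (x (K G1 m)) = \<Phi> x (K G2 m)"
  unfolding induced_quotient_map_def
  by (rule the_equality) (use x Phi_level in blast)+

text \<open>Both sides are continuous and agree on the dense image of \<open>G1\<close>. Concretely,
  the coordinate at \<open>N\<close> of the completed \<open>h\<close> reads \<open>x\<close> at the
  preimage \<open>L\<close> of \<open>N\<close>, and \<open>Phi_approx\<close> gives one
  \<open>g\<close> that serves both \<open>L\<close> and the value of \<Phi> at
  \<open>N\<close>.\<close>

lemma conjugate_of_completed_hom:
  assumes u: "u \<in> carrier PC2" and h: "h \<in> hom G1 G2"
    and eq: "\<And>g. g \<in> carrier G1 \<Longrightarrow> \<Phi> (completion_embed G1 g) = Inn PC2 u (completion_embed G2 (h g))"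
    and x: "x \<in> carrier PC1"
  shows "\<Phi> x = Inn PC2 u (completed_hom G1 G2 h x)"
proof
  interpret h: group_hom G1 G2 h
    using G1.is_group G2.is_group h by (simp add: group_hom_def group_hom_axioms_def)
  fix N
  show "\<Phi> x N = Inn PC2 u (completed_hom G1 G2 h x) N"
  proof (cases "N \<in> fin_normal G2")
    \<comment> \<open>Elements of the completion are extensional, so both sides are
      \<open>undefined\<close> off the index set.\<close>
    case False
    then have "\<Phi> x N = undefined"
      using Phi_closed[OF x] by (simp add: profinite_completion_outside)
    then show ?thesis using False by (simp add: Inn_def mult_profinite_completion)
  next
    case N: True
    note Nn = G2.fin_normalD[OF N]
    define L where "L = {g \<in> carrier G1. h g \<in> N}"
    have Ls: "subgroup L G1"
      by (rule G1.subgroupI)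
        (use subgroup.one_closed[OF Nn(3)] subgroup.m_closed[OF Nn(3)] subgroup.m_inv_closed[OF Nn(3)]
          in \<open>auto simp: L_def intro!: exI[of _ "\<one>\<^bsub>G1\<^esub>"]\<close>)
    have "a \<otimes>\<^bsub>G1\<^esub> l \<otimes>\<^bsub>G1\<^esub> inv\<^bsub>G1\<^esub> a \<in> L" if "a \<in> carrier G1" "l \<in> L" for a l
      using that normal.inv_op_closed2[OF Nn(1), of "h a" "h l"] by (simp add: L_def)
    then have Ln: "L \<lhd> G1" using Ls by (simp add: G1.normal_inv_iff)
    have "finite (rcosets\<^bsub>G1\<^esub> L)"
    proof (rule G1.index_le_cardI(1)[OF Ls Nn(2)])
      show "(\<lambda>g. N #>\<^bsub>G2\<^esub> h g) ` carrier G1 \<subseteq> rcosets\<^bsub>G2\<^esub> N"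
        by (auto intro!: G2.r_coset_in_rcosets)
    next
      fix a b assume "a \<in> carrier G1" "b \<in> carrier G1" "N #>\<^bsub>G2\<^esub> h a = N #>\<^bsub>G2\<^esub> h b"
      then show "a \<otimes>\<^bsub>G1\<^esub> inv\<^bsub>G1\<^esub> b \<in> L"
        using G2.r_coset_eq_iff[OF Nn(3), of "h a" "h b"] by (simp add: L_def)
    qed
    then have L: "L \<in> fin_normal G1" using Ln by (simp add: fin_normal_def)
    obtain g where g: "g \<in> carrier G1" "x L = L #>\<^bsub>G1\<^esub> g" "\<Phi> x N = \<Phi> (completion_embed G1 g) N"
      using Phi_approx[OF x N L] by blast
    \<comment> \<open>As \<open>h\<close> maps \<open>L\<close> into \<open>N\<close>, the set
      product collapses to one coset.\<close>
    have "N <#>\<^bsub>G2\<^esub> (h ` x L) = N #>\<^bsub>G2\<^esub> h g"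
    proof (intro equalityI subsetI)
      fix z assume "z \<in> N <#>\<^bsub>G2\<^esub> (h ` x L)"
      then obtain n l where nl: "n \<in> N" "l \<in> L" "z = n \<otimes>\<^bsub>G2\<^esub> h (l \<otimes>\<^bsub>G1\<^esub> g)"
        unfolding g(2) set_mult_def r_coset_def by blast
      then have lc: "l \<in> carrier G1" "h l \<in> N" by (simp_all add: L_def)
      have nc: "n \<in> carrier G2" using nl(1) Nn(4) by blast
      have "z = (n \<otimes>\<^bsub>G2\<^esub> h l) \<otimes>\<^bsub>G2\<^esub> h g"
        using nl(3) nc lc g(1) by (simp add: G2.m_assoc)
      then show "z \<in> N #>\<^bsub>G2\<^esub> h g"
        using subgroup.m_closed[OF Nn(3) nl(1) lc(2)] unfolding r_coset_def by blast
    next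
      fix z assume "z \<in> N #>\<^bsub>G2\<^esub> h g"
      then obtain n where n: "n \<in> N" "z = n \<otimes>\<^bsub>G2\<^esub> h g" unfolding r_coset_def by blast
      have "g \<in> x L" unfolding g(2) using g(1) Ls by (rule G1.rcos_self)
      then show "z \<in> N <#>\<^bsub>G2\<^esub> (h ` x L)" using n unfolding set_mult_def by blast
    qed
    then have "completed_hom G1 G2 h x N = completion_embed G2 (h g) N"
      using N by (simp add: completed_hom_def L_def completion_embed_apply)
    then have "Inn PC2 u (completed_hom G1 G2 h x) N = Inn PC2 u (completion_embed G2 (h g)) N"
      using N by (simp add: Inn_def mult_profinite_completion)
    then show ?thesis using g(3) eq[OF g(1)] by simp
  qed
qed

end

section \<open>Maps induced on completions by equivariant maps\<close>

definition levelwise :: "('x \<Rightarrow> 'y) \<Rightarrow> (nat \<Rightarrow> 'x set) \<Rightarrow> nat \<Rightarrow> 'y set" where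
  "levelwise t p = (\<lambda>m. t ` p m)"

text \<open>Covers \<open>tail\<close> and \<open>head\<close>, from edges to vertices, as well as
  the reversal, from edges to edges.\<close>

locale action_map = A: fg_action G A \<alpha> + V: fg_action G V \<phi>
  for G (structure) and A and \<alpha> and V and \<phi> +
  fixes t
  assumes t_closed: "a \<in> A \<Longrightarrow> t a \<in> V"
    and t_act: "\<lbrakk>g \<in> carrier G; a \<in> A\<rbrakk> \<Longrightarrow> t (\<alpha> g a) = \<phi> g (t a)"
begin

lemma image_set_act:
  assumes "C \<subseteq> carrier G" "S \<subseteq> A"
  shows "t ` set_act \<alpha> C S = set_act \<phi> C (t ` S)"
  by (rule set_act_image) (use assms t_act in blast)

lemma image_orb:
  assumes "subgroup N G" "a \<in> A"
  shows "t ` A.orb N a = V.orb N (t a)"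
proof -
  have "t (\<alpha> n a) = \<phi> n (t a)" if "n \<in> N" for n
    by (rule t_act[OF subgroup.mem_carrier[OF assms(1) that] assms(2)])
  then show ?thesis by (force simp: orbit_def)
qed

lemma image_level: "p \<in> level G \<alpha> A m \<Longrightarrow> t ` p \<in> level G \<phi> V m"
proof -
  assume "p \<in> level G \<alpha> A m"
  then obtain a where "a \<in> A" "p = A.orb (K G m) a" by (auto simp: A.level_iff)
  then have "t ` p = V.orb (K G m) (t a)" "t a \<in> V"
    using image_orb[OF A.K_facts(2)] t_closed by simp_all
  then show ?thesis unfolding V.level_iff by blast
qed

lemma image_level_proj:
  assumes p: "p \<in> level G \<alpha> A m"
  shows "t ` set_act \<alpha> (K G k) p = set_act \<phi> (K G k) (t ` p)"
proof (rule image_set_act)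
  show "K G k \<subseteq> carrier G" by (simp add: K_def)
  show "p \<subseteq> A" using A.level_mem(1)[OF p] by blast
qed

lemma levelwise_closed: "p \<in> climit G \<alpha> A \<Longrightarrow> levelwise t p \<in> climit G \<phi> V"
  using image_level image_level_proj by (simp add: climit_iff levelwise_def) metis

lemma levelwise_embed: "a \<in> A \<Longrightarrow> levelwise t (embed G \<alpha> a) = embed G \<phi> (t a)"
  by (simp add: levelwise_def embed_def image_orb fun_eq_iff)

lemma levelwise_act:
  assumes x: "x \<in> carrier A.PC" and p: "p \<in> climit G \<alpha> A"
  shows "levelwise t (completed_act G \<alpha> x p) = completed_act G \<phi> x (levelwise t p)"
proof
  fix m
  obtain g where g: "g \<in> carrier G" "x (K G m) = K G m #> g"
    using A.PC_coset[OF x A.K_fin_normal] by blast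
  have "K G m \<subseteq> carrier G" by (simp add: K_def)
  then have C: "x (K G m) \<subseteq> carrier G"
    unfolding g(2) by (rule A.r_coset_subset_G[OF _ g(1)])
  have S: "p m \<subseteq> A" using A.climit_mem(1)[OF p _ order_refl] by blast
  show "levelwise t (completed_act G \<alpha> x p) m = completed_act G \<phi> x (levelwise t p) m"
    unfolding levelwise_def completed_act_def by (rule image_set_act[OF C S])
qed

text \<open>This is where local finiteness acts. Every \<open>p m\<close> contains an edge lying
  exactly over \<open>v\<close>, and only finitely many edges do, so one of them occurs in all
  \<open>p m\<close> and thereby equals \<open>p\<close>.\<close>

lemma levelwise_fiber:
  assumes p: "p \<in> climit G \<alpha> A" and v: "v \<in> V" and fin: "finite {a \<in> A. t a = v}"
    and eq: "levelwise t p = embed G \<phi> v"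
  obtains a where "a \<in> A" "t a = v" "p = embed G \<alpha> a"
proof -
  have "\<exists>a\<in>{a \<in> A. t a = v}. \<forall>m. a \<in> p m"
  proof (rule finite_antimono_ex[OF fin])
    fix m
    have "t ` p m = V.orb (K G m) v"
      using fun_cong[OF eq, of m] by (simp add: levelwise_def embed_def)
    then have "v \<in> t ` p m" using V.orb_self[OF A.K_facts(2) v] by simp
    then obtain a where "a \<in> p m" "t a = v" by blast
    then show "\<exists>a\<in>{a \<in> A. t a = v}. a \<in> p m" using A.climit_mem(1)[OF p _ order_refl] by blast
  next
    fix k m a assume "k \<le> m" "a \<in> p m"
    then show "a \<in> p k" using A.climit_mem(3)[OF p] by blast
  qed
  then obtain a where "a \<in> A" "t a = v" "\<And>m. a \<in> p m" by blast
  then show thesis using A.climit_eq_embed[OF p] that by blast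
qed

end

section \<open>Invariant subsets\<close>

context fg_action
begin

lemma level_subset: "Z \<subseteq> E \<Longrightarrow> level G \<phi> Z m \<subseteq> level G \<phi> E m"
  by (auto simp: level_def orbits_def)

lemma climit_subset: "Z \<subseteq> E \<Longrightarrow> climit G \<phi> Z \<subseteq> climit G \<phi> E"
  using level_subset[of Z] by (intro subsetI) (simp add: climit_iff subset_iff)

text \<open>All elements of all components of \<open>p\<close> lie in the single
  \<open>G\<close>-orbit \<open>p 0\<close>, which an invariant set either contains or misses. So
  any element at any level decides.\<close>

lemma mem_climit_invariant:
  assumes Z: "Z \<subseteq> E" "\<And>g. g \<in> carrier G \<Longrightarrow> \<phi> g ` Z \<subseteq> Z" and p: "p \<in> climit G \<phi> E" and v: "v \<in> p m"
  shows "p \<in> climit G \<phi> Z \<longleftrightarrow> v \<in> Z"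
proof
  assume "p \<in> climit G \<phi> Z"
  then have "p m \<in> level G \<phi> Z m" by (simp add: climit_iff)
  then obtain z where z: "z \<in> Z" "p m = orb (K G m) z" by (auto simp: level_def orbits_def)
  then obtain g where "g \<in> K G m" "v = \<phi> g z" using v by (auto simp: mem_orb)
  then show "v \<in> Z" using Z(2)[of g] z(1) by (auto simp: K_def)
next
  assume vZ: "v \<in> Z"
  have vE: "v \<in> E" using vZ Z(1) by blast
  have sub: "p n \<subseteq> Z" for n
  proof
    fix w assume "w \<in> p n"
    then have "w \<in> p 0" using climit_mem(3)[OF p _ le0] by blast
    moreover have "p 0 = orb (K G 0) v" by (rule climit_mem(2)[OF p v le0])
    ultimately have "\<exists>g\<in>K G 0. w = \<phi> g v" by (simp only: mem_orb)
    then obtain g where "g \<in> carrier G" "w = \<phi> g v" unfolding K_0 by blast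
    then show "w \<in> Z" using Z(2)[of g] vZ by auto
  qed
  have "p n \<in> level G \<phi> Z n" for n
  proof -
    obtain w where w: "w \<in> p n" using climit_nonempty[OF p] by blast
    have "p n = orb (K G n) w" by (rule climit_mem(2)[OF p w order_refl])
    then show ?thesis using sub[of n] w by (auto simp: level_def orbits_def)
  qed
  then show "p \<in> climit G \<phi> Z" using p by (simp add: climit_iff)
qed

lemma embed_mem_climit_iff:
  assumes "Z \<subseteq> E" "\<And>g. g \<in> carrier G \<Longrightarrow> \<phi> g ` Z \<subseteq> Z" "v \<in> E"
  shows "embed G \<phi> v \<in> climit G \<phi> Z \<longleftrightarrow> v \<in> Z"
  by (rule mem_climit_invariant[OF assms(1,2) embed_closed[OF assms(3)], where m = 0])
    (simp_all add: embed_apply orb_self assms)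

lemma completed_act_invariant:
  assumes Z: "Z \<subseteq> E" "\<And>g. g \<in> carrier G \<Longrightarrow> \<phi> g ` Z \<subseteq> Z"
    and x: "x \<in> carrier PC" and p: "p \<in> climit G \<phi> Z"
  shows "completed_act G \<phi> x p \<in> climit G \<phi> Z"
proof -
  have pE: "p \<in> climit G \<phi> E" using p climit_subset[OF Z(1)] by blast
  obtain v where v: "v \<in> p 0" using climit_nonempty[OF pE] by blast
  have vZ: "v \<in> Z" using mem_climit_invariant[OF Z pE v] p by simp
  obtain g where g: "g \<in> carrier G" "x (K G 0) = K G 0 #> g" using PC_coset[OF x K_fin_normal] by blast
  note vE = climit_mem(1)[OF pE v order_refl]
  have "completed_act G \<phi> x p 0 = orb (K G 0) (\<phi> g v)"
    by (rule completed_act_apply[of p 0 v x g, OF climit_mem(2)[OF pE v order_refl] g(2,1) vE])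
  then have "\<phi> g v \<in> completed_act G \<phi> x p 0"
    using orb_self[OF K_facts(2) act_closed[OF g(1) vE]] by simp
  moreover have "\<phi> g v \<in> Z" using Z(2)[OF g(1)] vZ by blast
  ultimately show ?thesis
    using mem_climit_invariant[OF Z completed_act_closed[OF x pE], of "\<phi> g v" 0] by simp
qed

end

section \<open>Completed graphs\<close>

lemma completed_graph_simps [simp]:
  "verts (completed_graph G X) = climit G (vact X) (verts X)"
  "arcs (completed_graph G X) = climit G (aact X) (arcs X)"
  "tail (completed_graph G X) = levelwise (tail X)"
  "head (completed_graph G X) = levelwise (head X)"
  "reversal (completed_graph G X) = map_option levelwise (reversal X)"
  by (simp_all add: completed_graph_def quotient_graph_def climit_def level_def[abs_def]
      levelwise_def[abs_def])

lemma quotient_graph_simps [simp]: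
  "verts (quotient_graph G (K G m) X) = level G (vact X) (verts X) m"
  "arcs (quotient_graph G (K G m) X) = level G (aact X) (arcs X) m"
  "tail (quotient_graph G N X) = (`) (tail X)"
  "head (quotient_graph G N X) = (`) (head X)"
  "reversal (quotient_graph G N X) = map_option (`) (reversal X)"
  by (simp_all add: quotient_graph_def level_def fun_eq_iff)

lemma completed_topology_simps:
  "completed_verts_topology G X = climit_topology G (vact X) (verts X)"
  "completed_arcs_topology G X = climit_topology G (aact X) (arcs X)"
  by (simp_all add: completed_verts_topology_def completed_arcs_topology_def climit_topology_def
      level_def[abs_def])

lemma sub_simps [simp]:
  "verts (sub X Z) = fst Z" "arcs (sub X Z) = snd Z" "vact (sub X Z) = vact X" "aact (sub X Z) = aact X"
  by (simp_all add: sub_def)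

lemma connected_multigraph_nonempty: "connected_multigraph X \<Longrightarrow> verts X \<noteq> {}"
  by (auto simp: connected_multigraph_def connected_def strongly_connected_def
      pre_digraph.truncate_def mk_symmetric_def)

text \<open>Connectedness concerns the symmetric closure, whose paths may cross an edge against its
  direction; hence the induction step is an equivalence.\<close>

lemma connected_multigraph_induct:
  assumes "connected_multigraph X" "v0 \<in> verts X" "P v0" "v \<in> verts X"
    and step: "\<And>a. a \<in> arcs X \<Longrightarrow> P (tail X a) \<longleftrightarrow> P (head X a)"
  shows "P v"
proof -
  let ?S = "mk_symmetric (pre_digraph.truncate X)"
  have "v0 \<rightarrow>\<^sup>*\<^bsub>?S\<^esub> v"
    using assms(1,2,4) unfolding connected_multigraph_def connected_def strongly_connected_def
    by (auto simp: pre_digraph.truncate_def mk_symmetric_def)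
  then have "(v0, v) \<in> rtrancl_on (verts ?S) (arcs_ends ?S)" by (simp add: reachable_def)
  then show ?thesis
  proof (induction rule: rtrancl_on_induct)
    case base
    show ?case by (rule assms(3))
  next
    case (step y z)
    then obtain a where "a \<in> arcs X" "(y = tail X a \<and> z = head X a) \<or> (y = head X a \<and> z = tail X a)"
      by (auto simp: arcs_ends_def arc_to_ends_def mk_symmetric_def pre_digraph.truncate_def)
    then show ?case using assms(5)[of a] step by blast
  qed
qed

locale graph_action =
  fixes G :: "('g, 'y) monoid_scheme" and X :: "('g, 'v, 'a) group_graph"
  assumes grp: "group G" and fg: "finitely_generated G" and rf: "residually_finite G"
    and multigraph: "directed_multigraph X" and conn: "connected_multigraph X"
    and lf: "locally_finite X" and acts: "acts_on_graph G X" and stab: "finite_vertex_stabilizers G X"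
begin

lemma tail_closed: "a \<in> arcs X \<Longrightarrow> tail X a \<in> verts X"
  and head_closed: "a \<in> arcs X \<Longrightarrow> head X a \<in> verts X"
  using multigraph by (auto simp: directed_multigraph_def wf_digraph_def pre_digraph.truncate_def)

lemma reversal_closed: "\<lbrakk>reversal X = Some r; a \<in> arcs X\<rbrakk> \<Longrightarrow> r a \<in> arcs X"
  using multigraph by (simp add: directed_multigraph_def)

lemma fg_action_verts: "fg_action G (verts X) (vact X)"
  and fg_action_arcs: "fg_action G (arcs X) (aact X)"
  using grp fg acts
  by (simp_all add: fg_action_def fg_group_def fg_group_axioms_def acts_on_graph_def)

lemma tail_act: "\<lbrakk>g \<in> carrier G; a \<in> arcs X\<rbrakk> \<Longrightarrow> tail X (aact X g a) = vact X g (tail X a)"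
  and head_act: "\<lbrakk>g \<in> carrier G; a \<in> arcs X\<rbrakk> \<Longrightarrow> head X (aact X g a) = vact X g (head X a)"
  and reversal_act:
    "\<lbrakk>reversal X = Some r; g \<in> carrier G; a \<in> arcs X\<rbrakk> \<Longrightarrow> r (aact X g a) = aact X g (r a)"
  using acts by (simp_all add: acts_on_graph_def)

text \<open>An element fixing an edge fixes its tail, so the edges carry a
  \<open>proper_action\<close> as well.\<close>

lemma finite_arc_stabilizer: "a \<in> arcs X \<Longrightarrow> finite (stabilizer G (aact X) a)"
proof (rule finite_subset[of _ "stabilizer G (vact X) (tail X a)"])
  assume a: "a \<in> arcs X"
  show "finite (stabilizer G (vact X) (tail X a))"
    using stab tail_closed[OF a] by (simp add: finite_vertex_stabilizers_def)
  show "stabilizer G (aact X) a \<subseteq> stabilizer G (vact X) (tail X a)"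
  proof
    fix g assume "g \<in> stabilizer G (aact X) a"
    then have "g \<in> carrier G" "aact X g a = a" by (simp_all add: stabilizer_def)
    then show "g \<in> stabilizer G (vact X) (tail X a)"
      using tail_act[of g a] a by (simp add: stabilizer_def)
  qed
qed

sublocale V: proper_action G "verts X" "vact X"
  using fg_action_verts rf stab
  by (simp add: proper_action_def proper_action_axioms_def finite_vertex_stabilizers_def)

sublocale A: proper_action G "arcs X" "aact X"
  using fg_action_arcs rf finite_arc_stabilizer
  by (simp add: proper_action_def proper_action_axioms_def)

sublocale T: action_map G "arcs X" "aact X" "verts X" "vact X" "tail X"
  by unfold_locales (rule tail_closed, assumption, rule tail_act)

sublocale H: action_map G "arcs X" "aact X" "verts X" "vact X" "head X"
  by unfold_locales (rule head_closed, assumption, rule head_act)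

lemma action_map_reversal:
  assumes "reversal X = Some r"
  shows "action_map G (arcs X) (aact X) (arcs X) (aact X) r"
  by unfold_locales (rule reversal_closed[OF assms], assumption, rule reversal_act[OF assms])

lemma finite_incident:
  assumes "v \<in> verts X"
  shows "finite {a \<in> arcs X. tail X a = v}" "finite {a \<in> arcs X. head X a = v}"
  using lf assms unfolding locally_finite_def by (auto elim: rev_finite_subset)

end

section \<open>Isomorphisms of completed graphs\<close>

locale graph_pair = X1: graph_action G1 X1 + X2: graph_action G2 X2
  for G1 :: "('g, 'y) monoid_scheme" and X1 :: "('g, 'v, 'a) group_graph"
    and G2 :: "('h, 'z) monoid_scheme" and X2 :: "('h, 'w, 'b) group_graph"
begin

abbreviation "VV1 \<equiv> climit G1 (vact X1) (verts X1)"
abbreviation "AA1 \<equiv> climit G1 (aact X1) (arcs X1)"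
abbreviation "VV2 \<equiv> climit G2 (vact X2) (verts X2)"
abbreviation "AA2 \<equiv> climit G2 (aact X2) (arcs X2)"
abbreviation "ev1 \<equiv> embed G1 (vact X1)"
abbreviation "ea1 \<equiv> embed G1 (aact X1)"
abbreviation "ev2 \<equiv> embed G2 (vact X2)"
abbreviation "ea2 \<equiv> embed G2 (aact X2)"

text \<open>Compatibility with endpoints alone, in a form that passes to the inverse map, so that
  the component argument can be run in both directions.\<close>

definition limit_hom where
  "limit_hom Fv Fa \<longleftrightarrow> (\<forall>p\<in>AA1. Fa p \<in> AA2 \<and>
     levelwise (tail X2) (Fa p) = Fv (levelwise (tail X1) p) \<and>
     levelwise (head X2) (Fa p) = Fv (levelwise (head X1) p))"

text \<open>The embedded graph \<open>X2\<close> is a connected component of its completion: by local finiteness, a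
  completed edge incident to a vertex of \<open>X2\<close> is an edge of \<open>X2\<close>.\<close>

lemma arc_into_component_tail:
  assumes F: "limit_hom Fv Fa" and a: "a \<in> arcs X1" and w: "w \<in> verts X2" "Fv (ev1 (tail X1 a)) = ev2 w"
  obtains b where "b \<in> arcs X2" "Fa (ea1 a) = ea2 b" "tail X2 b = w"
    "Fv (ev1 (head X1 a)) = ev2 (head X2 b)"
proof -
  have e: "ea1 a \<in> AA1" by (rule X1.A.embed_closed[OF a])
  have F': "Fa (ea1 a) \<in> AA2" "levelwise (tail X2) (Fa (ea1 a)) = ev2 w"
    "levelwise (head X2) (Fa (ea1 a)) = Fv (ev1 (head X1 a))"
    using F e w(2) a
    by (simp_all add: limit_hom_def X1.T.levelwise_embed X1.H.levelwise_embed)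
  obtain b where b: "b \<in> arcs X2" "tail X2 b = w" "Fa (ea1 a) = ea2 b"
    using X2.T.levelwise_fiber[OF F'(1) w(1) X2.finite_incident(1)[OF w(1)] F'(2)] by blast
  show thesis using that[OF b(1,3,2)] F'(3) b by (simp add: X2.H.levelwise_embed)
qed

lemma arc_into_component_head:
  assumes F: "limit_hom Fv Fa" and a: "a \<in> arcs X1" and w: "w \<in> verts X2" "Fv (ev1 (head X1 a)) = ev2 w"
  obtains b where "b \<in> arcs X2" "Fv (ev1 (tail X1 a)) = ev2 (tail X2 b)"
proof -
  have e: "ea1 a \<in> AA1" by (rule X1.A.embed_closed[OF a])
  have F': "Fa (ea1 a) \<in> AA2" "levelwise (head X2) (Fa (ea1 a)) = ev2 w"
    "levelwise (tail X2) (Fa (ea1 a)) = Fv (ev1 (tail X1 a))"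
    using F e w(2) a
    by (simp_all add: limit_hom_def X1.T.levelwise_embed X1.H.levelwise_embed)
  obtain b where b: "b \<in> arcs X2" "head X2 b = w" "Fa (ea1 a) = ea2 b"
    using X2.H.levelwise_fiber[OF F'(1) w(1) X2.finite_incident(2)[OF w(1)] F'(2)] by blast
  show thesis using that[OF b(1)] F'(3) b by (simp add: X2.T.levelwise_embed)
qed

text \<open>Being sent into the embedded \<open>X2\<close> spreads across every edge in either
  direction, starting from \<open>v0\<close>.\<close>

lemma component_verts:
  assumes F: "limit_hom Fv Fa"
    and v0: "v0 \<in> verts X1" and w0: "w0 \<in> verts X2" and vw: "Fv (ev1 v0) = ev2 w0"
    and v: "v \<in> verts X1"
  shows "\<exists>w\<in>verts X2. Fv (ev1 v) = ev2 w"
proof (rule connected_multigraph_induct[OF X1.conn v0 _ v, where P = "\<lambda>v. \<exists>w\<in>verts X2. Fv (ev1 v) = ev2 w"])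
  show "\<exists>w\<in>verts X2. Fv (ev1 v0) = ev2 w" using w0 vw by blast
next
  fix a assume a: "a \<in> arcs X1"
  show "(\<exists>w\<in>verts X2. Fv (ev1 (tail X1 a)) = ev2 w) \<longleftrightarrow> (\<exists>w\<in>verts X2. Fv (ev1 (head X1 a)) = ev2 w)"
    using arc_into_component_tail[OF F a] arc_into_component_head[OF F a] X2.tail_closed X2.head_closed
    by metis
qed

lemma component_arcs:
  assumes F: "limit_hom Fv Fa"
    and v0: "v0 \<in> verts X1" and w0: "w0 \<in> verts X2" and vw: "Fv (ev1 v0) = ev2 w0"
    and a: "a \<in> arcs X1"
  shows "\<exists>b\<in>arcs X2. Fa (ea1 a) = ea2 b"
proof -
  obtain w where "w \<in> verts X2" "Fv (ev1 (tail X1 a)) = ev2 w"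
    using component_verts[OF F v0 w0 vw X1.tail_closed[OF a]] by blast
  then show ?thesis using arc_into_component_tail[OF F a] by blast
qed

text \<open>Prepares surjectivity of the restriction: every vertex and edge of \<open>X2\<close> is
  reached because the inverse map sends the embedded \<open>X2\<close> into
  \<open>X1\<close>.\<close>

lemma limit_hom_inverse:
  assumes F: "limit_hom Fv Fa" and Fv: "bij_betw Fv VV1 VV2" and Fa: "bij_betw Fa AA1 AA2"
  shows "graph_pair.limit_hom G2 X2 G1 X1 (inv_into VV1 Fv) (inv_into AA1 Fa)"
proof -
  interpret rev: graph_pair G2 X2 G1 X1 ..
  show ?thesis
    unfolding rev.limit_hom_def
  proof (intro ballI conjI)
    fix q assume q: "q \<in> AA2"
    define p where "p = inv_into AA1 Fa q"
    have p: "p \<in> AA1" "Fa p = q"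
      using Fa q unfolding p_def bij_betw_def by (auto simp: inv_into_into f_inv_into_f)
    have Fp: "levelwise (tail X2) q = Fv (levelwise (tail X1) p)"
      "levelwise (head X2) q = Fv (levelwise (head X1) p)"
      using F p by (auto simp: limit_hom_def)
    have inj: "inj_on Fv VV1" using Fv by (simp add: bij_betw_def)
    show "p \<in> AA1" by (rule p(1))
    show "levelwise (tail X1) p = inv_into VV1 Fv (levelwise (tail X2) q)"
      unfolding Fp by (rule inv_into_f_f[OF inj X1.T.levelwise_closed[OF p(1)], symmetric])
    show "levelwise (head X1) p = inv_into VV1 Fv (levelwise (head X2) q)"
      unfolding Fp by (rule inv_into_f_f[OF inj X1.H.levelwise_closed[OF p(1)], symmetric])
  qed
qed

text \<open>Injectivity is inherited from the completed maps and \<open>embed_inj\<close>.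
  Surjectivity is the component argument for the inverse maps, with \<open>w0\<close> and
  \<open>v0\<close> exchanged as base points.\<close>

lemma restrict_to_components:
  assumes F: "limit_hom Fv Fa" and Fv: "bij_betw Fv VV1 VV2" and Fa: "bij_betw Fa AA1 AA2"
    and v0: "v0 \<in> verts X1" and w0: "w0 \<in> verts X2" and vw: "Fv (ev1 v0) = ev2 w0"
  obtains fv fa where
    "\<And>v. v \<in> verts X1 \<Longrightarrow> Fv (ev1 v) = ev2 (fv v)" "\<And>a. a \<in> arcs X1 \<Longrightarrow> Fa (ea1 a) = ea2 (fa a)"
    "bij_betw fv (verts X1) (verts X2)" "bij_betw fa (arcs X1) (arcs X2)"
    "\<And>a. a \<in> arcs X1 \<Longrightarrow> tail X2 (fa a) = fv (tail X1 a)"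
    "\<And>a. a \<in> arcs X1 \<Longrightarrow> head X2 (fa a) = fv (head X1 a)"
proof -
  interpret rev: graph_pair G2 X2 G1 X1 ..
  note F' = limit_hom_inverse[OF F Fv Fa]
  have injv: "inj_on Fv VV1" and inja: "inj_on Fa AA1"
    using Fv Fa by (simp_all add: bij_betw_def)
  have v0c: "ev1 v0 \<in> VV1" by (rule X1.V.embed_closed[OF v0])
  have wv: "inv_into VV1 Fv (ev2 w0) = ev1 v0"
    unfolding vw[symmetric] by (rule inv_into_f_f[OF injv v0c])
  from component_verts[OF F v0 w0 vw]
  have "\<forall>v\<in>verts X1. \<exists>w. w \<in> verts X2 \<and> Fv (ev1 v) = ev2 w" by blast
  from bchoice[OF this] obtain fv where fv: "\<forall>v\<in>verts X1. fv v \<in> verts X2 \<and> Fv (ev1 v) = ev2 (fv v)" ..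
  from component_arcs[OF F v0 w0 vw]
  have "\<forall>a\<in>arcs X1. \<exists>b. b \<in> arcs X2 \<and> Fa (ea1 a) = ea2 b" by blast
  from bchoice[OF this] obtain fa where fa: "\<forall>a\<in>arcs X1. fa a \<in> arcs X2 \<and> Fa (ea1 a) = ea2 (fa a)" ..
  have bv: "bij_betw fv (verts X1) (verts X2)"
  proof (rule bij_betw_imageI)
    show "inj_on fv (verts X1)"
    proof (rule inj_onI)
      fix v v' assume v: "v \<in> verts X1" "v' \<in> verts X1" "fv v = fv v'"
      then have "Fv (ev1 v) = Fv (ev1 v')" using fv by simp
      then have "ev1 v = ev1 v'"
        using inj_onD[OF injv] X1.V.embed_closed v by blast
      then show "v = v'" by (rule X1.V.embed_inj[OF v(1,2)])
    qed
    show "fv ` verts X1 = verts X2"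
    proof (intro equalityI subsetI)
      show "w \<in> verts X2" if "w \<in> fv ` verts X1" for w using that fv by auto
    next
      fix w assume w: "w \<in> verts X2"
      obtain v where v: "v \<in> verts X1" "inv_into VV1 Fv (ev2 w) = ev1 v"
        using rev.component_verts[OF F' w0 v0 wv w] by blast
      have "ev2 w = Fv (ev1 v)"
        unfolding v(2)[symmetric]
        by (rule bij_betw_inv_into_right[OF Fv X2.V.embed_closed[OF w], symmetric])
      then have "ev2 w = ev2 (fv v)" using fv v(1) by simp
      then have "w = fv v" using X2.V.embed_inj[OF w] fv v(1) by blast
      then show "w \<in> fv ` verts X1" using v(1) by simp
    qed
  qed
  have ba: "bij_betw fa (arcs X1) (arcs X2)"
  proof (rule bij_betw_imageI)
    show "inj_on fa (arcs X1)"
    proof (rule inj_onI)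
      fix a a' assume a: "a \<in> arcs X1" "a' \<in> arcs X1" "fa a = fa a'"
      then have "Fa (ea1 a) = Fa (ea1 a')" using fa by simp
      then have "ea1 a = ea1 a'"
        using inj_onD[OF inja] X1.A.embed_closed a by blast
      then show "a = a'" by (rule X1.A.embed_inj[OF a(1,2)])
    qed
    show "fa ` arcs X1 = arcs X2"
    proof (intro equalityI subsetI)
      show "b \<in> arcs X2" if "b \<in> fa ` arcs X1" for b using that fa by auto
    next
      fix b assume b: "b \<in> arcs X2"
      obtain a where a: "a \<in> arcs X1" "inv_into AA1 Fa (ea2 b) = ea1 a"
        using rev.component_arcs[OF F' w0 v0 wv b] by blast
      have "ea2 b = Fa (ea1 a)"
        unfolding a(2)[symmetric]
        by (rule bij_betw_inv_into_right[OF Fa X2.A.embed_closed[OF b], symmetric])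
      then have "ea2 b = ea2 (fa a)" using fa a(1) by simp
      then have "b = fa a" using X2.A.embed_inj[OF b] fa a(1) by blast
      then show "b \<in> fa ` arcs X1" using a(1) by simp
    qed
  qed
  have ends: "tail X2 (fa a) = fv (tail X1 a) \<and> head X2 (fa a) = fv (head X1 a)"
    if a: "a \<in> arcs X1" for a
  proof -
    have fac: "fa a \<in> arcs X2" "ea2 (fa a) = Fa (ea1 a)" using fa a by auto
    have "ev2 (tail X2 (fa a)) = Fv (ev1 (tail X1 a))" "ev2 (head X2 (fa a)) = Fv (ev1 (head X1 a))"
      using F X1.A.embed_closed[OF a]
      by (simp_all add: limit_hom_def X2.T.levelwise_embed[OF fac(1), symmetric] fac(2)
          X2.H.levelwise_embed[OF fac(1), symmetric] X1.T.levelwise_embed[OF a] X1.H.levelwise_embed[OF a])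
    then have "ev2 (tail X2 (fa a)) = ev2 (fv (tail X1 a))" "ev2 (head X2 (fa a)) = ev2 (fv (head X1 a))"
      using fv X1.tail_closed[OF a] X1.head_closed[OF a] by simp_all
    then show ?thesis
      using X2.V.embed_inj fv X1.tail_closed[OF a] X1.head_closed[OF a]
        X2.tail_closed[OF fac(1)] X2.head_closed[OF fac(1)] by metis
  qed
  show thesis by (rule that[of fv fa]) (use fv fa bv ba ends in auto)
qed

text \<open>\<open>G1\<close> and \<open>G2\<close> are the stabilizers of the components \<open>X1\<close> and \<open>X2\<close>.\<close>

lemma restrict_to_stabilizers:
  assumes Fv: "bij_betw Fv VV1 VV2"
    and \<Psi>: "\<Psi> \<in> iso (profinite_completion G1) (profinite_completion G2)"
    and eqv: "\<And>x p. \<lbrakk>x \<in> carrier (profinite_completion G1); p \<in> VV1\<rbrakk>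
      \<Longrightarrow> Fv (completed_act G1 (vact X1) x p) = completed_act G2 (vact X2) (\<Psi> x) (Fv p)"
    and fv: "\<And>v. v \<in> verts X1 \<Longrightarrow> Fv (ev1 v) = ev2 (fv v)"
    and bfv: "bij_betw fv (verts X1) (verts X2)" and v0: "v0 \<in> verts X1"
  obtains h where "h \<in> iso G1 G2"
    "\<And>g. g \<in> carrier G1 \<Longrightarrow> \<Psi> (completion_embed G1 g) = completion_embed G2 (h g)"
proof -
  let ?PC1 = "profinite_completion G1" and ?PC2 = "profinite_completion G2"
  note G1 = X1.V.is_group and G2 = X2.V.is_group
  have \<Psi>h: "\<Psi> \<in> hom ?PC1 ?PC2" using \<Psi> by (simp add: iso_def)
  have \<Psi>c: "\<Psi> x \<in> carrier ?PC2" if "x \<in> carrier ?PC1" for x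
    using hom_in_carrier[OF \<Psi>h that] .
  have \<Psi>m: "\<Psi> (x \<otimes>\<^bsub>?PC1\<^esub> y) = \<Psi> x \<otimes>\<^bsub>?PC2\<^esub> \<Psi> y" if "x \<in> carrier ?PC1" "y \<in> carrier ?PC1" for x y
    using hom_mult[OF \<Psi>h that] .
  have \<Psi>i: "inj_on \<Psi> (carrier ?PC1)" and \<Psi>s: "\<Psi> ` carrier ?PC1 = carrier ?PC2"
    using \<Psi> by (auto simp: iso_def bij_betw_def)
  have fvc: "fv v \<in> verts X2" if "v \<in> verts X1" for v
    using bfv that by (rule bij_betw_apply)
  \<comment> \<open>The image of \<open>g\<close> carries \<open>fv v0\<close> to another vertex of
    \<open>X2\<close>, so \<open>transporter_in_G\<close> places it in \<open>G2\<close>.\<close>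
  have "\<exists>k. k \<in> carrier G2 \<and> \<Psi> (completion_embed G1 g) = completion_embed G2 k" if g: "g \<in> carrier G1" for g
  proof -
    note gc = X1.V.completion_embed_closed[OF g]
    have gv: "vact X1 g v0 \<in> verts X1" by (rule X1.V.act_closed[OF g v0])
    have "completed_act G2 (vact X2) (\<Psi> (completion_embed G1 g)) (ev2 (fv v0)) = ev2 (fv (vact X1 g v0))"
      unfolding fv[OF v0, symmetric] eqv[OF gc X1.V.embed_closed[OF v0], symmetric]
        X1.V.completed_act_embed[OF g v0] by (rule fv[OF gv])
    then show ?thesis
      using X2.V.transporter_in_G[OF \<Psi>c[OF gc] fvc[OF v0] fvc[OF gv]] by blast
  qed
  then have "\<forall>g\<in>carrier G1. \<exists>k. k \<in> carrier G2 \<and> \<Psi> (completion_embed G1 g) = completion_embed G2 k" by blast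
  from bchoice[OF this] obtain h where
    h_all: "\<forall>g\<in>carrier G1. h g \<in> carrier G2 \<and> \<Psi> (completion_embed G1 g) = completion_embed G2 (h g)" ..
  have h: "h g \<in> carrier G2" "\<Psi> (completion_embed G1 g) = completion_embed G2 (h g)"
    if "g \<in> carrier G1" for g
    using h_all that by auto
  have "h \<in> hom G1 G2"
  proof (rule homI)
    fix a b assume ab: "a \<in> carrier G1" "b \<in> carrier G1"
    note abc = group.subgroup_self[OF G1, THEN subgroup.m_closed, OF ab]
    have "completion_embed G2 (h (a \<otimes>\<^bsub>G1\<^esub> b)) = \<Psi> (completion_embed G1 a \<otimes>\<^bsub>?PC1\<^esub> completion_embed G1 b)"
      unfolding h(2)[OF abc, symmetric] X1.V.completion_embed_mult[OF ab] ..
    also have "\<dots> = completion_embed G2 (h a) \<otimes>\<^bsub>?PC2\<^esub> completion_embed G2 (h b)"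
      unfolding \<Psi>m[OF X1.V.completion_embed_closed[OF ab(1)] X1.V.completion_embed_closed[OF ab(2)]]
        h(2)[OF ab(1)] h(2)[OF ab(2)] ..
    also have "\<dots> = completion_embed G2 (h a \<otimes>\<^bsub>G2\<^esub> h b)"
      by (rule X2.V.completion_embed_mult[OF h(1)[OF ab(1)] h(1)[OF ab(2)], symmetric])
    finally show "h (a \<otimes>\<^bsub>G1\<^esub> b) = h a \<otimes>\<^bsub>G2\<^esub> h b"
      using X2.V.completion_embed_inj[OF h(1)[OF abc] X2.V.m_closed[OF h(1)[OF ab(1)] h(1)[OF ab(2)]]] by simp
  qed (rule h(1))
  moreover have "inj_on h (carrier G1)"
  proof (rule inj_onI)
    fix a b assume ab: "a \<in> carrier G1" "b \<in> carrier G1" "h a = h b"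
    then have "\<Psi> (completion_embed G1 a) = \<Psi> (completion_embed G1 b)" using h(2) by simp
    then have "completion_embed G1 a = completion_embed G1 b"
      using inj_onD[OF \<Psi>i] X1.V.completion_embed_closed ab by blast
    then show "a = b" by (rule X1.V.completion_embed_inj[OF ab(1,2)])
  qed
  moreover have "h ` carrier G1 = carrier G2"
  proof (intro equalityI subsetI)
    show "k \<in> carrier G2" if "k \<in> h ` carrier G1" for k using that h(1) by auto
  next
    fix k assume k: "k \<in> carrier G2"
    \<comment> \<open>For surjectivity the same argument runs backwards: the preimage
      \<open>x\<close> of \<open>k\<close> carries \<open>v0\<close> to a vertex of
      \<open>X1\<close>, hence comes from \<open>G1\<close>.\<close>
    obtain x where x: "x \<in> carrier ?PC1" "\<Psi> x = completion_embed G2 k"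
      using X2.V.completion_embed_closed[OF k] \<Psi>s by (metis imageE)
    have kw: "vact X2 k (fv v0) \<in> verts X2" by (rule X2.V.act_closed[OF k fvc[OF v0]])
    obtain v where v: "v \<in> verts X1" "fv v = vact X2 k (fv v0)"
      using bfv kw unfolding bij_betw_def by (metis imageE)
    have "Fv (completed_act G1 (vact X1) x (ev1 v0)) = Fv (ev1 v)"
      unfolding eqv[OF x(1) X1.V.embed_closed[OF v0]] x(2) fv[OF v0] fv[OF v(1)] v(2)
      by (rule X2.V.completed_act_embed[OF k fvc[OF v0]])
    moreover have "inj_on Fv VV1" using Fv by (simp add: bij_betw_def)
    ultimately have "completed_act G1 (vact X1) x (ev1 v0) = ev1 v"
      using inj_onD X1.V.completed_act_closed[OF x(1) X1.V.embed_closed[OF v0]] X1.V.embed_closed[OF v(1)]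
      by metis
    then obtain g where g: "g \<in> carrier G1" "x = completion_embed G1 g"
      using X1.V.transporter_in_G[OF x(1) v0 v(1)] by blast
    then have "completion_embed G2 (h g) = completion_embed G2 k" using h(2) x(2) by simp
    then have "h g = k" by (rule X2.V.completion_embed_inj[OF h(1)[OF g(1)] k])
    then show "k \<in> h ` carrier G1" using g(1) by blast
  qed
  ultimately have "h \<in> iso G1 G2" by (simp add: iso_def bij_betw_def)
  then show thesis using that h(2) by blast
qed

end

section \<open>Inner automorphisms, translations, and restriction to the embedded sets\<close>

lemma (in group) Inn_closed: "\<lbrakk>u \<in> carrier G; x \<in> carrier G\<rbrakk> \<Longrightarrow> Inn G u x \<in> carrier G"
  by (simp add: Inn_def)

lemma (in group) Inn_inv_Inn:
  assumes "u \<in> carrier G" "x \<in> carrier G"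
  shows "Inn G (inv u) (Inn G u x) = x" "Inn G u (Inn G (inv u) x) = x"
  using assms inv_mult_cancel[of "inv u" x] by (simp_all add: Inn_def m_assoc inv_mult_cancel)

lemma (in group) Inn_iso:
  assumes u: "u \<in> carrier G"
  shows "Inn G u \<in> iso G G"
proof -
  have "Inn G u \<in> hom G G"
    by (rule homI) (use u in \<open>simp_all add: Inn_def m_assoc inv_mult_cancel\<close>)
  moreover have "bij_betw (Inn G u) (carrier G) (carrier G)"
    by (rule bij_betw_byWitness[where f' = "Inn G (inv u)"])
      (use u in \<open>auto simp: Inn_inv_Inn Inn_closed\<close>)
  ultimately show ?thesis by (simp add: iso_def)
qed

lemma iso_compose:
  assumes "f \<in> iso G H" "g \<in> iso H J"
  shows "(\<lambda>x. g (f x)) \<in> iso G J"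
  using hom_compose[of f G H g J] bij_betw_trans[of f "carrier G" "carrier H" g "carrier J"] assms by (simp add: iso_def o_def)

context fg_action
begin

lemma completed_act_bij:
  assumes x: "x \<in> carrier PC"
  shows "bij_betw (completed_act G \<phi> x) (climit G \<phi> E) (climit G \<phi> E)"
proof -
  have xi: "inv\<^bsub>PC\<^esub> x \<in> carrier PC" by (rule group.inv_closed[OF group_profinite_completion x])
  show ?thesis
    by (rule bij_betw_byWitness[where f' = "completed_act G \<phi> (inv\<^bsub>PC\<^esub> x)"])
      (use x xi in \<open>auto simp: completed_act_inv completed_act_closed\<close>)
qed

end

text \<open>The situation after restriction, common to vertices and edges: \<open>F\<close> on the
  completed sets induces the bijection \<open>f\<close> between the embedded ones.\<close>

locale proper_action_pair = E1: proper_action G1 E1 \<phi>1 + E2: proper_action G2 E2 \<phi>2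
  for G1 :: "('g, 'y) monoid_scheme" and E1 :: "'v set" and \<phi>1
    and G2 :: "('h, 'z) monoid_scheme" and E2 :: "'w set" and \<phi>2 +
  fixes F :: "(nat \<Rightarrow> 'v set) \<Rightarrow> nat \<Rightarrow> 'w set" and f :: "'v \<Rightarrow> 'w"
  assumes F_embed: "v \<in> E1 \<Longrightarrow> F (embed G1 \<phi>1 v) = embed G2 \<phi>2 (f v)"
    and bij_f: "bij_betw f E1 E2"
begin

lemma f_closed: "v \<in> E1 \<Longrightarrow> f v \<in> E2"
  using bij_f by (rule bij_betw_apply)

lemma restriction_equivariant:
  assumes eqv: "\<And>x p. \<lbrakk>x \<in> carrier (profinite_completion G1); p \<in> climit G1 \<phi>1 E1\<rbrakk>
      \<Longrightarrow> F (completed_act G1 \<phi>1 x p) = completed_act G2 \<phi>2 (\<Psi> x) (F p)"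
    and h: "h g \<in> carrier G2" "\<Psi> (completion_embed G1 g) = completion_embed G2 (h g)"
    and g: "g \<in> carrier G1" and v: "v \<in> E1"
  shows "f (\<phi>1 g v) = \<phi>2 (h g) (f v)"
proof (rule E2.embed_inj)
  have gv: "\<phi>1 g v \<in> E1" by (rule E1.act_closed[OF g v])
  show "f (\<phi>1 g v) \<in> E2" by (rule f_closed[OF gv])
  show "\<phi>2 (h g) (f v) \<in> E2" by (rule E2.act_closed[OF h(1) f_closed[OF v]])
  have "embed G2 \<phi>2 (f (\<phi>1 g v)) = F (completed_act G1 \<phi>1 (completion_embed G1 g) (embed G1 \<phi>1 v))"
    unfolding E1.completed_act_embed[OF g v] by (rule F_embed[OF gv, symmetric])
  also have "\<dots> = completed_act G2 \<phi>2 (completion_embed G2 (h g)) (embed G2 \<phi>2 (f v))"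
    unfolding eqv[OF E1.completion_embed_closed[OF g] E1.embed_closed[OF v]] h(2) F_embed[OF v] ..
  also have "\<dots> = embed G2 \<phi>2 (\<phi>2 (h g) (f v))"
    by (rule E2.completed_act_embed[OF h(1) f_closed[OF v]])
  finally show "embed G2 \<phi>2 (f (\<phi>1 g v)) = embed G2 \<phi>2 (\<phi>2 (h g) (f v))" .
qed

text \<open>An invariant set consists of the points whose embedding lies in its completion
  (\<open>embed_mem_climit_iff\<close>). Injectivity of \<open>F\<close> identifies the preimage
  found in the completion of \<open>Z1\<close> with the embedded point itself.\<close>

lemma restriction_image:
  assumes Z1: "Z1 \<subseteq> E1" "\<And>g. g \<in> carrier G1 \<Longrightarrow> \<phi>1 g ` Z1 \<subseteq> Z1"
    and Z2: "Z2 \<subseteq> E2" "\<And>g. g \<in> carrier G2 \<Longrightarrow> \<phi>2 g ` Z2 \<subseteq> Z2"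
    and inj: "inj_on F (climit G1 \<phi>1 E1)"
    and img: "F ` climit G1 \<phi>1 Z1 = climit G2 \<phi>2 Z2"
  shows "f ` Z1 = Z2"
proof (intro equalityI subsetI)
  fix w assume "w \<in> f ` Z1"
  then obtain v where v: "v \<in> Z1" "w = f v" by blast
  then have vE: "v \<in> E1" using Z1(1) by blast
  have "embed G1 \<phi>1 v \<in> climit G1 \<phi>1 Z1" using E1.embed_mem_climit_iff[OF Z1 vE] v(1) by simp
  then have "embed G2 \<phi>2 (f v) \<in> climit G2 \<phi>2 Z2"
    unfolding F_embed[OF vE, symmetric] img[symmetric] by (rule imageI)
  then show "w \<in> Z2" using E2.embed_mem_climit_iff[OF Z2 f_closed[OF vE]] v(2) by simp
next
  fix w assume w: "w \<in> Z2"
  then have wE: "w \<in> E2" using Z2(1) by blast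
  then obtain v where v: "v \<in> E1" "w = f v" using bij_f unfolding bij_betw_def by blast
  have "embed G2 \<phi>2 w \<in> climit G2 \<phi>2 Z2" using E2.embed_mem_climit_iff[OF Z2 wE] w by simp
  then have "F (embed G1 \<phi>1 v) \<in> F ` climit G1 \<phi>1 Z1" unfolding img F_embed[OF v(1)] v(2) .
  then obtain p where p: "p \<in> climit G1 \<phi>1 Z1" "F (embed G1 \<phi>1 v) = F p" by blast
  have "embed G1 \<phi>1 v = p"
    using inj_onD[OF inj p(2) E1.embed_closed[OF v(1)]] E1.climit_subset[OF Z1(1)] p(1) by blast
  then have "v \<in> Z1" using p(1) E1.embed_mem_climit_iff[OF Z1 v(1)] by simp
  then show "w \<in> f ` Z1" using v(2) by simp
qed

end

section \<open>From an isomorphism of completed graphs to one of the graphs\<close>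

locale graph_pair_iso = graph_pair G1 X1 G2 X2 + completion_iso G1 G2 \<Phi>
  for G1 :: "('g, 'y) monoid_scheme" and X1 :: "('g, 'v, 'a) group_graph"
    and G2 :: "('h, 'z) monoid_scheme" and X2 :: "('h, 'w, 'b) group_graph" and \<Phi>
begin

lemma completed_iso_discretizes:
  assumes ci: "completed_iso G1 G2 \<Phi> X1 X2 \<Lambda> Z1 Z2 \<sigma> Fv Fa"
    and \<sigma>: "\<And>l. l \<in> \<Lambda> \<Longrightarrow> \<sigma> l \<in> \<Lambda>"
    and Z1: "\<forall>l\<in>\<Lambda>. invariant_subgraph G1 X1 (Z1 l)"
    and Z2: "\<forall>l\<in>\<Lambda>. invariant_subgraph G2 X2 (Z2 l)"
  shows "discretizes G1 G2 \<Phi> X1 X2 \<Lambda> Z1 Z2 \<sigma> Fv Fa"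
proof -
  let ?actv = "completed_act G2 (vact X2)" and ?acta = "completed_act G2 (aact X2)"
  note cif = ci[unfolded completed_iso_def Let_def graph_iso_def completed_graph_simps sub_simps equivariant_def]
  have bv: "bij_betw Fv VV1 VV2" and ba: "bij_betw Fa AA1 AA2"
    and ends: "\<forall>a\<in>AA1. levelwise (tail X2) (Fa a) = Fv (levelwise (tail X1) a) \<and>
        levelwise (head X2) (Fa a) = Fv (levelwise (head X1) a)"
    and rev: "case (map_option levelwise (reversal X1), map_option levelwise (reversal X2)) of
        (None, None) \<Rightarrow> True | (Some r, Some r') \<Rightarrow> (\<forall>a\<in>AA1. r' (Fa a) = Fa (r a)) | _ \<Rightarrow> False"
    and eqv: "\<forall>x\<in>carrier PC1. \<forall>p\<in>VV1. Fv (completed_act G1 (vact X1) x p) = ?actv (\<Phi> x) (Fv p)"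
    and eqa: "\<forall>x\<in>carrier PC1. \<forall>p\<in>AA1. Fa (completed_act G1 (aact X1) x p) = ?acta (\<Phi> x) (Fa p)"
    and FZ: "\<forall>l\<in>\<Lambda>. Fv ` climit G1 (vact X1) (fst (Z1 l)) = climit G2 (vact X2) (fst (Z2 (\<sigma> l))) \<and>
        Fa ` climit G1 (aact X1) (snd (Z1 l)) = climit G2 (aact X2) (snd (Z2 (\<sigma> l)))"
    using cif by blast+
  obtain v0 where v0: "v0 \<in> verts X1" using connected_multigraph_nonempty[OF X1.conn] by blast
  have "Fv (ev1 v0) \<in> VV2" using bij_betw_apply[OF bv X1.V.embed_closed[OF v0]] .
  then obtain u w0 where u: "u \<in> carrier PC2" and w0: "w0 \<in> verts X2" and Fv0: "Fv (ev1 v0) = ?actv u (ev2 w0)"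
    using X2.V.climit_transitive by blast
  define ui where "ui = inv\<^bsub>PC2\<^esub> u"
  have ui: "ui \<in> carrier PC2" unfolding ui_def by (rule group.inv_closed[OF grp2 u])
  have inv_ui: "inv\<^bsub>PC2\<^esub> ui = u" unfolding ui_def by (rule group.inv_inv[OF grp2 u])
  define Fv' where "Fv' p = ?actv ui (Fv p)" for p
  define Fa' where "Fa' p = ?acta ui (Fa p)" for p
  have bv': "bij_betw Fv' VV1 VV2"
    using bij_betw_trans[OF bv X2.V.completed_act_bij[OF ui]] by (simp add: Fv'_def[abs_def] o_def)
  have ba': "bij_betw Fa' AA1 AA2"
    using bij_betw_trans[OF ba X2.A.completed_act_bij[OF ui]] by (simp add: Fa'_def[abs_def] o_def)
  have Fvc: "Fv p \<in> VV2" if "p \<in> VV1" for p using bij_betw_apply[OF bv that] .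
  have Fac: "Fa p \<in> AA2" if "p \<in> AA1" for p using bij_betw_apply[OF ba that] .
  have hom': "limit_hom Fv' Fa'"
    unfolding limit_hom_def
  proof (intro ballI conjI)
    fix p assume p: "p \<in> AA1"
    show "Fa' p \<in> AA2" using bij_betw_apply[OF ba' p] .
    show "levelwise (tail X2) (Fa' p) = Fv' (levelwise (tail X1) p)"
      unfolding Fa'_def Fv'_def X2.T.levelwise_act[OF ui Fac[OF p]] using ends p by simp
    show "levelwise (head X2) (Fa' p) = Fv' (levelwise (head X1) p)"
      unfolding Fa'_def Fv'_def X2.H.levelwise_act[OF ui Fac[OF p]] using ends p by simp
  qed
  have vw: "Fv' (ev1 v0) = ev2 w0"
    unfolding Fv'_def Fv0 ui_def by (rule X2.V.completed_act_inv(1)[OF u X2.V.embed_closed[OF w0]])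
  \<comment> \<open>Translating \<open>F\<close> by the inverse of \<open>u\<close> conjugates the
    homomorphism along which it is equivariant, so the stabilizer argument is applied to \<Psi> in
    place of \<Phi>; \<open>\<Psi>_mult\<close> is the commutation rule behind this.\<close>
  define \<Psi> where "\<Psi> x = Inn PC2 ui (\<Phi> x)" for x
  have \<Psi>: "\<Psi> \<in> iso PC1 PC2"
    unfolding \<Psi>_def[abs_def] by (rule iso_compose[OF iso group.Inn_iso[OF grp2 ui]])
  have \<Psi>_mult: "\<Psi> x \<otimes>\<^bsub>PC2\<^esub> ui = ui \<otimes>\<^bsub>PC2\<^esub> \<Phi> x" if "x \<in> carrier PC1" for x
    using Phi_closed[OF that] u ui grp2 unfolding \<Psi>_def Inn_def inv_ui
    by (simp add: group.is_monoid monoid.m_assoc ui_def group.r_inv monoid.m_closed)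
  have \<Psi>c: "\<Psi> x \<in> carrier PC2" if "x \<in> carrier PC1" for x
    unfolding \<Psi>_def by (rule group.Inn_closed[OF grp2 ui Phi_closed[OF that]])
  have eqv': "Fv' (completed_act G1 (vact X1) x p) = ?actv (\<Psi> x) (Fv' p)"
    if x: "x \<in> carrier PC1" and p: "p \<in> VV1" for x p
  proof -
    have "Fv' (completed_act G1 (vact X1) x p) = ?actv ui (?actv (\<Phi> x) (Fv p))"
      unfolding Fv'_def using eqv x p by simp
    also have "\<dots> = ?actv (\<Psi> x \<otimes>\<^bsub>PC2\<^esub> ui) (Fv p)"
      unfolding \<Psi>_mult[OF x] by (rule X2.V.completed_act_mult[OF ui Phi_closed[OF x] Fvc[OF p], symmetric])
    also have "\<dots> = ?actv (\<Psi> x) (Fv' p)"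
      unfolding Fv'_def by (rule X2.V.completed_act_mult[OF \<Psi>c[OF x] ui Fvc[OF p]])
    finally show ?thesis .
  qed
  have eqa': "Fa' (completed_act G1 (aact X1) x p) = ?acta (\<Psi> x) (Fa' p)"
    if x: "x \<in> carrier PC1" and p: "p \<in> AA1" for x p
  proof -
    have "Fa' (completed_act G1 (aact X1) x p) = ?acta ui (?acta (\<Phi> x) (Fa p))"
      unfolding Fa'_def using eqa x p by simp
    also have "\<dots> = ?acta (\<Psi> x \<otimes>\<^bsub>PC2\<^esub> ui) (Fa p)"
      unfolding \<Psi>_mult[OF x] by (rule X2.A.completed_act_mult[OF ui Phi_closed[OF x] Fac[OF p], symmetric])
    also have "\<dots> = ?acta (\<Psi> x) (Fa' p)"
      unfolding Fa'_def by (rule X2.A.completed_act_mult[OF \<Psi>c[OF x] ui Fac[OF p]])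
    finally show ?thesis .
  qed
  obtain fv fa where fv: "\<And>v. v \<in> verts X1 \<Longrightarrow> Fv' (ev1 v) = ev2 (fv v)"
    and fa: "\<And>a. a \<in> arcs X1 \<Longrightarrow> Fa' (ea1 a) = ea2 (fa a)"
    and bfv: "bij_betw fv (verts X1) (verts X2)" and bfa: "bij_betw fa (arcs X1) (arcs X2)"
    and tl: "\<And>a. a \<in> arcs X1 \<Longrightarrow> tail X2 (fa a) = fv (tail X1 a)"
    and hd: "\<And>a. a \<in> arcs X1 \<Longrightarrow> head X2 (fa a) = fv (head X1 a)"
    using restrict_to_components[OF hom' bv' ba' v0 w0 vw] by blast
  obtain h where h_iso: "h \<in> iso G1 G2"
    and h: "\<And>g. g \<in> carrier G1 \<Longrightarrow> \<Psi> (completion_embed G1 g) = completion_embed G2 (h g)"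
    using restrict_to_stabilizers[OF bv' \<Psi> eqv' fv bfv v0] by blast
  have h_hom: "h \<in> hom G1 G2" using h_iso by (simp add: iso_def)
  have hc: "h g \<in> carrier G2" if "g \<in> carrier G1" for g using hom_in_carrier[OF h_hom that] .
  have "\<Phi> x = Inn PC2 u (completed_hom G1 G2 h x)" if x: "x \<in> carrier PC1" for x
  proof (rule conjugate_of_completed_hom[OF u h_hom _ x])
    fix g assume g: "g \<in> carrier G1"
    have "\<Phi> (completion_embed G1 g) = Inn PC2 u (\<Psi> (completion_embed G1 g))"
      unfolding \<Psi>_def ui_def
      by (rule group.Inn_inv_Inn(2)[OF grp2 u Phi_closed[OF X1.V.completion_embed_closed[OF g]], symmetric])
    then show "\<Phi> (completion_embed G1 g) = Inn PC2 u (completion_embed G2 (h g))"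
      unfolding h[OF g] .
  qed
  moreover
  interpret rv: proper_action_pair G1 "verts X1" "vact X1" G2 "verts X2" "vact X2" Fv' fv
    by unfold_locales (use fv bfv in auto)
  interpret ra: proper_action_pair G1 "arcs X1" "aact X1" G2 "arcs X2" "aact X2" Fa' fa
    by unfold_locales (use fa bfa in auto)
  have "case (reversal X1, reversal X2) of (None, None) \<Rightarrow> True
      | (Some r, Some r') \<Rightarrow> (\<forall>a\<in>arcs X1. r' (fa a) = fa (r a)) | _ \<Rightarrow> False"
  proof (cases "reversal X1")
    case None
    then show ?thesis using rev by (cases "reversal X2") simp_all
  next
    case (Some r)
    then obtain r' where r': "reversal X2 = Some r'" using rev by (cases "reversal X2") simp_all
    interpret R1: action_map G1 "arcs X1" "aact X1" "arcs X1" "aact X1" r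
      by (rule X1.action_map_reversal[OF Some])
    interpret R2: action_map G2 "arcs X2" "aact X2" "arcs X2" "aact X2" r'
      by (rule X2.action_map_reversal[OF r'])
    have rev': "levelwise r' (Fa p) = Fa (levelwise r p)" if "p \<in> AA1" for p
      using rev that by (simp add: Some r')
    have "r' (fa a) = fa (r a)" if a: "a \<in> arcs X1" for a
    proof (rule X2.A.embed_inj)
      have fac: "fa a \<in> arcs X2" using bij_betw_apply[OF bfa a] .
      show "r' (fa a) \<in> arcs X2" using R2.t_closed[OF fac] .
      show "fa (r a) \<in> arcs X2" using bij_betw_apply[OF bfa R1.t_closed[OF a]] .
      note ac = X1.A.embed_closed[OF a]
      have "ea2 (r' (fa a)) = levelwise r' (Fa' (ea1 a))"
        unfolding fa[OF a] by (rule R2.levelwise_embed[OF fac, symmetric])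
      also have "\<dots> = Fa' (levelwise r (ea1 a))"
        unfolding Fa'_def R2.levelwise_act[OF ui Fac[OF ac]] rev'[OF ac] ..
      also have "\<dots> = ea2 (fa (r a))"
        unfolding R1.levelwise_embed[OF a] by (rule fa[OF R1.t_closed[OF a]])
      finally show "ea2 (r' (fa a)) = ea2 (fa (r a))" .
    qed
    then show ?thesis by (simp add: Some r')
  qed
  then have "graph_iso X1 X2 fv fa"
    unfolding graph_iso_def using bfv bfa tl hd by blast
  moreover have "equivariant (carrier G1) h (vact X1) (vact X2) (verts X1) fv"
    unfolding equivariant_def
  proof (intro ballI)
    fix g x assume g: "g \<in> carrier G1" and x: "x \<in> verts X1"
    show "fv (vact X1 g x) = vact X2 (h g) (fv x)"
      by (rule rv.restriction_equivariant[where \<Psi> = \<Psi> and h = h, OF eqv' hc[OF g] h[OF g] g x])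
  qed
  moreover have "equivariant (carrier G1) h (aact X1) (aact X2) (arcs X1) fa"
    unfolding equivariant_def
  proof (intro ballI)
    fix g x assume g: "g \<in> carrier G1" and x: "x \<in> arcs X1"
    show "fa (aact X1 g x) = aact X2 (h g) (fa x)"
      by (rule ra.restriction_equivariant[where \<Psi> = \<Psi> and h = h, OF eqa' hc[OF g] h[OF g] g x])
  qed
  moreover have "fv ` fst (Z1 l) = fst (Z2 (\<sigma> l)) \<and> fa ` snd (Z1 l) = snd (Z2 (\<sigma> l))" if l: "l \<in> \<Lambda>" for l
  proof
    have Z1l: "fst (Z1 l) \<subseteq> verts X1" "\<And>g. g \<in> carrier G1 \<Longrightarrow> vact X1 g ` fst (Z1 l) \<subseteq> fst (Z1 l)"
      "snd (Z1 l) \<subseteq> arcs X1" "\<And>g. g \<in> carrier G1 \<Longrightarrow> aact X1 g ` snd (Z1 l) \<subseteq> snd (Z1 l)"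
      using Z1 l by (simp_all add: invariant_subgraph_def)
    have Z2l: "fst (Z2 (\<sigma> l)) \<subseteq> verts X2" "\<And>g. g \<in> carrier G2 \<Longrightarrow> vact X2 g ` fst (Z2 (\<sigma> l)) \<subseteq> fst (Z2 (\<sigma> l))"
      "snd (Z2 (\<sigma> l)) \<subseteq> arcs X2" "\<And>g. g \<in> carrier G2 \<Longrightarrow> aact X2 g ` snd (Z2 (\<sigma> l)) \<subseteq> snd (Z2 (\<sigma> l))"
      using Z2 \<sigma>[OF l] by (simp_all add: invariant_subgraph_def)
    \<comment> \<open>The completion of an invariant subgraph is stable under the profinite group,
      so the translation does not disturb the condition on labelled subgraphs.\<close>
    have act_img: "?actv ui ` climit G2 (vact X2) (fst (Z2 (\<sigma> l))) = climit G2 (vact X2) (fst (Z2 (\<sigma> l)))"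
    proof (intro equalityI subsetI)
      fix q assume "q \<in> ?actv ui ` climit G2 (vact X2) (fst (Z2 (\<sigma> l)))"
      then show "q \<in> climit G2 (vact X2) (fst (Z2 (\<sigma> l)))"
        using X2.V.completed_act_invariant[OF Z2l(1,2) ui] by blast
    next
      fix q assume q: "q \<in> climit G2 (vact X2) (fst (Z2 (\<sigma> l)))"
      then have "q = ?actv ui (?actv u q)"
        using X2.V.completed_act_inv(1)[OF u] X2.V.climit_subset[OF Z2l(1)] unfolding ui_def by force
      then show "q \<in> ?actv ui ` climit G2 (vact X2) (fst (Z2 (\<sigma> l)))"
        using X2.V.completed_act_invariant[OF Z2l(1,2) u q] by blast
    qed
    have act_img_a: "?acta ui ` climit G2 (aact X2) (snd (Z2 (\<sigma> l))) = climit G2 (aact X2) (snd (Z2 (\<sigma> l)))"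
    proof (intro equalityI subsetI)
      fix q assume "q \<in> ?acta ui ` climit G2 (aact X2) (snd (Z2 (\<sigma> l)))"
      then show "q \<in> climit G2 (aact X2) (snd (Z2 (\<sigma> l)))"
        using X2.A.completed_act_invariant[OF Z2l(3,4) ui] by blast
    next
      fix q assume q: "q \<in> climit G2 (aact X2) (snd (Z2 (\<sigma> l)))"
      then have "q = ?acta ui (?acta u q)"
        using X2.A.completed_act_inv(1)[OF u] X2.A.climit_subset[OF Z2l(3)] unfolding ui_def by force
      then show "q \<in> ?acta ui ` climit G2 (aact X2) (snd (Z2 (\<sigma> l)))"
        using X2.A.completed_act_invariant[OF Z2l(3,4) u q] by blast
    qed
    have "Fv' ` climit G1 (vact X1) (fst (Z1 l)) = climit G2 (vact X2) (fst (Z2 (\<sigma> l)))"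
      using FZ l act_img by (simp add: Fv'_def[abs_def] image_image[symmetric])
    then show "fv ` fst (Z1 l) = fst (Z2 (\<sigma> l))"
      using rv.restriction_image[OF Z1l(1,2) Z2l(1,2) bij_betw_imp_inj_on[OF bv']] by blast
    have "Fa' ` climit G1 (aact X1) (snd (Z1 l)) = climit G2 (aact X2) (snd (Z2 (\<sigma> l)))"
      using FZ l act_img_a by (simp add: Fa'_def[abs_def] image_image[symmetric])
    then show "fa ` snd (Z1 l) = snd (Z2 (\<sigma> l))"
      using ra.restriction_image[OF Z1l(3,4) Z2l(3,4) bij_betw_imp_inj_on[OF ba']] by blast
  qed
  ultimately show ?thesis
    unfolding discretizes_def using u h_iso fv fa unfolding Fv'_def Fa'_def ui_def by blast
qed

end

section \<open>Maps between finite levels\<close>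

context fg_action
begin

lemma level_act_orb:
  assumes "x (K G m) = K G m #> g" "g \<in> carrier G" "v \<in> E"
  shows "set_act \<phi> (x (K G m)) (orb (K G m) v) = orb (K G m) (\<phi> g v)"
  unfolding assms(1) by (rule set_act_orb) (use assms in simp_all)

lemma level_act_closed:
  assumes x: "x \<in> carrier PC" and p: "p \<in> level G \<phi> E m"
  shows "set_act \<phi> (x (K G m)) p \<in> level G \<phi> E m"
proof -
  obtain v where v: "v \<in> E" "p = orb (K G m) v" using p unfolding level_iff by blast
  obtain g where g: "g \<in> carrier G" "x (K G m) = K G m #> g" using PC_coset[OF x K_fin_normal] by blast
  show ?thesis unfolding v(2) level_act_orb[of x m g v, OF g(2,1) v(1)] level_iff using act_closed[OF g(1) v(1)] by blast
qed

lemma level_act_proj: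
  assumes x: "x \<in> carrier PC" and p: "p \<in> level G \<phi> E m" and km: "k \<le> m"
  shows "set_act \<phi> (K G k) (set_act \<phi> (x (K G m)) p) = set_act \<phi> (x (K G k)) (set_act \<phi> (K G k) p)"
proof -
  obtain v where v: "v \<in> E" "p = orb (K G m) v" using p unfolding level_iff by blast
  obtain g where g: "g \<in> carrier G" "x (K G m) = K G m #> g" using PC_coset[OF x K_fin_normal] by blast
  have gk: "x (K G k) = K G k #> g"
    by (rule PC_coset_superset[OF x K_fin_normal K_fin_normal K_antimono[OF km] g])
  show ?thesis
    unfolding v(2) level_act_orb[of x m g v, OF g(2,1) v(1)] level_proj_orb[OF km act_closed[OF g(1) v(1)]]
      level_proj_orb[OF km v(1)] level_act_orb[of x k g v, OF gk g(1) v(1)] ..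
qed

text \<open>A fibre of the projection to level \<open>k\<close> is a single orbit of
  \<open>K G k\<close>. The element is returned in the completion, where
  \<open>level_equivariant\<close> and \<Phi> can be applied to it.\<close>

lemma level_same_proj:
  assumes p: "p \<in> level G \<phi> E m" "p' \<in> level G \<phi> E m" and km: "k \<le> m"
    and eq: "set_act \<phi> (K G k) p' = set_act \<phi> (K G k) p"
  obtains x where "x \<in> carrier PC" "x (K G k) = K G k" "p' = set_act \<phi> (x (K G m)) p"
proof -
  obtain v where v: "v \<in> E" "p = orb (K G m) v" using p(1) unfolding level_iff by blast
  obtain w where w: "w \<in> E" "p' = orb (K G m) w" using p(2) unfolding level_iff by blast
  have "orb (K G k) w = orb (K G k) v"
    using eq unfolding v(2) w(2) level_proj_orb[OF km v(1)] level_proj_orb[OF km w(1)] .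
  then have "w \<in> orb (K G k) v" using orb_self[OF K_facts(2) w(1)] by blast
  then obtain n where n: "n \<in> K G k" "w = \<phi> n v" unfolding mem_orb by blast
  have nc: "n \<in> carrier G" using n(1) by (simp add: K_def)
  have "completion_embed G n (K G k) = K G k"
    unfolding completion_embed_apply[OF K_fin_normal] by (rule coset_join2[OF nc K_facts(2) n(1)])
  moreover have "p' = set_act \<phi> (completion_embed G n (K G m)) p"
    unfolding v(2) w(2) n(2)
    by (rule level_act_orb[of "completion_embed G n" m n v, OF completion_embed_apply[OF K_fin_normal] nc v(1), symmetric])
  ultimately show thesis using that completion_embed_closed[OF nc] by blast
qed

lemma level_proj_image:
  assumes "Z \<subseteq> E" "k \<le> m"
  shows "set_act \<phi> (K G k) ` level G \<phi> Z m = level G \<phi> Z k"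
proof -
  have "set_act \<phi> (K G k) (orb (K G m) v) = orb (K G k) v" if "v \<in> Z" for v
    using level_proj_orb[OF assms(2)] assms(1) that by blast
  then have "(\<lambda>v. set_act \<phi> (K G k) (orb (K G m) v)) ` Z = (\<lambda>v. orb (K G k) v) ` Z"
    by (rule image_cong[OF refl])
  moreover have "level G \<phi> Z n = (\<lambda>v. orb (K G n) v) ` Z" for n
    by (auto simp: level_def orbits_def)
  ultimately show ?thesis by (simp add: image_image)
qed

text \<open>Each of the finitely many \<open>G\<close>-orbits splits into at most as many pieces as
  \<open>K G m\<close> has cosets: the orbit of a translate of a representative \<open>w\<close> is
  a coset applied to the orbit of \<open>w\<close>.\<close>

lemma finite_level:
  assumes fin: "finite (orbits G E \<phi>)"
  shows "finite (level G \<phi> E m)"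
proof -
  define R where "R = (\<lambda>C. SOME w. w \<in> E \<and> C = orb (carrier G) w) ` orbits G E \<phi>"
  have orbit_carrier: "Group_Action.orbit G \<phi> v = orb (carrier G) v" for v
    by (simp add: orbit_def)
  have "level G \<phi> E m \<subseteq> (\<lambda>(C, w). set_act \<phi> C (orb (K G m) w)) ` ((rcosets (K G m)) \<times> R)"
  proof
    fix p assume "p \<in> level G \<phi> E m"
    then obtain v where v: "v \<in> E" "p = orb (K G m) v" unfolding level_iff by blast
    define w where "w = (SOME w. w \<in> E \<and> orb (carrier G) v = orb (carrier G) w)"
    have w: "w \<in> E \<and> orb (carrier G) v = orb (carrier G) w"
      unfolding w_def by (rule someI[of _ v]) (use v(1) in simp)
    have "orb (carrier G) v \<in> orbits G E \<phi>"
      unfolding orbits_def orbit_carrier using v(1) by blast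
    then have wR: "w \<in> R" unfolding R_def w_def by (rule imageI)
    have "v \<in> orb (carrier G) w" using w orb_self[OF subgroup_self v(1)] by blast
    then obtain g where g: "g \<in> carrier G" "v = \<phi> g w" unfolding mem_orb by blast
    have "p = set_act \<phi> (K G m #> g) (orb (K G m) w)"
      unfolding v(2) g(2) by (rule set_act_orb[OF K_facts(1,2) order_refl g(1), symmetric]) (use w in simp)
    then show "p \<in> (\<lambda>(C, w). set_act \<phi> C (orb (K G m) w)) ` ((rcosets (K G m)) \<times> R)"
      using r_coset_in_rcosets[OF g(1)] wR by (intro image_eqI[of _ _ "(K G m #> g, w)"]) simp_all
  qed
  moreover have "finite ((rcosets (K G m)) \<times> R)" using fin by (simp add: R_def)
  ultimately show ?thesis using finite_surj by blast
qed

lemma climit_eqI_unbounded: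
  assumes p: "p \<in> climit G \<phi> E" and q: "q \<in> climit G \<phi> E"
    and ms: "\<And>n. \<exists>j. n \<le> ms j" and eq: "\<And>j. p (ms j) = q (ms j)"
  shows "p = q"
proof
  fix m
  obtain j where "m \<le> ms j" using ms by blast
  then have "p m = set_act \<phi> (K G m) (p (ms j))" "q m = set_act \<phi> (K G m) (q (ms j))"
    using p q by (simp_all add: climit_iff)
  then show "p m = q m" using eq by simp
qed

end

locale action_pair = completion_iso G1 G2 \<Phi> + E1: fg_action G1 E1 \<phi>1 + E2: fg_action G2 E2 \<phi>2
  for G1 :: "('g, 'y) monoid_scheme" and G2 :: "('h, 'z) monoid_scheme" and \<Phi>
    and E1 :: "'v set" and \<phi>1 and E2 :: "'w set" and \<phi>2
begin

text \<open>Quantifies over the completion rather than over the finite quotient, so that one element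
  acts at all levels simultaneously; \<open>equivariant_level_iff\<close> shows that the condition
  is the same.\<close>

definition level_equivariant where
  "level_equivariant m f \<longleftrightarrow> (\<forall>x\<in>carrier PC1. \<forall>p\<in>level G1 \<phi>1 E1 m.
     f (set_act \<phi>1 (x (K G1 m)) p) = set_act \<phi>2 (\<Phi> x (K G2 m)) (f p))"

lemma equivariant_level_iff:
  "equivariant (carrier (G1 Mod K G1 m)) (induced_quotient_map G1 G2 \<Phi> m) (set_act \<phi>1) (set_act \<phi>2)
     (level G1 \<phi>1 E1 m) f \<longleftrightarrow> level_equivariant m f"
proof -
  have "carrier (G1 Mod K G1 m) = (\<lambda>x. x (K G1 m)) ` carrier PC1"
  proof (intro equalityI subsetI)
    fix C assume "C \<in> carrier (G1 Mod K G1 m)"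
    then obtain g where "g \<in> carrier G1" "C = K G1 m #>\<^bsub>G1\<^esub> g" by (auto simp: carrier_FactGroup)
    then show "C \<in> (\<lambda>x. x (K G1 m)) ` carrier PC1"
      using G1.completion_embed_closed completion_embed_apply[OF G1.K_fin_normal] by (metis image_eqI)
  next
    fix C assume "C \<in> (\<lambda>x. x (K G1 m)) ` carrier PC1"
    then obtain x where "x \<in> carrier PC1" "C = x (K G1 m)" by blast
    then show "C \<in> carrier (G1 Mod K G1 m)"
      using G1.PC_coset[OF _ G1.K_fin_normal] unfolding carrier_FactGroup by (metis image_eqI)
  qed
  then show ?thesis
    by (simp add: equivariant_def level_equivariant_def induced_quotient_map_apply)
qed

text \<open>The preimage at level \<open>m\<close> is chosen arbitrarily. The restriction makes the
  map extensional, so that all descents to level \<open>k\<close> lie in one function space, finite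
  when the levels are.\<close>

definition descent where
  "descent k m f = (\<lambda>q\<in>level G1 \<phi>1 E1 k.
     set_act \<phi>2 (K G2 k) (f (SOME p. p \<in> level G1 \<phi>1 E1 m \<and> set_act \<phi>1 (K G1 k) p = q)))"

text \<open>Two preimages differ by an element \<open>x\<close> that is trivial at level
  \<open>k\<close>. By \<open>Phi_level\<close> its image is trivial at level \<open>k\<close> too,
  so the two values have the same projection.\<close>

lemma descent_apply:
  assumes eqv: "level_equivariant m f" and f: "\<And>p. p \<in> level G1 \<phi>1 E1 m \<Longrightarrow> f p \<in> level G2 \<phi>2 E2 m"
    and km: "k \<le> m" and p: "p \<in> level G1 \<phi>1 E1 m"
  shows "descent k m f (set_act \<phi>1 (K G1 k) p) = set_act \<phi>2 (K G2 k) (f p)"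
proof -
  define p' where "p' = (SOME p'. p' \<in> level G1 \<phi>1 E1 m \<and> set_act \<phi>1 (K G1 k) p' = set_act \<phi>1 (K G1 k) p)"
  have p': "p' \<in> level G1 \<phi>1 E1 m \<and> set_act \<phi>1 (K G1 k) p' = set_act \<phi>1 (K G1 k) p"
    unfolding p'_def by (rule someI[of _ p]) (use p in simp)
  obtain x where x: "x \<in> carrier PC1" "x (K G1 k) = K G1 k" "p' = set_act \<phi>1 (x (K G1 m)) p"
    using E1.level_same_proj[OF p _ km] p' by blast
  have "x (K G1 k) = \<one>\<^bsub>PC1\<^esub> (K G1 k)" by (simp add: x(2) one_profinite_completion)
  then have "\<Phi> x (K G2 k) = \<Phi> \<one>\<^bsub>PC1\<^esub> (K G2 k)"
    by (rule Phi_level[OF x(1) monoid.one_closed[OF group.is_monoid[OF grp1]]])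
  then have \<Phi>x: "\<Phi> x (K G2 k) = K G2 k"
    unfolding group_hom.hom_one[OF group_hom_Phi] by (simp add: one_profinite_completion)
  have "f p' = set_act \<phi>2 (\<Phi> x (K G2 m)) (f p)"
    using eqv x(1) p unfolding level_equivariant_def x(3) by blast
  then have "set_act \<phi>2 (K G2 k) (f p') = set_act \<phi>2 (K G2 k) (set_act \<phi>2 (K G2 k) (f p))"
    using E2.level_act_proj[OF Phi_closed[OF x(1)] f[OF p] km] \<Phi>x by simp
  also have "\<dots> = set_act \<phi>2 (K G2 k) (f p)" by (rule E2.level_proj_proj[OF order_refl km f[OF p]])
  finally show ?thesis
    using E1.level_proj_closed[OF km p] unfolding descent_def p'_def by simp
qed

lemma descent_image:
  assumes eqv: "level_equivariant m f" and f: "\<And>p. p \<in> level G1 \<phi>1 E1 m \<Longrightarrow> f p \<in> level G2 \<phi>2 E2 m"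
    and km: "k \<le> m" and Z: "Z1 \<subseteq> E1" "Z2 \<subseteq> E2" and img: "f ` level G1 \<phi>1 Z1 m = level G2 \<phi>2 Z2 m"
  shows "descent k m f ` level G1 \<phi>1 Z1 k = level G2 \<phi>2 Z2 k"
proof -
  have "descent k m f ` level G1 \<phi>1 Z1 k = (\<lambda>p. descent k m f (set_act \<phi>1 (K G1 k) p)) ` level G1 \<phi>1 Z1 m"
    unfolding E1.level_proj_image[OF Z(1) km, symmetric] by (rule image_image)
  also have "\<dots> = (\<lambda>p. set_act \<phi>2 (K G2 k) (f p)) ` level G1 \<phi>1 Z1 m"
    using descent_apply[OF eqv f km] E1.level_subset[OF Z(1)] by (intro image_cong[OF refl]) blast
  also have "\<dots> = level G2 \<phi>2 Z2 k"
    unfolding E2.level_proj_image[OF Z(2) km, symmetric] img[symmetric] by (rule image_image[symmetric])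
  finally show ?thesis .
qed

lemma descent_equivariant:
  assumes eqv: "level_equivariant m f" and f: "\<And>p. p \<in> level G1 \<phi>1 E1 m \<Longrightarrow> f p \<in> level G2 \<phi>2 E2 m"
    and km: "k \<le> m"
  shows "level_equivariant k (descent k m f)"
  unfolding level_equivariant_def
proof (intro ballI)
  fix x q assume x: "x \<in> carrier PC1" and q: "q \<in> level G1 \<phi>1 E1 k"
  obtain p where p: "p \<in> level G1 \<phi>1 E1 m" "set_act \<phi>1 (K G1 k) p = q"
    using E1.level_proj_surj[OF km q] by blast
  have "descent k m f (set_act \<phi>1 (x (K G1 k)) q) = set_act \<phi>2 (K G2 k) (f (set_act \<phi>1 (x (K G1 m)) p))"
    unfolding p(2)[symmetric] E1.level_act_proj[OF x p(1) km, symmetric]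
    by (rule descent_apply[OF eqv f km E1.level_act_closed[OF x p(1)]])
  also have "f (set_act \<phi>1 (x (K G1 m)) p) = set_act \<phi>2 (\<Phi> x (K G2 m)) (f p)"
    using eqv x p(1) unfolding level_equivariant_def by blast
  also have "set_act \<phi>2 (K G2 k) \<dots> = set_act \<phi>2 (\<Phi> x (K G2 k)) (set_act \<phi>2 (K G2 k) (f p))"
    by (rule E2.level_act_proj[OF Phi_closed[OF x] f[OF p(1)] km])
  also have "set_act \<phi>2 (K G2 k) (f p) = descent k m f q"
    unfolding p(2)[symmetric] by (rule descent_apply[OF eqv f km p(1), symmetric])
  finally show "descent k m f (set_act \<phi>1 (x (K G1 k)) q) = set_act \<phi>2 (\<Phi> x (K G2 k)) (descent k m f q)" .
qed

text \<open>Injectivity comes from counting: a surjection between finite sets of the same size.\<close>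

lemma descent_bij:
  assumes eqv: "level_equivariant m f" and f: "bij_betw f (level G1 \<phi>1 E1 m) (level G2 \<phi>2 E2 m)"
    and km: "k \<le> m" and fin: "finite (level G1 \<phi>1 E1 k)"
    and f0: "bij_betw f0 (level G1 \<phi>1 E1 k) (level G2 \<phi>2 E2 k)"
  shows "bij_betw (descent k m f) (level G1 \<phi>1 E1 k) (level G2 \<phi>2 E2 k)"
proof -
  have fc: "f p \<in> level G2 \<phi>2 E2 m" if "p \<in> level G1 \<phi>1 E1 m" for p
    using bij_betw_apply[OF f that] .
  have "descent k m f ` level G1 \<phi>1 E1 k = level G2 \<phi>2 E2 k"
    by (rule descent_image[OF eqv fc km order_refl order_refl bij_betw_imp_surj_on[OF f]])
  \<comment> \<open>The equal cardinality comes from \<open>f0\<close>; beyond its bijectivity, no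
    relation between \<open>f0\<close> and the descended map is assumed.\<close>
  moreover from this have "inj_on (descent k m f) (level G1 \<phi>1 E1 k)"
    using bij_betw_same_card[OF f0] by (intro eq_card_imp_inj_on[OF fin]) simp
  ultimately show ?thesis by (simp add: bij_betw_def)
qed

end

text \<open>Serves tails, heads and reversals alike. Two instances of \<open>action_pair\<close> are
  involved, one for the source and one for the target of the structure maps.\<close>

lemma descent_commute:
  assumes A: "action_pair G1 G2 \<Phi> A1 \<alpha>1 A2 \<alpha>2" and V: "action_pair G1 G2 \<Phi> V1 \<phi>1 V2 \<phi>2"
    and t1: "action_map G1 A1 \<alpha>1 V1 \<phi>1 t1" and t2: "action_map G2 A2 \<alpha>2 V2 \<phi>2 t2"
    and fa: "action_pair.level_equivariant G1 G2 \<Phi> A1 \<alpha>1 \<alpha>2 m fa"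
      "\<And>p. p \<in> level G1 \<alpha>1 A1 m \<Longrightarrow> fa p \<in> level G2 \<alpha>2 A2 m"
    and fv: "action_pair.level_equivariant G1 G2 \<Phi> V1 \<phi>1 \<phi>2 m fv"
      "\<And>p. p \<in> level G1 \<phi>1 V1 m \<Longrightarrow> fv p \<in> level G2 \<phi>2 V2 m"
    and comm: "\<And>p. p \<in> level G1 \<alpha>1 A1 m \<Longrightarrow> t2 ` fa p = fv (t1 ` p)"
    and km: "k \<le> m" and q: "q \<in> level G1 \<alpha>1 A1 k"
  shows "t2 ` action_pair.descent G1 G2 A1 \<alpha>1 \<alpha>2 k m fa q
    = action_pair.descent G1 G2 V1 \<phi>1 \<phi>2 k m fv (t1 ` q)"
proof -
  interpret A: action_pair G1 G2 \<Phi> A1 \<alpha>1 A2 \<alpha>2 by (rule A)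
  interpret V: action_pair G1 G2 \<Phi> V1 \<phi>1 V2 \<phi>2 by (rule V)
  interpret t1: action_map G1 A1 \<alpha>1 V1 \<phi>1 t1 by (rule t1)
  interpret t2: action_map G2 A2 \<alpha>2 V2 \<phi>2 t2 by (rule t2)
  obtain p where p: "p \<in> level G1 \<alpha>1 A1 m" "set_act \<alpha>1 (K G1 k) p = q"
    using A.E1.level_proj_surj[OF km q] by blast
  have "A.descent k m fa q = set_act \<alpha>2 (K G2 k) (fa p)"
    using A.descent_apply[OF fa km p(1)] p(2) by simp
  then have "t2 ` A.descent k m fa q = set_act \<phi>2 (K G2 k) (fv (t1 ` p))"
    using t2.image_level_proj[OF fa(2)[OF p(1)]] comm[OF p(1)] by simp
  also have "\<dots> = V.descent k m fv (set_act \<phi>1 (K G1 k) (t1 ` p))"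
    by (rule V.descent_apply[OF fv km t1.image_level[OF p(1)], symmetric])
  also have "set_act \<phi>1 (K G1 k) (t1 ` p) = t1 ` q"
    unfolding p(2)[symmetric] by (rule t1.image_level_proj[OF p(1), symmetric])
  finally show ?thesis .
qed

section \<open>Limits of compatible maps\<close>

locale tower_map = E1: fg_action G1 E1 \<phi>1 + E2: fg_action G2 E2 \<phi>2
  for G1 :: "('g, 'y) monoid_scheme" and E1 :: "'v set" and \<phi>1
    and G2 :: "('h, 'z) monoid_scheme" and E2 :: "'w set" and \<phi>2 +
  fixes ms :: "nat \<Rightarrow> nat" and T :: "nat \<Rightarrow> 'v set \<Rightarrow> 'w set"
  assumes mono: "mono ms" and unbounded: "\<exists>j. n \<le> ms j"
    and T_closed: "p \<in> level G1 \<phi>1 E1 (ms j) \<Longrightarrow> T j p \<in> level G2 \<phi>2 E2 (ms j)"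
    and T_proj: "\<lbrakk>j \<le> k; p \<in> level G1 \<phi>1 E1 (ms k)\<rbrakk>
      \<Longrightarrow> T j (set_act \<phi>1 (K G1 (ms j)) p) = set_act \<phi>2 (K G2 (ms j)) (T k p)"
begin

text \<open>Levels between the chosen ones are filled by projecting down from the first chosen level
  above; \<open>lim_map_apply\<close> shows that every chosen level above gives the same
  value.\<close>

definition lim_map where
  "lim_map p = (\<lambda>m. set_act \<phi>2 (K G2 m) (T (LEAST j. m \<le> ms j) (p (ms (LEAST j. m \<le> ms j)))))"

lemma lim_map_apply:
  assumes p: "p \<in> climit G1 \<phi>1 E1" and mj: "m \<le> ms j"
  shows "lim_map p m = set_act \<phi>2 (K G2 m) (T j (p (ms j)))"
proof -
  define l where "l = (LEAST j. m \<le> ms j)"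
  have l: "l \<le> j" "m \<le> ms l" unfolding l_def using mj by (auto intro: Least_le LeastI)
  have pj: "p (ms j) \<in> level G1 \<phi>1 E1 (ms j)" using p by (simp add: climit_iff)
  have "p (ms l) = set_act \<phi>1 (K G1 (ms l)) (p (ms j))"
    using p monoD[OF mono l(1)] by (simp add: climit_iff)
  then have "T l (p (ms l)) = set_act \<phi>2 (K G2 (ms l)) (T j (p (ms j)))"
    using T_proj[OF l(1) pj] by simp
  then show ?thesis
    using E2.level_proj_proj[OF l(2) monoD[OF mono l(1)] T_closed[OF pj]]
    unfolding lim_map_def l_def by simp
qed

lemma lim_map_at:
  assumes p: "p \<in> climit G1 \<phi>1 E1"
  shows "lim_map p (ms j) = T j (p (ms j))"
proof -
  have "p (ms j) \<in> level G1 \<phi>1 E1 (ms j)" using p by (simp add: climit_iff)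
  then show ?thesis
    unfolding lim_map_apply[OF p order_refl] by (rule E2.level_proj_self[OF T_closed])
qed

lemma lim_map_closed:
  assumes p: "p \<in> climit G1 \<phi>1 E1"
  shows "lim_map p \<in> climit G2 \<phi>2 E2"
  unfolding climit_iff
proof (intro conjI allI impI)
  have pj: "p (ms j) \<in> level G1 \<phi>1 E1 (ms j)" for j using p by (simp add: climit_iff)
  fix m
  obtain j where j: "m \<le> ms j" using unbounded by blast
  show "lim_map p m \<in> level G2 \<phi>2 E2 m"
    unfolding lim_map_apply[OF p j] by (rule E2.level_proj_closed[OF j T_closed[OF pj]])
  fix k assume k: "k \<le> m"
  show "set_act \<phi>2 (K G2 k) (lim_map p m) = lim_map p k"
    unfolding lim_map_apply[OF p j] lim_map_apply[OF p order_trans[OF k j]]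
    by (rule E2.level_proj_proj[OF k j T_closed[OF pj]])
qed

text \<open>Each coordinate of the image depends on a single coordinate of the argument, which takes
  values in a discrete set.\<close>

lemma lim_map_continuous:
  "continuous_map (climit_topology G1 \<phi>1 E1) (climit_topology G2 \<phi>2 E2) lim_map"
  unfolding climit_topology_def[of G2]
proof (rule continuous_map_into_limit)
  fix p assume "p \<in> topspace (climit_topology G1 \<phi>1 E1)"
  then show "lim_map p \<in> inverse_limit UNIV (\<le>) (level G2 \<phi>2 E2) (\<lambda>m. set_act \<phi>2 (K G2 m))"
    using lim_map_closed by (simp add: climit_def)
next
  fix m :: nat
  obtain j where j: "m \<le> ms j" using unbounded by blast
  have "continuous_map (climit_topology G1 \<phi>1 E1) (discrete_topology (level G1 \<phi>1 E1 (ms j))) (\<lambda>p. p (ms j))"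
    unfolding climit_topology_def by (rule continuous_map_limit_component) simp
  moreover have "continuous_map (discrete_topology (level G1 \<phi>1 E1 (ms j)))
      (discrete_topology (level G2 \<phi>2 E2 m)) (\<lambda>q. set_act \<phi>2 (K G2 m) (T j q))"
    using E2.level_proj_closed[OF j T_closed] by (auto simp: continuous_map_def)
  ultimately have "continuous_map (climit_topology G1 \<phi>1 E1) (discrete_topology (level G2 \<phi>2 E2 m))
      ((\<lambda>q. set_act \<phi>2 (K G2 m) (T j q)) \<circ> (\<lambda>p. p (ms j)))"
    by (rule continuous_map_compose)
  then show "continuous_map (climit_topology G1 \<phi>1 E1) (discrete_topology (level G2 \<phi>2 E2 m)) (\<lambda>p. lim_map p m)"
    by (rule continuous_map_eq) (simp add: lim_map_apply[OF _ j])
qed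

lemma lim_map_image_subset:
  assumes Z: "Z1 \<subseteq> E1" "Z2 \<subseteq> E2"
    and img: "\<And>j. T j ` level G1 \<phi>1 Z1 (ms j) \<subseteq> level G2 \<phi>2 Z2 (ms j)"
  shows "lim_map ` climit G1 \<phi>1 Z1 \<subseteq> climit G2 \<phi>2 Z2"
proof (rule image_subsetI)
  fix p assume p: "p \<in> climit G1 \<phi>1 Z1"
  then have pE: "p \<in> climit G1 \<phi>1 E1" using E1.climit_subset[OF Z(1)] by blast
  have "lim_map p m \<in> level G2 \<phi>2 Z2 m" for m
  proof -
    obtain j where j: "m \<le> ms j" using unbounded by blast
    have "T j (p (ms j)) \<in> level G2 \<phi>2 Z2 (ms j)" using img p by (auto simp: climit_iff)
    then show ?thesis
      unfolding lim_map_apply[OF pE j] E2.level_proj_image[OF Z(2) j, symmetric] by (rule imageI)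
  qed
  then show "lim_map p \<in> climit G2 \<phi>2 Z2"
    using lim_map_closed[OF pE] by (simp add: climit_iff)
qed

end

locale tower_iso = tower_map +
  assumes T_bij: "bij_betw (T j) (level G1 \<phi>1 E1 (ms j)) (level G2 \<phi>2 E2 (ms j))"
begin

definition "T_inv j = inv_into (level G1 \<phi>1 E1 (ms j)) (T j)"

lemma T_inv_T: "p \<in> level G1 \<phi>1 E1 (ms j) \<Longrightarrow> T_inv j (T j p) = p"
  unfolding T_inv_def using T_bij by (rule bij_betw_inv_into_left)

lemma T_T_inv: "q \<in> level G2 \<phi>2 E2 (ms j) \<Longrightarrow> T j (T_inv j q) = q"
  unfolding T_inv_def using T_bij by (rule bij_betw_inv_into_right)

lemma T_inv_closed: "q \<in> level G2 \<phi>2 E2 (ms j) \<Longrightarrow> T_inv j q \<in> level G1 \<phi>1 E1 (ms j)"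
  unfolding T_inv_def using bij_betw_apply[OF bij_betw_inv_into[OF T_bij]] .

text \<open>The inverse bijections are again compatible, so the inverse of the limit map is a limit
  map itself and its continuity needs no separate argument.\<close>

sublocale inv: tower_map G2 E2 \<phi>2 G1 E1 \<phi>1 ms T_inv
proof unfold_locales
  show "mono ms" by (rule mono)
  show "\<exists>j. n \<le> ms j" for n by (rule unbounded)
  show "T_inv j q \<in> level G1 \<phi>1 E1 (ms j)" if "q \<in> level G2 \<phi>2 E2 (ms j)" for j q
    by (rule T_inv_closed[OF that])
  fix j k :: nat and q assume jk: "j \<le> k" and q: "q \<in> level G2 \<phi>2 E2 (ms k)"
  have "T j (set_act \<phi>1 (K G1 (ms j)) (T_inv k q)) = set_act \<phi>2 (K G2 (ms j)) q"
    unfolding T_proj[OF jk T_inv_closed[OF q]] T_T_inv[OF q] ..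
  then have "T_inv j (set_act \<phi>2 (K G2 (ms j)) q) = T_inv j (T j (set_act \<phi>1 (K G1 (ms j)) (T_inv k q)))"
    by simp
  also have "\<dots> = set_act \<phi>1 (K G1 (ms j)) (T_inv k q)"
    by (rule T_inv_T[OF E1.level_proj_closed[OF monoD[OF mono jk] T_inv_closed[OF q]]])
  finally show "T_inv j (set_act \<phi>2 (K G2 (ms j)) q) = set_act \<phi>1 (K G1 (ms j)) (T_inv k q)" .
qed

lemma inv_lim_map:
  assumes p: "p \<in> climit G1 \<phi>1 E1"
  shows "inv.lim_map (lim_map p) = p"
proof (rule E1.climit_eqI_unbounded[OF inv.lim_map_closed[OF lim_map_closed[OF p]] p unbounded])
  fix j
  have "p (ms j) \<in> level G1 \<phi>1 E1 (ms j)" using p by (simp add: climit_iff)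
  then show "inv.lim_map (lim_map p) (ms j) = p (ms j)"
    unfolding inv.lim_map_at[OF lim_map_closed[OF p]] lim_map_at[OF p] by (rule T_inv_T)
qed

lemma lim_map_inv:
  assumes q: "q \<in> climit G2 \<phi>2 E2"
  shows "lim_map (inv.lim_map q) = q"
proof (rule E2.climit_eqI_unbounded[OF lim_map_closed[OF inv.lim_map_closed[OF q]] q unbounded])
  fix j
  have "q (ms j) \<in> level G2 \<phi>2 E2 (ms j)" using q by (simp add: climit_iff)
  then show "lim_map (inv.lim_map q) (ms j) = q (ms j)"
    unfolding lim_map_at[OF inv.lim_map_closed[OF q]] inv.lim_map_at[OF q] by (rule T_T_inv)
qed

lemma lim_map_homeomorphic:
  "homeomorphic_map (climit_topology G1 \<phi>1 E1) (climit_topology G2 \<phi>2 E2) lim_map"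
proof -
  have "homeomorphic_maps (climit_topology G1 \<phi>1 E1) (climit_topology G2 \<phi>2 E2) lim_map inv.lim_map"
    unfolding homeomorphic_maps_def
    using lim_map_continuous inv.lim_map_continuous inv_lim_map lim_map_inv by simp
  then show ?thesis using homeomorphic_maps_map by blast
qed

lemma lim_map_bij: "bij_betw lim_map (climit G1 \<phi>1 E1) (climit G2 \<phi>2 E2)"
  by (rule bij_betw_byWitness[where f' = inv.lim_map])
    (use inv_lim_map lim_map_inv lim_map_closed inv.lim_map_closed in auto)

lemma lim_map_image:
  assumes Z: "Z1 \<subseteq> E1" "Z2 \<subseteq> E2"
    and img: "\<And>j. T j ` level G1 \<phi>1 Z1 (ms j) = level G2 \<phi>2 Z2 (ms j)"
  shows "lim_map ` climit G1 \<phi>1 Z1 = climit G2 \<phi>2 Z2"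
proof
  show "lim_map ` climit G1 \<phi>1 Z1 \<subseteq> climit G2 \<phi>2 Z2"
    by (rule lim_map_image_subset[OF Z]) (simp add: img)
  have "T_inv j ` level G2 \<phi>2 Z2 (ms j) \<subseteq> level G1 \<phi>1 Z1 (ms j)" for j
  proof (rule image_subsetI)
    fix q assume "q \<in> level G2 \<phi>2 Z2 (ms j)"
    then obtain p where p: "p \<in> level G1 \<phi>1 Z1 (ms j)" "q = T j p" unfolding img[symmetric] by blast
    then have "T_inv j q = p" using T_inv_T E1.level_subset[OF Z(1)] by blast
    then show "T_inv j q \<in> level G1 \<phi>1 Z1 (ms j)" using p(1) by simp
  qed
  note sub = inv.lim_map_image_subset[OF Z(2,1) this]
  show "climit G2 \<phi>2 Z2 \<subseteq> lim_map ` climit G1 \<phi>1 Z1"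
  proof
    fix q assume q: "q \<in> climit G2 \<phi>2 Z2"
    then have "q = lim_map (inv.lim_map q)"
      using lim_map_inv E2.climit_subset[OF Z(2)] by (metis subsetD)
    then show "q \<in> lim_map ` climit G1 \<phi>1 Z1" using sub q by blast
  qed
qed

end

lemma lim_map_commute:
  assumes A: "tower_map G1 A1 \<alpha>1 G2 A2 \<alpha>2 ms Ta" and V: "tower_map G1 V1 \<phi>1 G2 V2 \<phi>2 ms Tv"
    and t1: "action_map G1 A1 \<alpha>1 V1 \<phi>1 t1" and t2: "action_map G2 A2 \<alpha>2 V2 \<phi>2 t2"
    and comm: "\<And>j p. p \<in> level G1 \<alpha>1 A1 (ms j) \<Longrightarrow> t2 ` Ta j p = Tv j (t1 ` p)"
    and p: "p \<in> climit G1 \<alpha>1 A1"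
  shows "levelwise t2 (tower_map.lim_map G2 \<alpha>2 ms Ta p) = tower_map.lim_map G2 \<phi>2 ms Tv (levelwise t1 p)"
proof -
  interpret A: tower_map G1 A1 \<alpha>1 G2 A2 \<alpha>2 ms Ta by (rule A)
  interpret V: tower_map G1 V1 \<phi>1 G2 V2 \<phi>2 ms Tv by (rule V)
  interpret t1: action_map G1 A1 \<alpha>1 V1 \<phi>1 t1 by (rule t1)
  interpret t2: action_map G2 A2 \<alpha>2 V2 \<phi>2 t2 by (rule t2)
  note tp = t1.levelwise_closed[OF p]
  show ?thesis
  proof (rule V.E2.climit_eqI_unbounded[OF t2.levelwise_closed[OF A.lim_map_closed[OF p]] V.lim_map_closed[OF tp]
        V.unbounded])
    fix j
    have pj: "p (ms j) \<in> level G1 \<alpha>1 A1 (ms j)" using p by (simp add: climit_iff)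
    have "levelwise t2 (A.lim_map p) (ms j) = t2 ` Ta j (p (ms j))"
      unfolding levelwise_def A.lim_map_at[OF p] ..
    also have "\<dots> = Tv j (levelwise t1 p (ms j))" unfolding comm[OF pj] levelwise_def ..
    also have "\<dots> = V.lim_map (levelwise t1 p) (ms j)" by (rule V.lim_map_at[OF tp, symmetric])
    finally show "levelwise t2 (A.lim_map p) (ms j) = V.lim_map (levelwise t1 p) (ms j)" .
  qed
qed

lemma lim_map_equivariant:
  assumes P: "action_pair G1 G2 \<Phi> E1 \<phi>1 E2 \<phi>2" and T: "tower_map G1 E1 \<phi>1 G2 E2 \<phi>2 ms T"
    and eqv: "\<And>j. action_pair.level_equivariant G1 G2 \<Phi> E1 \<phi>1 \<phi>2 (ms j) (T j)"
    and x: "x \<in> carrier (profinite_completion G1)" and p: "p \<in> climit G1 \<phi>1 E1"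
  shows "tower_map.lim_map G2 \<phi>2 ms T (completed_act G1 \<phi>1 x p)
    = completed_act G2 \<phi>2 (\<Phi> x) (tower_map.lim_map G2 \<phi>2 ms T p)"
proof -
  interpret P: action_pair G1 G2 \<Phi> E1 \<phi>1 E2 \<phi>2 by (rule P)
  interpret T: tower_map G1 E1 \<phi>1 G2 E2 \<phi>2 ms T by (rule T)
  note xp = P.E1.completed_act_closed[OF x p]
  show ?thesis
  proof (rule P.E2.climit_eqI_unbounded[OF T.lim_map_closed[OF xp]
        P.E2.completed_act_closed[OF P.Phi_closed[OF x] T.lim_map_closed[OF p]] T.unbounded])
    fix j
    have pj: "p (ms j) \<in> level G1 \<phi>1 E1 (ms j)" using p by (simp add: climit_iff)
    show "T.lim_map (completed_act G1 \<phi>1 x p) (ms j) = completed_act G2 \<phi>2 (\<Phi> x) (T.lim_map p) (ms j)"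
      unfolding T.lim_map_at[OF xp] unfolding completed_act_def T.lim_map_at[OF p]
      by (rule bspec[OF bspec[OF eqv[unfolded P.level_equivariant_def] x] pj])
  qed
qed

section \<open>Compatible isomorphisms of finite quotients\<close>

context graph_pair_iso
begin

sublocale PV: action_pair G1 G2 \<Phi> "verts X1" "vact X1" "verts X2" "vact X2" ..
sublocale PA: action_pair G1 G2 \<Phi> "arcs X1" "aact X1" "arcs X2" "aact X2" ..

abbreviation "LV1 \<equiv> level G1 (vact X1) (verts X1)"
abbreviation "LA1 \<equiv> level G1 (aact X1) (arcs X1)"
abbreviation "LV2 \<equiv> level G2 (vact X2) (verts X2)"
abbreviation "LA2 \<equiv> level G2 (aact X2) (arcs X2)"

lemma level_iso_iff:
  "level_iso G1 G2 \<Phi> X1 X2 \<Lambda> Z1 Z2 m \<sigma> fv fa \<longleftrightarrow>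
     bij_betw fv (LV1 m) (LV2 m) \<and> bij_betw fa (LA1 m) (LA2 m) \<and>
     (\<forall>a\<in>LA1 m. tail X2 ` fa a = fv (tail X1 ` a) \<and> head X2 ` fa a = fv (head X1 ` a)) \<and>
     (case (reversal X1, reversal X2) of (None, None) \<Rightarrow> True
      | (Some r, Some r') \<Rightarrow> (\<forall>a\<in>LA1 m. r' ` fa a = fa (r ` a)) | _ \<Rightarrow> False) \<and>
     PV.level_equivariant m fv \<and> PA.level_equivariant m fa \<and>
     (\<forall>l\<in>\<Lambda>. fv ` level G1 (vact X1) (fst (Z1 l)) m = level G2 (vact X2) (fst (Z2 (\<sigma> l))) m \<and>
            fa ` level G1 (aact X1) (snd (Z1 l)) m = level G2 (aact X2) (snd (Z2 (\<sigma> l))) m)"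
proof -
  have rev: "(case (map_option (`) (reversal X1), map_option (`) (reversal X2)) of (None, None) \<Rightarrow> True
      | (Some r, Some r') \<Rightarrow> (\<forall>a\<in>LA1 m. r' (fa a) = fa (r a)) | _ \<Rightarrow> False) \<longleftrightarrow>
    (case (reversal X1, reversal X2) of (None, None) \<Rightarrow> True
      | (Some r, Some r') \<Rightarrow> (\<forall>a\<in>LA1 m. r' ` fa a = fa (r ` a)) | _ \<Rightarrow> False)"
    by (cases "reversal X1"; cases "reversal X2") simp_all
  show ?thesis
    unfolding level_iso_def Let_def graph_iso_def quotient_graph_simps sub_simps
      PV.equivariant_level_iff PA.equivariant_level_iff rev by simp
qed

text \<open>The permutation \<sigma> is inherited from level \<open>m\<close>. The isomorphism at
  level \<open>k\<close>, possibly with another permutation \<tau>, contributes the cardinalities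
  that make the descended maps injective.\<close>

lemma descent_level_iso:
  assumes iso_m: "level_iso G1 G2 \<Phi> X1 X2 \<Lambda> Z1 Z2 m \<sigma> fv fa"
    and iso_k: "level_iso G1 G2 \<Phi> X1 X2 \<Lambda> Z1 Z2 k \<tau> ev ea"
    and km: "k \<le> m" and cc: "cocompact G1 X1" and \<sigma>: "\<And>l. l \<in> \<Lambda> \<Longrightarrow> \<sigma> l \<in> \<Lambda>"
    and Z1: "\<forall>l\<in>\<Lambda>. invariant_subgraph G1 X1 (Z1 l)"
    and Z2: "\<forall>l\<in>\<Lambda>. invariant_subgraph G2 X2 (Z2 l)"
  shows "level_iso G1 G2 \<Phi> X1 X2 \<Lambda> Z1 Z2 k \<sigma> (PV.descent k m fv) (PA.descent k m fa)"
proof -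
  note I = iso_m[unfolded level_iso_iff]
  have bv: "bij_betw fv (LV1 m) (LV2 m)" and ba: "bij_betw fa (LA1 m) (LA2 m)"
    and ends: "\<forall>a\<in>LA1 m. tail X2 ` fa a = fv (tail X1 ` a) \<and> head X2 ` fa a = fv (head X1 ` a)"
    and rev: "case (reversal X1, reversal X2) of (None, None) \<Rightarrow> True
      | (Some r, Some r') \<Rightarrow> (\<forall>a\<in>LA1 m. r' ` fa a = fa (r ` a)) | _ \<Rightarrow> False"
    and eqv: "PV.level_equivariant m fv" and eqa: "PA.level_equivariant m fa"
    and img: "\<forall>l\<in>\<Lambda>. fv ` level G1 (vact X1) (fst (Z1 l)) m = level G2 (vact X2) (fst (Z2 (\<sigma> l))) m \<and>
            fa ` level G1 (aact X1) (snd (Z1 l)) m = level G2 (aact X2) (snd (Z2 (\<sigma> l))) m"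
    using I by - (elim conjE, assumption)+
  have bev: "bij_betw ev (LV1 k) (LV2 k)" and bea: "bij_betw ea (LA1 k) (LA2 k)"
    using iso_k[unfolded level_iso_iff] by - (elim conjE, assumption)+
  have fvc: "fv p \<in> LV2 m" if "p \<in> LV1 m" for p using bij_betw_apply[OF bv that] .
  have fac: "fa p \<in> LA2 m" if "p \<in> LA1 m" for p using bij_betw_apply[OF ba that] .
  have fin: "finite (LV1 k)" "finite (LA1 k)"
    using cc X1.V.finite_level X1.A.finite_level by (simp_all add: cocompact_def)
  note pv = PV.action_pair_axioms and pa = PA.action_pair_axioms
  show ?thesis
    unfolding level_iso_iff
  proof (intro conjI ballI)
    show "bij_betw (PV.descent k m fv) (LV1 k) (LV2 k)" by (rule PV.descent_bij[OF eqv bv km fin(1) bev])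
    show "bij_betw (PA.descent k m fa) (LA1 k) (LA2 k)" by (rule PA.descent_bij[OF eqa ba km fin(2) bea])
    show "PV.level_equivariant k (PV.descent k m fv)" by (rule PV.descent_equivariant[OF eqv fvc km])
    show "PA.level_equivariant k (PA.descent k m fa)" by (rule PA.descent_equivariant[OF eqa fac km])
  next
    fix a assume a: "a \<in> LA1 k"
    show "tail X2 ` PA.descent k m fa a = PV.descent k m fv (tail X1 ` a)"
      by (rule descent_commute[OF pa pv X1.T.action_map_axioms X2.T.action_map_axioms eqa fac eqv fvc _ km a])
        (use ends in simp_all)
    show "head X2 ` PA.descent k m fa a = PV.descent k m fv (head X1 ` a)"
      by (rule descent_commute[OF pa pv X1.H.action_map_axioms X2.H.action_map_axioms eqa fac eqv fvc _ km a])
        (use ends in simp_all)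
  next
    fix l assume l: "l \<in> \<Lambda>"
    have Z: "fst (Z1 l) \<subseteq> verts X1" "snd (Z1 l) \<subseteq> arcs X1" "fst (Z2 (\<sigma> l)) \<subseteq> verts X2" "snd (Z2 (\<sigma> l)) \<subseteq> arcs X2"
      using Z1 Z2 l \<sigma>[OF l] by (simp_all add: invariant_subgraph_def)
    show "PV.descent k m fv ` level G1 (vact X1) (fst (Z1 l)) k = level G2 (vact X2) (fst (Z2 (\<sigma> l))) k"
      by (rule PV.descent_image[OF eqv fvc km Z(1,3)]) (use img l in simp_all)
    show "PA.descent k m fa ` level G1 (aact X1) (snd (Z1 l)) k = level G2 (aact X2) (snd (Z2 (\<sigma> l))) k"
      by (rule PA.descent_image[OF eqa fac km Z(2,4)]) (use img l in simp_all)
  next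
    show "case (reversal X1, reversal X2) of (None, None) \<Rightarrow> True
      | (Some r, Some r') \<Rightarrow> (\<forall>a\<in>LA1 k. r' ` PA.descent k m fa a = PA.descent k m fa (r ` a)) | _ \<Rightarrow> False"
    proof (cases "reversal X1")
      case None
      then show ?thesis using rev by (cases "reversal X2") simp_all
    next
      case (Some r)
      then obtain r' where r': "reversal X2 = Some r'" using rev by (cases "reversal X2") simp_all
      have "r' ` PA.descent k m fa a = PA.descent k m fa (r ` a)" if a: "a \<in> LA1 k" for a
        by (rule descent_commute[OF pa pa X1.action_map_reversal[OF Some] X2.action_map_reversal[OF r']
              eqa fac eqa fac _ km a]) (use rev in \<open>simp_all add: Some r'\<close>)
      then show ?thesis by (simp add: Some r')
    qed
  qed
qed

text \<open>Row \<open>k\<close> of the array consists of all descents of the \<open>k\<close>-th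
  isomorphism. Including the permutation in each entry lets the same diagonal selection fix \<sigma>
  as well; the selected maps at level \<open>j\<close> are descents from all sufficiently late
  selected rows.\<close>

lemma compatible_level_isos:
  fixes ms :: "nat \<Rightarrow> nat"
  assumes mono: "mono ms"
    and isos: "\<And>j. \<exists>\<sigma>\<in>P. \<exists>fv fa. level_iso G1 G2 \<Phi> X1 X2 \<Lambda> Z1 Z2 (ms j) \<sigma> fv fa"
    and cc: "cocompact G1 X1" and P: "finite P" "P \<subseteq> \<Lambda> \<rightarrow> \<Lambda>"
    and Z1: "\<forall>l\<in>\<Lambda>. invariant_subgraph G1 X1 (Z1 l)"
    and Z2: "\<forall>l\<in>\<Lambda>. invariant_subgraph G2 X2 (Z2 l)"
  obtains \<sigma> Ev Ea where "\<sigma> \<in> P" "\<And>j. level_iso G1 G2 \<Phi> X1 X2 \<Lambda> Z1 Z2 (ms j) \<sigma> (Ev j) (Ea j)"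
    "\<And>j k. j \<le> k \<Longrightarrow> descends G1 G2 X1 X2 (ms k) (Ev k) (Ea k) (ms j) (Ev j) (Ea j)"
proof -
  have "\<forall>j. \<exists>s. fst s \<in> P \<and> level_iso G1 G2 \<Phi> X1 X2 \<Lambda> Z1 Z2 (ms j) (fst s) (fst (snd s)) (snd (snd s))"
    using isos by simp blast
  from choice[OF this] obtain s where
    s: "\<And>j. fst (s j) \<in> P" "\<And>j. level_iso G1 G2 \<Phi> X1 X2 \<Lambda> Z1 Z2 (ms j) (fst (s j)) (fst (snd (s j))) (snd (snd (s j)))"
    by blast
  define \<sigma> fv fa where "\<sigma> j = fst (s j)" and "fv j = fst (snd (s j))" and "fa j = snd (snd (s j))" for j
  have \<sigma>: "\<sigma> j \<in> P" and iso: "level_iso G1 G2 \<Phi> X1 X2 \<Lambda> Z1 Z2 (ms j) (\<sigma> j) (fv j) (fa j)" for j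
    using s by (simp_all add: \<sigma>_def fv_def fa_def)
  have \<sigma>\<Lambda>: "\<sigma> j l \<in> \<Lambda>" if "l \<in> \<Lambda>" for j l
    using subsetD[OF P(2) \<sigma>[of j]] that by blast
  define dv da where "dv k j = PV.descent (ms j) (ms k) (fv k)" and "da k j = PA.descent (ms j) (ms k) (fa k)" for k j
  have iso_d: "level_iso G1 G2 \<Phi> X1 X2 \<Lambda> Z1 Z2 (ms j) (\<sigma> k) (dv k j) (da k j)" if "j \<le> k" for j k
    unfolding dv_def da_def
    by (rule descent_level_iso[OF iso iso monoD[OF mono that] cc \<sigma>\<Lambda> Z1 Z2])
  \<comment> \<open>Finite because the descents are extensional, the levels are finite by
    cocompactness, and \<open>P\<close> is finite.\<close>
  define A where "A j = P \<times> (LV1 (ms j) \<rightarrow>\<^sub>E LV2 (ms j)) \<times> (LA1 (ms j) \<rightarrow>\<^sub>E LA2 (ms j))" for j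
  have finA: "finite (A j)" for j
  proof -
    have f1: "finite (LV1 (ms j))" "finite (LA1 (ms j))"
      using cc X1.V.finite_level X1.A.finite_level by (simp_all add: cocompact_def)
    have "bij_betw (fv j) (LV1 (ms j)) (LV2 (ms j))" "bij_betw (fa j) (LA1 (ms j)) (LA2 (ms j))"
      using iso[of j, unfolded level_iso_iff] by - (elim conjE, assumption)+
    with f1 have "finite (LV2 (ms j))" "finite (LA2 (ms j))"
      using bij_betw_finite by metis+
    with f1 show ?thesis unfolding A_def using P(1) by (intro finite_cartesian_product finite_PiE) simp_all
  qed
  have "(\<sigma> k, dv k j, da k j) \<in> A j" if "j \<le> k" for k j
  proof -
    have "bij_betw (dv k j) (LV1 (ms j)) (LV2 (ms j))" "bij_betw (da k j) (LA1 (ms j)) (LA2 (ms j))"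
      using iso_d[OF that, unfolded level_iso_iff] by - (elim conjE, assumption)+
    moreover have "dv k j \<in> extensional (LV1 (ms j))" "da k j \<in> extensional (LA1 (ms j))"
      by (simp_all add: dv_def da_def PV.descent_def PA.descent_def)
    ultimately show ?thesis
      unfolding A_def using \<sigma> by (auto simp: PiE_def dest: bij_betw_imp_funcset)
  qed
  from diagonal_selection[of A "\<lambda>k j. (\<sigma> k, dv k j, da k j)", OF finA this]
  obtain r e where r: "\<And>i. i \<le> r i" and e: "\<And>i j. j < i \<Longrightarrow> (\<sigma> (r i), dv (r i) j, da (r i) j) = e j"
    by blast
  define Ev Ea where "Ev j = fst (snd (e j))" and "Ea j = snd (snd (e j))" for j
  have E: "Ev j = dv (r i) j" "Ea j = da (r i) j" "\<sigma> (r i) = \<sigma> (r (Suc 0))" if "j < i" for i j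
  proof -
    show "Ev j = dv (r i) j" "Ea j = da (r i) j"
      unfolding Ev_def Ea_def e[OF that, symmetric] by simp_all
    \<comment> \<open>The permutation of a row is the same in all its columns, so column 0 already
      pins it down for all selected rows.\<close>
    have "\<sigma> (r i) = fst (e 0)" "\<sigma> (r (Suc 0)) = fst (e 0)"
      using e[of 0 i] e[of 0 "Suc 0"] that by (metis fst_conv gr_zeroI not_less_zero, metis fst_conv lessI)
    then show "\<sigma> (r i) = \<sigma> (r (Suc 0))" by simp
  qed
  show thesis
  proof (rule that)
    show "\<sigma> (r (Suc 0)) \<in> P" by (rule \<sigma>)
    show "level_iso G1 G2 \<Phi> X1 X2 \<Lambda> Z1 Z2 (ms j) (\<sigma> (r (Suc 0))) (Ev j) (Ea j)" for j
      using iso_d[of j "r (Suc j)"] r[of "Suc j"] E[of j "Suc j"] by simp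
    fix j k :: nat assume jk: "j \<le> k"
    \<comment> \<open>A common source: both \<open>Ev j\<close> and \<open>Ev k\<close> are descents
      of the one map at row \<open>l\<close>, so compatibility reduces to composing
      projections.\<close>
    define l where "l = r (Suc k)"
    have kl: "k \<le> l" unfolding l_def using r[of "Suc k"] by simp
    have Ej: "Ev j = dv l j" "Ea j = da l j" and Ek: "Ev k = dv l k" "Ea k = da l k"
      unfolding l_def using E(1,2)[of j "Suc k"] E(1,2)[of k "Suc k"] jk by simp_all
    note mjk = monoD[OF mono jk] and mkl = monoD[OF mono kl]
    note mjl = order_trans[OF mjk mkl]
    note Il = iso[of l, unfolded level_iso_iff]
    have bv: "bij_betw (fv l) (LV1 (ms l)) (LV2 (ms l))" and ba: "bij_betw (fa l) (LA1 (ms l)) (LA2 (ms l))"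
      and eqv: "PV.level_equivariant (ms l) (fv l)" and eqa: "PA.level_equivariant (ms l) (fa l)"
      using Il by - (elim conjE, assumption)+
    note fvc = bij_betw_apply[OF bv] and fac = bij_betw_apply[OF ba]
    show "descends G1 G2 X1 X2 (ms k) (Ev k) (Ea k) (ms j) (Ev j) (Ea j)"
      unfolding descends_def quotient_graph_simps Ej Ek dv_def da_def
    proof (intro conjI ballI)
      fix p assume "p \<in> LV1 (ms k)"
      then obtain q where q: "q \<in> LV1 (ms l)" "set_act (vact X1) (K G1 (ms k)) q = p"
        using X1.V.level_proj_surj[OF mkl] by blast
      show "PV.descent (ms j) (ms l) (fv l) (set_act (vact X1) (K G1 (ms j)) p)
          = set_act (vact X2) (K G2 (ms j)) (PV.descent (ms k) (ms l) (fv l) p)"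
      proof -
        have "PV.descent (ms j) (ms l) (fv l) (set_act (vact X1) (K G1 (ms j)) p) = set_act (vact X2) (K G2 (ms j)) (fv l q)"
          using PV.descent_apply[OF eqv fvc mjl q(1)] X1.V.level_proj_proj[OF mjk mkl q(1)] q(2) by simp
        moreover have "PV.descent (ms k) (ms l) (fv l) p = set_act (vact X2) (K G2 (ms k)) (fv l q)"
          using PV.descent_apply[OF eqv fvc mkl q(1)] q(2) by simp
        ultimately show ?thesis using X2.V.level_proj_proj[OF mjk mkl fvc[OF q(1)]] by simp
      qed
    next
      fix p assume "p \<in> LA1 (ms k)"
      then obtain q where q: "q \<in> LA1 (ms l)" "set_act (aact X1) (K G1 (ms k)) q = p"
        using X1.A.level_proj_surj[OF mkl] by blast
      show "PA.descent (ms j) (ms l) (fa l) (set_act (aact X1) (K G1 (ms j)) p)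
          = set_act (aact X2) (K G2 (ms j)) (PA.descent (ms k) (ms l) (fa l) p)"
      proof -
        have "PA.descent (ms j) (ms l) (fa l) (set_act (aact X1) (K G1 (ms j)) p) = set_act (aact X2) (K G2 (ms j)) (fa l q)"
          using PA.descent_apply[OF eqa fac mjl q(1)] X1.A.level_proj_proj[OF mjk mkl q(1)] q(2) by simp
        moreover have "PA.descent (ms k) (ms l) (fa l) p = set_act (aact X2) (K G2 (ms k)) (fa l q)"
          using PA.descent_apply[OF eqa fac mkl q(1)] q(2) by simp
        ultimately show ?thesis using X2.A.level_proj_proj[OF mjk mkl fac[OF q(1)]] by simp
      qed
    qed
  qed
qed

lemma limit_completed_iso:
  fixes ms :: "nat \<Rightarrow> nat"
  assumes mono: "mono ms" and unb: "\<And>n. \<exists>j. n \<le> ms j"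
    and iso: "\<And>j. level_iso G1 G2 \<Phi> X1 X2 \<Lambda> Z1 Z2 (ms j) \<sigma> (Ev j) (Ea j)"
    and desc: "\<And>j k. j \<le> k \<Longrightarrow> descends G1 G2 X1 X2 (ms k) (Ev k) (Ea k) (ms j) (Ev j) (Ea j)"
    and \<sigma>: "\<And>l. l \<in> \<Lambda> \<Longrightarrow> \<sigma> l \<in> \<Lambda>"
    and Z1: "\<forall>l\<in>\<Lambda>. invariant_subgraph G1 X1 (Z1 l)"
    and Z2: "\<forall>l\<in>\<Lambda>. invariant_subgraph G2 X2 (Z2 l)"
  obtains Fv Fa where "is_limit_of G1 X1 ms Ev Ea Fv Fa"
    "completed_iso G1 G2 \<Phi> X1 X2 \<Lambda> Z1 Z2 \<sigma> Fv Fa"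
proof -
  have bv: "bij_betw (Ev j) (LV1 (ms j)) (LV2 (ms j))" and ba: "bij_betw (Ea j) (LA1 (ms j)) (LA2 (ms j))"
    and ends: "\<forall>a\<in>LA1 (ms j). tail X2 ` Ea j a = Ev j (tail X1 ` a) \<and> head X2 ` Ea j a = Ev j (head X1 ` a)"
    and rev: "case (reversal X1, reversal X2) of (None, None) \<Rightarrow> True
      | (Some r, Some r') \<Rightarrow> (\<forall>a\<in>LA1 (ms j). r' ` Ea j a = Ea j (r ` a)) | _ \<Rightarrow> False"
    and eqv: "PV.level_equivariant (ms j) (Ev j)" and eqa: "PA.level_equivariant (ms j) (Ea j)"
    and img: "\<forall>l\<in>\<Lambda>. Ev j ` level G1 (vact X1) (fst (Z1 l)) (ms j) = level G2 (vact X2) (fst (Z2 (\<sigma> l))) (ms j) \<and>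
            Ea j ` level G1 (aact X1) (snd (Z1 l)) (ms j) = level G2 (aact X2) (snd (Z2 (\<sigma> l))) (ms j)" for j
    using iso[of j, unfolded level_iso_iff] by - (elim conjE, assumption)+
  interpret TV: tower_iso G1 "verts X1" "vact X1" G2 "verts X2" "vact X2" ms Ev
  proof unfold_locales
    show "Ev j (set_act (vact X1) (K G1 (ms j)) p) = set_act (vact X2) (K G2 (ms j)) (Ev k p)"
      if "j \<le> k" "p \<in> LV1 (ms k)" for j k p
      using desc[OF that(1)] that(2) unfolding descends_def quotient_graph_simps by blast
  qed (rule mono unb bv bij_betw_apply[OF bv], assumption?)+
  interpret TA: tower_iso G1 "arcs X1" "aact X1" G2 "arcs X2" "aact X2" ms Ea
  proof unfold_locales
    show "Ea j (set_act (aact X1) (K G1 (ms j)) p) = set_act (aact X2) (K G2 (ms j)) (Ea k p)"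
      if "j \<le> k" "p \<in> LA1 (ms k)" for j k p
      using desc[OF that(1)] that(2) unfolding descends_def quotient_graph_simps by blast
  qed (rule mono unb ba bij_betw_apply[OF ba], assumption?)+
  note tv = TV.tower_map_axioms and ta = TA.tower_map_axioms
  have "is_limit_of G1 X1 ms Ev Ea TV.lim_map TA.lim_map"
    unfolding is_limit_of_def completed_graph_simps using TV.lim_map_at TA.lim_map_at by blast
  moreover have "completed_iso G1 G2 \<Phi> X1 X2 \<Lambda> Z1 Z2 \<sigma> TV.lim_map TA.lim_map"
    unfolding completed_iso_def Let_def graph_iso_def completed_graph_simps sub_simps equivariant_def
      completed_topology_simps
  proof (intro conjI ballI)
    fix a assume a: "a \<in> AA1"
    show "levelwise (tail X2) (TA.lim_map a) = TV.lim_map (levelwise (tail X1) a)"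
      by (rule lim_map_commute[OF ta tv X1.T.action_map_axioms X2.T.action_map_axioms _ a])
        (use ends in simp)
    show "levelwise (head X2) (TA.lim_map a) = TV.lim_map (levelwise (head X1) a)"
      by (rule lim_map_commute[OF ta tv X1.H.action_map_axioms X2.H.action_map_axioms _ a])
        (use ends in simp)
  next
    fix x p assume x: "x \<in> carrier PC1" and p: "p \<in> VV1"
    show "TV.lim_map (completed_act G1 (vact X1) x p) = completed_act G2 (vact X2) (\<Phi> x) (TV.lim_map p)"
      by (rule lim_map_equivariant[OF PV.action_pair_axioms tv eqv x p])
  next
    fix x p assume x: "x \<in> carrier PC1" and p: "p \<in> AA1"
    show "TA.lim_map (completed_act G1 (aact X1) x p) = completed_act G2 (aact X2) (\<Phi> x) (TA.lim_map p)"
      by (rule lim_map_equivariant[OF PA.action_pair_axioms ta eqa x p])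
  next
    fix l assume l: "l \<in> \<Lambda>"
    have Z: "fst (Z1 l) \<subseteq> verts X1" "snd (Z1 l) \<subseteq> arcs X1" "fst (Z2 (\<sigma> l)) \<subseteq> verts X2" "snd (Z2 (\<sigma> l)) \<subseteq> arcs X2"
      using Z1 Z2 l \<sigma>[OF l] by (simp_all add: invariant_subgraph_def)
    show "TV.lim_map ` climit G1 (vact X1) (fst (Z1 l)) = climit G2 (vact X2) (fst (Z2 (\<sigma> l)))"
      by (rule TV.lim_map_image[OF Z(1,3)]) (use img l in simp)
    show "TA.lim_map ` climit G1 (aact X1) (snd (Z1 l)) = climit G2 (aact X2) (snd (Z2 (\<sigma> l)))"
      by (rule TA.lim_map_image[OF Z(2,4)]) (use img l in simp)
  next
    show "case (map_option levelwise (reversal X1), map_option levelwise (reversal X2)) of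
        (None, None) \<Rightarrow> True | (Some r, Some r') \<Rightarrow> (\<forall>a\<in>AA1. r' (TA.lim_map a) = TA.lim_map (r a)) | _ \<Rightarrow> False"
    proof (cases "reversal X1")
      case None
      then show ?thesis using rev by (cases "reversal X2") simp_all
    next
      case (Some r)
      then obtain r' where r': "reversal X2 = Some r'" using rev by (cases "reversal X2") simp_all
      have "levelwise r' (TA.lim_map a) = TA.lim_map (levelwise r a)" if a: "a \<in> AA1" for a
        by (rule lim_map_commute[OF ta ta X1.action_map_reversal[OF Some] X2.action_map_reversal[OF r'] _ a])
          (use rev in \<open>simp add: Some r'\<close>)
      then show ?thesis by (simp add: Some r')
    qed
  qed (rule TV.lim_map_bij TA.lim_map_bij TV.lim_map_homeomorphic TA.lim_map_homeomorphic)+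
  ultimately show thesis by (rule that)
qed

end

theorem theorem2p4:
  fixes G1 :: "'g monoid" and G2 :: "'h monoid"
    and X1 :: "('g, 'v, 'a) group_graph" and X2 :: "('h, 'w, 'b) group_graph"
    and \<Lambda> :: "'l set"
    and Z1 :: "'l \<Rightarrow> 'v set \<times> 'a set" and Z2 :: "'l \<Rightarrow> 'w set \<times> 'b set"
    and P :: "('l \<Rightarrow> 'l) set"
    and \<Phi> :: "('g set \<Rightarrow> 'g set) \<Rightarrow> ('h set \<Rightarrow> 'h set)"
  assumes "group G1" "finitely_generated G1" "residually_finite G1"
    and "group G2" "finitely_generated G2" "residually_finite G2"
    and "directed_multigraph X1" "connected_multigraph X1" "locally_finite X1"
    and "directed_multigraph X2" "connected_multigraph X2" "locally_finite X2"
    and "acts_on_graph G1 X1" "cocompact G1 X1" "finite_vertex_stabilizers G1 X1"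
    and "acts_on_graph G2 X2" "cocompact G2 X2" "finite_vertex_stabilizers G2 X2"
    and "finite \<Lambda>"
    and "\<forall>l\<in>\<Lambda>. invariant_subgraph G1 X1 (Z1 l)"
    and "\<forall>l\<in>\<Lambda>. invariant_subgraph G2 X2 (Z2 l)"
    and "subgroup P (BijGroup \<Lambda>)"
    and "\<Phi> \<in> iso (profinite_completion G1) (profinite_completion G2)"
    and "continuous_map (profinite_topology G1) (profinite_topology G2) \<Phi>"
  shows
    "(\<forall>ms :: nat \<Rightarrow> nat.
        mono ms \<and> (\<forall>n. \<exists>j. n \<le> ms j) \<and>
        (\<forall>j. \<exists>\<sigma>\<in>P. \<exists>fv fa. level_iso G1 G2 \<Phi> X1 X2 \<Lambda> Z1 Z2 (ms j) \<sigma> fv fa)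
        \<longrightarrow>
        (\<exists>\<sigma>\<in>P. \<exists>Ev Ea Fv Fa.
           (\<forall>j. level_iso G1 G2 \<Phi> X1 X2 \<Lambda> Z1 Z2 (ms j) \<sigma> (Ev j) (Ea j)) \<and>
           (\<forall>j k. j \<le> k \<longrightarrow> descends G1 G2 X1 X2 (ms k) (Ev k) (Ea k) (ms j) (Ev j) (Ea j)) \<and>
           is_limit_of G1 X1 ms Ev Ea Fv Fa \<and>
           completed_iso G1 G2 \<Phi> X1 X2 \<Lambda> Z1 Z2 \<sigma> Fv Fa \<and>
           discretizes G1 G2 \<Phi> X1 X2 \<Lambda> Z1 Z2 \<sigma> Fv Fa))
     \<and>
     (\<forall>\<sigma>\<in>P. \<forall>Fv Fa.
        completed_iso G1 G2 \<Phi> X1 X2 \<Lambda> Z1 Z2 \<sigma> Fv Fa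
        \<longrightarrow> discretizes G1 G2 \<Phi> X1 X2 \<Lambda> Z1 Z2 \<sigma> Fv Fa)"
proof -
  interpret graph_pair_iso G1 X1 G2 X2 \<Phi>
    using assms
    by (simp add: graph_pair_iso_def graph_pair_def graph_action_def completion_iso_def
        completion_iso_axioms_def fg_group_def fg_group_axioms_def)
  have PB: "P \<subseteq> Bij \<Lambda>"
    using subgroup.subset[OF \<open>subgroup P (BijGroup \<Lambda>)\<close>] by (simp add: BijGroup_def)
  have "Bij \<Lambda> \<subseteq> \<Lambda> \<rightarrow> \<Lambda>" by (auto simp: Bij_def dest: bij_betw_imp_funcset)
  then have PF: "P \<subseteq> \<Lambda> \<rightarrow> \<Lambda>" using PB by (rule order_trans[rotated])
  have P\<Lambda>: "\<sigma> l \<in> \<Lambda>" if "\<sigma> \<in> P" "l \<in> \<Lambda>" for \<sigma> l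
    using subsetD[OF PF that(1)] that(2) by blast
  \<comment> \<open>Members of \<open>Bij \<Lambda>\<close> are extensional, which bounds
    \<open>P\<close> by a finite function space although \<open>'l\<close> itself may be
    infinite.\<close>
  have "Bij \<Lambda> \<subseteq> \<Lambda> \<rightarrow>\<^sub>E \<Lambda>"
    by (auto simp: Bij_def PiE_def dest: bij_betw_imp_funcset)
  then have "finite P"
    using PB \<open>finite \<Lambda>\<close> finite_PiE[of \<Lambda> "\<lambda>_. \<Lambda>"] by (meson finite_subset)
  note Z = \<open>\<forall>l\<in>\<Lambda>. invariant_subgraph G1 X1 (Z1 l)\<close> \<open>\<forall>l\<in>\<Lambda>. invariant_subgraph G2 X2 (Z2 l)\<close>
  have b: "discretizes G1 G2 \<Phi> X1 X2 \<Lambda> Z1 Z2 \<sigma> Fv Fa"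
    if "\<sigma> \<in> P" "completed_iso G1 G2 \<Phi> X1 X2 \<Lambda> Z1 Z2 \<sigma> Fv Fa" for \<sigma> Fv Fa
    by (rule completed_iso_discretizes[OF that(2) P\<Lambda>[OF that(1)] Z])
  show ?thesis
  proof (intro conjI allI impI ballI)
    fix ms :: "nat \<Rightarrow> nat"
    assume "mono ms \<and> (\<forall>n. \<exists>j. n \<le> ms j) \<and>
        (\<forall>j. \<exists>\<sigma>\<in>P. \<exists>fv fa. level_iso G1 G2 \<Phi> X1 X2 \<Lambda> Z1 Z2 (ms j) \<sigma> fv fa)"
    then have ms: "mono ms" "\<And>n. \<exists>j. n \<le> ms j"
      and isos: "\<And>j. \<exists>\<sigma>\<in>P. \<exists>fv fa. level_iso G1 G2 \<Phi> X1 X2 \<Lambda> Z1 Z2 (ms j) \<sigma> fv fa"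
      by blast+
    obtain \<sigma> Ev Ea where \<sigma>: "\<sigma> \<in> P"
      and E: "\<And>j. level_iso G1 G2 \<Phi> X1 X2 \<Lambda> Z1 Z2 (ms j) \<sigma> (Ev j) (Ea j)"
        "\<And>j k. j \<le> k \<Longrightarrow> descends G1 G2 X1 X2 (ms k) (Ev k) (Ea k) (ms j) (Ev j) (Ea j)"
      using compatible_level_isos[where ms = ms and P = P and \<Lambda> = \<Lambda> and ?Z1.0 = Z1 and ?Z2.0 = Z2, OF ms(1) isos \<open>cocompact G1 X1\<close> \<open>finite P\<close> PF Z] by blast
    obtain Fv Fa where F: "is_limit_of G1 X1 ms Ev Ea Fv Fa"
      "completed_iso G1 G2 \<Phi> X1 X2 \<Lambda> Z1 Z2 \<sigma> Fv Fa"
      using limit_completed_iso[where ms = ms and Ev = Ev and Ea = Ea and \<Lambda> = \<Lambda> and ?Z1.0 = Z1 and ?Z2.0 = Z2 and \<sigma> = \<sigma>, OF ms E P\<Lambda>[OF \<sigma>] Z] by blast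
    show "\<exists>\<sigma>\<in>P. \<exists>Ev Ea Fv Fa.
           (\<forall>j. level_iso G1 G2 \<Phi> X1 X2 \<Lambda> Z1 Z2 (ms j) \<sigma> (Ev j) (Ea j)) \<and>
           (\<forall>j k. j \<le> k \<longrightarrow> descends G1 G2 X1 X2 (ms k) (Ev k) (Ea k) (ms j) (Ev j) (Ea j)) \<and>
           is_limit_of G1 X1 ms Ev Ea Fv Fa \<and>
           completed_iso G1 G2 \<Phi> X1 X2 \<Lambda> Z1 Z2 \<sigma> Fv Fa \<and>
           discretizes G1 G2 \<Phi> X1 X2 \<Lambda> Z1 Z2 \<sigma> Fv Fa"
      using \<sigma> E F b[OF \<sigma> F(2)] by blast
  qed (rule b)
qed

end
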